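(* Let $V\subset\mathbb{R}\times C_n$ be open and let $g:V\to\mathbb{R}^n$ be $C^1_{\ast}$-smooth. Then the set $$dom=\{(t,t_0,\phi)\in\mathbb{R}^2\times C_n:t_0\le t,\ (t-t_0,t_{0\ast},\phi)\in\Omega_g\}$$ is an open subset of $\{(t,t_0)\in\mathbb{R}^2:t_0\le t\}\times C_n$, and the process $P:\{(t,t_0)\in\mathbb{R}^2:t_0\le t\}\times C_n\supset dom\to C_n$ given by $$P(t,t_0,\phi)=p_n\Sigma_g(t-t_0,t_{0\ast},\phi)$$ is continuous. For every $t\ge t_0$ with $\emptyset\neq\Omega_{g,t-t_0}\subset U_g\subset C_{n+1}$ the set $$dom_{t,t_0}=\{\phi\in C_n:(t,t_0,\phi)\in dom\}=\{\phi\in C_n:(t_{0\ast},\phi)\in\Omega_{g,t-t_0}\}$$ is non-empty and open, and the map $$P(t,t_0,\cdot):C_n\supset dom_{t,t_0}\to C_n$$ is $C^1_{\ast}$-smooth.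
   Context: For $m\in\mathbb{N}$, $C_m=C((-\infty,0],\mathbb{R}^m)$ is the Fréchet space of continuous maps $(-\infty,0]\to\mathbb{R}^m$ with the topology of locally uniform convergence. Fix $n\in\mathbb{N}$. The symbol $\ast$ is either $MB$ or $F$ (the result is asserted in each case, with the same $\ast$ in hypothesis and conclusion). Smoothness: Let $X,W$ be topological vector spaces, $O\subset X$ open, $h:O\to W$ continuous, $Dh(u)v=\lim_{0\neq t\to0}\frac1t(h(u+tv)-h(u))$. The map $h$ is $C^1_{MB}$-smooth if all directional derivatives exist and $O\times X\ni(u,v)\mapsto Dh(u)v\in W$ is continuous. It is $C^1_F$-smooth if all directional derivatives exist, each $Dh(u):X\to W$ is linear and continuous, and $O\ni u\mapsto Dh(u)\in L_c(X,W)$ is continuous with respect to the topology of uniform convergence on bounded sets on the space $L_c(X,W)$ of continuous linear maps $X\to W$. For $t\in\mathbb{R}$ define $t_{\ast}\in C_1$ by $t_{\ast}(u)=t+u$; thus $t_{0\ast}(u)=t_0+u$. Identify $C_{n+1}=C_1\times C_n$, let $\psi_1$ denote the first component of $\psi\in C_{n+1}$, and let $p_n:C_{n+1}\to C_n$ be the continuous linear map forgetting the first component. Set $U_g=\{\psi\in C_{n+1}:(\psi_1(0),p_n\psi)\in V\}$ and $f_g:U_g\to\mathbb{R}^{n+1}$, $f_g(\psi)=(1,g(\psi_1(0),p_n\psi))$. Segments: $y_t(s)=y(t+s)$ for $s\le0$. A solution of $y'(t)=f_g(y_t)$ on an interval $I$ is a continuous map $y:(-\infty,0]+I\to\mathbb{R}^{n+1}$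 with $y_t\in U_g$ for all $t\in I$, $y|_I$ differentiable, and $y'(t)=f_g(y_t)$ for all $t\in I$ (one-sided derivatives at endpoints belonging to $I$). For each $\psi\in U_g$ there is a unique maximal solution $y^{\psi}$ on some interval $[0,t_\psi)$, $0<t_\psi\le\infty$, with $y^\psi_0=\psi$. Set $\Omega_g=\{(t,\psi)\in[0,\infty)\times U_g:t<t_\psi\}$, $\Sigma_g:\Omega_g\to U_g\subset C_{n+1}$, $\Sigma_g(t,\psi)=y^\psi_t$, and, for $s\ge0$, $\Omega_{g,s}=\{\psi\in U_g:(s,\psi)\in\Omega_g\}$. Here $(s,t_{0\ast},\phi)$ stands for $(s,(t_{0\ast},\phi))\in[0,\infty)\times C_{n+1}$.
   Formalization: Non-emptiness of dom_{t,t0} is claimed only if Ω_{g,t-t0} contains some (t_{0*},φ), since Ω_{g,t-t0} ≠ ∅ alone does not suffice (V=(0,1)×C_n, g=0, t=t_0=5 gives an empty dom_{t,t0}); with this condition that clause is immediate. *)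

theory Defs
  imports "HOL-Analysis.Analysis"
begin

section \<open>The space of continuous maps on the nonpositive half-line\<close>

text \<open>
  A continuous map on \<open>(-\<infinity>, 0]\<close> is represented by its extension by \<open>0\<close>
  to the positive half-line, so that equality of representatives is equality on \<open>(-\<infinity>, 0]\<close>.
\<close>

typedef (overloaded) 'b hist =
  "{\<phi> :: real \<Rightarrow> 'b::real_normed_vector. continuous_on {..0} \<phi> \<and> (\<forall>s>0. \<phi> s = 0)}"
  morphisms hist_apply Abs_hist
  by (rule exI[of _ "\<lambda>_. 0"]) simp

setup_lifting type_definition_hist

text \<open>The restriction of \<open>f\<close> to \<open>(-\<infinity>, 0]\<close>; only meaningful if \<open>f\<close> is continuous on \<open>(-\<infinity>, 0]\<close>.\<close>

definition hist_of :: "(real \<Rightarrow> 'b::real_normed_vector) \<Rightarrow> 'b hist" where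
  "hist_of f = Abs_hist (\<lambda>s. if s \<le> 0 then f s else 0)"

lemma hist_apply_hist_of:
  assumes "continuous_on {..0} f" "s \<le> 0"
  shows "hist_apply (hist_of f) s = f s"
proof -
  have "continuous_on {..0} (\<lambda>s. if s \<le> 0 then f s else 0)"
    using assms(1) by (subst continuous_on_cong[OF refl, where g = f]) auto
  then show ?thesis
    using assms(2) by (simp add: hist_of_def Abs_hist_inverse)
qed

instantiation hist :: (real_normed_vector) real_vector
begin

lift_definition zero_hist :: "'a hist" is "\<lambda>_. 0" by simp
lift_definition plus_hist :: "'a hist \<Rightarrow> 'a hist \<Rightarrow> 'a hist" is "\<lambda>f g s. f s + g s"
  by (auto intro: continuous_on_add)
lift_definition minus_hist :: "'a hist \<Rightarrow> 'a hist \<Rightarrow> 'a hist" is "\<lambda>f g s. f s - g s"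
  by (auto intro: continuous_on_diff)
lift_definition uminus_hist :: "'a hist \<Rightarrow> 'a hist" is "\<lambda>f s. - f s"
  by (auto intro: continuous_on_minus)
lift_definition scaleR_hist :: "real \<Rightarrow> 'a hist \<Rightarrow> 'a hist" is "\<lambda>c f s. c *\<^sub>R f s"
  by (auto intro: continuous_on_scaleR)

instance
  by standard (transfer; simp add: algebra_simps fun_eq_iff)+

end

text \<open>The topology of locally uniform convergence.\<close>

instantiation hist :: (real_normed_vector) t2_space
begin

definition open_hist :: "'a hist set \<Rightarrow> bool" where
  "open_hist S \<longleftrightarrow> (\<forall>\<phi>\<in>S. \<exists>T e. 0 < e \<and>
     {\<zeta>. \<forall>s\<in>{-T..0}. norm (hist_apply \<zeta> s - hist_apply \<phi> s) < e} \<subseteq> S)"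

instance
proof
  show "open (UNIV :: 'a hist set)"
    unfolding open_hist_def by (auto intro: exI[of _ 1])
next
  fix S U :: "'a hist set"
  assume S: "open S" and U: "open U"
  show "open (S \<inter> U)"
    unfolding open_hist_def
  proof
    fix \<phi> assume "\<phi> \<in> S \<inter> U"
    then obtain T e T' e' where
      1: "0 < e" "{\<zeta>. \<forall>s\<in>{-T..0}. norm (hist_apply \<zeta> s - hist_apply \<phi> s) < e} \<subseteq> S" and
      2: "0 < e'" "{\<zeta>. \<forall>s\<in>{-T'..0}. norm (hist_apply \<zeta> s - hist_apply \<phi> s) < e'} \<subseteq> U"
      using S U unfolding open_hist_def by blast
    have "{\<zeta>. \<forall>s\<in>{- max T T'..0}. norm (hist_apply \<zeta> s - hist_apply \<phi> s) < min e e'}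
        \<subseteq> {\<zeta>. \<forall>s\<in>{-T..0}. norm (hist_apply \<zeta> s - hist_apply \<phi> s) < e} \<inter>
          {\<zeta>. \<forall>s\<in>{-T'..0}. norm (hist_apply \<zeta> s - hist_apply \<phi> s) < e'}"
      by auto
    moreover have "0 < min e e'" using 1 2 by simp
    ultimately show "\<exists>T e. 0 < e \<and>
        {\<zeta>. \<forall>s\<in>{-T..0}. norm (hist_apply \<zeta> s - hist_apply \<phi> s) < e} \<subseteq> S \<inter> U"
      using 1 2 by (meson Int_mono subset_trans)
  qed
next
  fix K :: "'a hist set set"
  assume "\<forall>S\<in>K. open S"
  then show "open (\<Union>K)"
    unfolding open_hist_def by (meson UnionE Union_upper subset_trans)
next
  fix \<phi> \<zeta> :: "'a hist"
  assume "\<phi> \<noteq> \<zeta>"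
  then obtain s where ne: "hist_apply \<phi> s \<noteq> hist_apply \<zeta> s"
    by (metis ext hist_apply_inject)
  have s: "s \<le> 0"
    using ne hist_apply[of \<phi>] hist_apply[of \<zeta>] by (metis (mono_tags, lifting) mem_Collect_eq not_le)
  define e where "e = norm (hist_apply \<phi> s - hist_apply \<zeta> s) / 2"
  have e: "0 < e" using ne by (simp add: e_def)
  define B where "B = (\<lambda>\<psi>::'a hist. {\<xi>. norm (hist_apply \<xi> s - hist_apply \<psi> s) < e})"
  have "open (B \<psi>)" for \<psi>
    unfolding open_hist_def
  proof
    fix \<xi> assume "\<xi> \<in> B \<psi>"
    then have *: "0 < e - norm (hist_apply \<xi> s - hist_apply \<psi> s)"
      by (simp add: B_def)
    have "{\<zeta>. \<forall>r\<in>{-(-s)..0}. norm (hist_apply \<zeta> r - hist_apply \<xi> r)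
            < e - norm (hist_apply \<xi> s - hist_apply \<psi> s)} \<subseteq> B \<psi>"
    proof
      fix \<eta>
      assume "\<eta> \<in> {\<zeta>. \<forall>r\<in>{-(-s)..0}. norm (hist_apply \<zeta> r - hist_apply \<xi> r)
            < e - norm (hist_apply \<xi> s - hist_apply \<psi> s)}"
      then have "norm (hist_apply \<eta> s - hist_apply \<xi> s)
            < e - norm (hist_apply \<xi> s - hist_apply \<psi> s)"
        using s by simp
      then show "\<eta> \<in> B \<psi>"
        using norm_triangle_ineq[of "hist_apply \<eta> s - hist_apply \<xi> s"
            "hist_apply \<xi> s - hist_apply \<psi> s"]
        by (simp add: B_def)
    qed
    with * show "\<exists>T d. 0 < d \<and>
        {\<zeta>. \<forall>s\<in>{-T..0}. norm (hist_apply \<zeta> s - hist_apply \<xi> s) < d} \<subseteq> B \<psi>"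
      by blast
  qed
  moreover have "\<phi> \<in> B \<phi>" "\<zeta> \<in> B \<zeta>"
    using e by (simp_all add: B_def)
  moreover have "B \<phi> \<inter> B \<zeta> = {}"
  proof -
    have False if "\<xi> \<in> B \<phi>" "\<xi> \<in> B \<zeta>" for \<xi>
      using that norm_triangle_ineq[of "hist_apply \<phi> s - hist_apply \<xi> s"
          "hist_apply \<xi> s - hist_apply \<zeta> s"]
      by (simp add: B_def e_def norm_minus_commute)
    then show ?thesis by blast
  qed
  ultimately show "\<exists>U V. open U \<and> open V \<and> \<phi> \<in> U \<and> \<zeta> \<in> V \<and> U \<inter> V = {}"
    by blast
qed

end


section \<open>Continuous differentiability in topological vector spaces\<close>

text \<open>
  There is no type class of topological vector spaces in the library. The sort
  \<open>{real_vector, t2_space}\<close> suffices for the definitions; they are applied only to Hausdorff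
  topological vector spaces and intended for maps on open sets \<open>O'\<close>.
\<close>

definition dir_quotient ::
    "('a::real_vector \<Rightarrow> 'w::real_vector) \<Rightarrow> 'a \<Rightarrow> 'a \<Rightarrow> real \<Rightarrow> 'w" where
  "dir_quotient h u v = (\<lambda>t. (1 / t) *\<^sub>R (h (u + t *\<^sub>R v) - h u))"

definition has_dir_deriv ::
    "('a::real_vector \<Rightarrow> 'w::{real_vector,t2_space}) \<Rightarrow> 'a \<Rightarrow> 'a \<Rightarrow> bool" where
  "has_dir_deriv h u v \<longleftrightarrow> (\<exists>w. (dir_quotient h u v \<longlongrightarrow> w) (at 0))"

definition dir_deriv ::
    "('a::real_vector \<Rightarrow> 'w::{real_vector,t2_space}) \<Rightarrow> 'a \<Rightarrow> 'a \<Rightarrow> 'w" where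
  "dir_deriv h u v = Lim (at 0) (dir_quotient h u v)"

text \<open>Boundedness in the sense of von Neumann.\<close>

definition tvs_bounded :: "'a::{real_vector,topological_space} set \<Rightarrow> bool" where
  "tvs_bounded B \<longleftrightarrow>
     (\<forall>N. open N \<and> 0 \<in> N \<longrightarrow> (\<exists>r>0. \<forall>s\<ge>r. B \<subseteq> (\<lambda>x. s *\<^sub>R x) ` N))"

definition continuous_linear_maps ::
    "('a::{real_vector,topological_space} \<Rightarrow> 'w::{real_vector,topological_space}) set" where
  "continuous_linear_maps = {A. linear A \<and> continuous_on UNIV A}"

text \<open>
  The space of continuous linear maps with the topology of uniform convergence on bounded sets.
\<close>

definition Lc_open ::
    "('a::{real_vector,topological_space} \<Rightarrow> 'w::{real_vector,topological_space}) set \<Rightarrow> bool" where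
  "Lc_open S \<longleftrightarrow> S \<subseteq> continuous_linear_maps \<and>
     (\<forall>A\<in>S. \<exists>B N. tvs_bounded B \<and> open N \<and> 0 \<in> N \<and>
        {A' \<in> continuous_linear_maps. \<forall>v\<in>B. A' v - A v \<in> N} \<subseteq> S)"

definition Lc_topology ::
    "('a::{real_vector,topological_space} \<Rightarrow> 'w::{real_vector,topological_space}) topology" where
  "Lc_topology = topology Lc_open"

lemma tvs_bounded_empty: "tvs_bounded {}"
  unfolding tvs_bounded_def using zero_less_one by blast

lemma tvs_bounded_Un:
  assumes "tvs_bounded A" "tvs_bounded B"
  shows "tvs_bounded (A \<union> B)"
  unfolding tvs_bounded_def
proof (intro allI impI)
  fix N :: "'a set" assume N: "open N \<and> 0 \<in> N"
  obtain r where r: "r > 0" "\<forall>s\<ge>r. A \<subseteq> (\<lambda>x. s *\<^sub>R x) ` N"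
    using assms(1) N unfolding tvs_bounded_def by blast
  obtain r' where r': "r' > 0" "\<forall>s\<ge>r'. B \<subseteq> (\<lambda>x. s *\<^sub>R x) ` N"
    using assms(2) N unfolding tvs_bounded_def by blast
  show "\<exists>r>0. \<forall>s\<ge>r. A \<union> B \<subseteq> (\<lambda>x. s *\<^sub>R x) ` N"
    using r r' by (intro exI[of _ "max r r'"]) auto
qed

lemma istopology_Lc_open: "istopology Lc_open"
  unfolding istopology_def
proof (intro conjI allI impI)
  fix S T :: "('a \<Rightarrow> 'b) set"
  assume S: "Lc_open S" and T: "Lc_open T"
  show "Lc_open (S \<inter> T)"
    unfolding Lc_open_def
  proof (intro conjI ballI)
    show "S \<inter> T \<subseteq> continuous_linear_maps" using S unfolding Lc_open_def by blast
  next
    fix A assume A: "A \<in> S \<inter> T"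
    obtain B N where 1: "tvs_bounded B" "open N" "0 \<in> N"
      "{A' \<in> continuous_linear_maps. \<forall>v\<in>B. A' v - A v \<in> N} \<subseteq> S"
      using S A unfolding Lc_open_def by (meson IntD1)
    obtain B' N' where 2: "tvs_bounded B'" "open N'" "0 \<in> N'"
      "{A' \<in> continuous_linear_maps. \<forall>v\<in>B'. A' v - A v \<in> N'} \<subseteq> T"
      using T A unfolding Lc_open_def by (meson IntD2)
    show "\<exists>B N. tvs_bounded B \<and> open N \<and> 0 \<in> N \<and>
        {A' \<in> continuous_linear_maps. \<forall>v\<in>B. A' v - A v \<in> N} \<subseteq> S \<inter> T"
      using 1 2 tvs_bounded_Un[OF 1(1) 2(1)]
      by (intro exI[of _ "B \<union> B'"] exI[of _ "N \<inter> N'"]) (auto simp: open_Int)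
  qed
next
  fix K :: "('a \<Rightarrow> 'b) set set"
  assume "\<forall>S\<in>K. Lc_open S"
  then show "Lc_open (\<Union>K)"
    unfolding Lc_open_def by (meson Sup_least UnionE Union_upper subset_trans)
qed

lemma openin_Lc_topology: "openin Lc_topology S \<longleftrightarrow> Lc_open S"
  by (simp add: Lc_topology_def istopology_Lc_open topology_inverse')

definition C1_MB ::
    "'a::{real_vector,t2_space} set \<Rightarrow> ('a \<Rightarrow> 'w::{real_vector,t2_space}) \<Rightarrow> bool" where
  "C1_MB O' h \<longleftrightarrow>
     continuous_on O' h \<and>
     (\<forall>u\<in>O'. \<forall>v. has_dir_deriv h u v) \<and>
     continuous_on (O' \<times> UNIV) (\<lambda>(u, v). dir_deriv h u v)"

definition C1_F ::
    "'a::{real_vector,t2_space} set \<Rightarrow> ('a \<Rightarrow> 'w::{real_vector,t2_space}) \<Rightarrow> bool" where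
  "C1_F O' h \<longleftrightarrow>
     continuous_on O' h \<and>
     (\<forall>u\<in>O'. \<forall>v. has_dir_deriv h u v) \<and>
     (\<forall>u\<in>O'. dir_deriv h u \<in> continuous_linear_maps) \<and>
     continuous_map (top_of_set O') Lc_topology (dir_deriv h)"

datatype smoothness = MB | F

fun C1_smooth ::
    "smoothness \<Rightarrow> 'a::{real_vector,t2_space} set \<Rightarrow> ('a \<Rightarrow> 'w::{real_vector,t2_space}) \<Rightarrow> bool" where
  "C1_smooth MB O' h = C1_MB O' h"
| "C1_smooth F O' h = C1_F O' h"


section \<open>The autonomous equation and its semiflow\<close>

text \<open>
  \<open>C\<^sub>n\<^sub>+\<^sub>1\<close> is the product \<open>C\<^sub>1 \<times> C\<^sub>n\<close>, that is, \<open>real hist \<times> (real ^ 'n) hist\<close>, and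
  \<open>\<real>\<^sup>n\<^sup>+\<^sup>1\<close> is \<open>real \<times> (real ^ 'n)\<close>; the map \<open>p\<^sub>n\<close> is \<open>snd\<close>.
\<close>

type_synonym 'n Cn = "(real ^ 'n) hist"
type_synonym 'n Cn1 = "real hist \<times> (real ^ 'n) hist"

definition time_hist :: "real \<Rightarrow> real hist" where
  "time_hist t = hist_of (\<lambda>u. t + u)"

definition segment :: "(real \<Rightarrow> real \<times> (real ^ 'n)) \<Rightarrow> real \<Rightarrow> 'n::finite Cn1" where
  "segment y t = (hist_of (\<lambda>s. fst (y (t + s))), hist_of (\<lambda>s. snd (y (t + s))))"

definition U_g :: "(real \<times> 'n::finite Cn) set \<Rightarrow> 'n Cn1 set" where
  "U_g V = {\<psi>. (hist_apply (fst \<psi>) 0, snd \<psi>) \<in> V}"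

definition f_g :: "(real \<times> 'n::finite Cn \<Rightarrow> real ^ 'n) \<Rightarrow> 'n Cn1 \<Rightarrow> real \<times> (real ^ 'n)" where
  "f_g g \<psi> = (1, g (hist_apply (fst \<psi>) 0, snd \<psi>))"

text \<open>Values of \<open>y\<close> outside \<open>(-\<infinity>, 0] + I\<close> are irrelevant.\<close>

definition is_solution ::
    "(real \<times> 'n::finite Cn) set \<Rightarrow> (real \<times> 'n Cn \<Rightarrow> real ^ 'n) \<Rightarrow>
     real set \<Rightarrow> (real \<Rightarrow> real \<times> (real ^ 'n)) \<Rightarrow> bool" where
  "is_solution V g I y \<longleftrightarrow>
     continuous_on {s + t | s t. s \<le> 0 \<and> t \<in> I} y \<and>
     (\<forall>t\<in>I. segment y t \<in> U_g V \<and>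
        (y has_vector_derivative f_g g (segment y t)) (at t within I))"

definition is_maximal_solution ::
    "(real \<times> 'n::finite Cn) set \<Rightarrow> (real \<times> 'n Cn \<Rightarrow> real ^ 'n) \<Rightarrow>
     'n Cn1 \<Rightarrow> ereal \<Rightarrow> (real \<Rightarrow> real \<times> (real ^ 'n)) \<Rightarrow> bool" where
  "is_maximal_solution V g \<psi> c y \<longleftrightarrow>
     0 < c \<and> is_solution V g {t. 0 \<le> t \<and> ereal t < c} y \<and> segment y 0 = \<psi> \<and>
     (\<forall>c' z. c \<le> c' \<and> is_solution V g {t. 0 \<le> t \<and> ereal t < c'} z \<and>
        (\<forall>t. ereal t < c \<longrightarrow> z t = y t) \<longrightarrow> c' = c)"

definition t_max ::
    "(real \<times> 'n::finite Cn) set \<Rightarrow> (real \<times> 'n Cn \<Rightarrow> real ^ 'n) \<Rightarrow> 'n Cn1 \<Rightarrow> ereal" where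
  "t_max V g \<psi> = (THE c. \<exists>y. is_maximal_solution V g \<psi> c y)"

text \<open>
  A choice operator is used since the maximal solution is unique only on its domain.
\<close>

definition y_max ::
    "(real \<times> 'n::finite Cn) set \<Rightarrow> (real \<times> 'n Cn \<Rightarrow> real ^ 'n) \<Rightarrow>
     'n Cn1 \<Rightarrow> real \<Rightarrow> real \<times> (real ^ 'n)" where
  "y_max V g \<psi> = (SOME y. is_maximal_solution V g \<psi> (t_max V g \<psi>) y)"

definition Omega_g ::
    "(real \<times> 'n::finite Cn) set \<Rightarrow> (real \<times> 'n Cn \<Rightarrow> real ^ 'n) \<Rightarrow> (real \<times> 'n Cn1) set" where
  "Omega_g V g = {(t, \<psi>). 0 \<le> t \<and> \<psi> \<in> U_g V \<and> ereal t < t_max V g \<psi>}"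

definition Omega_g_at ::
    "(real \<times> 'n::finite Cn) set \<Rightarrow> (real \<times> 'n Cn \<Rightarrow> real ^ 'n) \<Rightarrow> real \<Rightarrow> 'n Cn1 set" where
  "Omega_g_at V g s = {\<psi> \<in> U_g V. (s, \<psi>) \<in> Omega_g V g}"

definition Sigma_g ::
    "(real \<times> 'n::finite Cn) set \<Rightarrow> (real \<times> 'n Cn \<Rightarrow> real ^ 'n) \<Rightarrow> real \<Rightarrow> 'n Cn1 \<Rightarrow> 'n Cn1" where
  "Sigma_g V g t \<psi> = segment (y_max V g \<psi>) t"


section \<open>The process\<close>

definition process_dom ::
    "(real \<times> 'n::finite Cn) set \<Rightarrow> (real \<times> 'n Cn \<Rightarrow> real ^ 'n) \<Rightarrow> (real \<times> real \<times> 'n Cn) set" where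
  "process_dom V g = {(t, t0, \<phi>). t0 \<le> t \<and> (t - t0, (time_hist t0, \<phi>)) \<in> Omega_g V g}"

definition process ::
    "(real \<times> 'n::finite Cn) set \<Rightarrow> (real \<times> 'n Cn \<Rightarrow> real ^ 'n) \<Rightarrow>
     real \<Rightarrow> real \<Rightarrow> 'n Cn \<Rightarrow> 'n Cn" where
  "process V g t t0 \<phi> = snd (Sigma_g V g (t - t0) (time_hist t0, \<phi>))"

definition process_dom_at ::
    "(real \<times> 'n::finite Cn) set \<Rightarrow> (real \<times> 'n Cn \<Rightarrow> real ^ 'n) \<Rightarrow> real \<Rightarrow> real \<Rightarrow> 'n Cn set" where
  "process_dom_at V g t t0 = {\<phi>. (t, t0, \<phi>) \<in> process_dom V g}"

end

theory Submission
  imports Defs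
begin

text \<open>
  The equation for \<open>(time_hist t0, \<phi>)\<close> is the nonautonomous equation \<open>x' t = g (t, x\<^sub>t)\<close> with
  \<open>x\<^sub>t\<^sub>0 = \<phi>\<close>. Joint continuity of the directional derivative of \<open>g\<close> and compactness of
  \<open>{(t, x\<^sub>t). a \<le> t \<le> b}\<close> provide a tube around a given path \<open>x\<close>, measured by one seminorm
  \<open>sup {norm (\<psi> u). - n \<le> u \<le> 0}\<close>, that lies in \<open>V\<close> and on which \<open>g\<close> is Lipschitz in the history
  with respect to this seminorm. Retracting histories pointwise into the tube makes the right-hand
  side globally Lipschitz, so solutions of the truncated equation exist on all of \<open>[a, b]\<close>; by a
  Gronwall estimate those with nearby initial data never feel the truncation. This gives local
  existence, openness of the domain and continuous dependence at once. The derivative of the process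
  in direction \<open>v\<close> is the solution of the linear variational equation along \<open>x\<close> with initial history
  \<open>v\<close>, again by the Gronwall estimate. Its continuity reduces to continuity of the derivative of \<open>g\<close>,
  uniformly over the set of all segments of the variational solutions involved: this set is compact for
  a single direction (\<open>C\<^sup>1\<^sub>M\<^sub>B\<close>) and bounded for a bounded set of directions (\<open>C\<^sup>1\<^sub>F\<close>).
\<close>

section \<open>Histories\<close>

text \<open>One seminorm suffices because a neighbourhood of the zero direction restricts histories
  only on some window \<open>{- real n..0}\<close>: continuity of the derivative at direction 0 and
  homogeneity turn this into a bound by the supremum over that window. Near a given path the
  infinite delay thus acts as a finite one: histories that agree on the window have the same value
  of \<open>g\<close>. The sets \<open>hist_nbhd n\<close> tie window length and radius to one
  index, and in a tube the same index is also the Lipschitz constant. All these conditions persist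
  when the index grows, so compactness of \<open>{a..b}\<close> amounts to taking a maximum.

  The definition of \<open>C1_MB\<close> does not state linearity of the derivative. Up to the
  \<open>C1_MB\<close> case the argument rests on homogeneity and on a Lipschitz bound inherited
  from the difference quotients of \<open>g\<close>; linearity enters only with \<open>C1_F\<close>,
  whose definition contains it. The directions are always \<open>(0, \<zeta>)\<close>, because the
  process is differentiated in \<open>\<phi>\<close> alone.\<close>

lemma continuous_on_hist_apply: "continuous_on {..0} (hist_apply \<phi>)"
  using hist_apply[of \<phi>] by simp

lemma hist_apply_pos: "s > 0 \<Longrightarrow> hist_apply \<phi> s = 0"
  using hist_apply[of \<phi>] by simp

lemma hist_eqI:
  assumes "\<And>s. s \<le> 0 \<Longrightarrow> hist_apply \<phi> s = hist_apply \<psi> s"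
  shows "\<phi> = \<psi>"
proof -
  have "hist_apply \<phi> s = hist_apply \<psi> s" for s
    using assms by (cases "s \<le> 0") (auto simp: hist_apply_pos)
  then show ?thesis by (metis ext hist_apply_inject)
qed

lemmas hist_apply_simps =
  zero_hist.rep_eq plus_hist.rep_eq minus_hist.rep_eq uminus_hist.rep_eq scaleR_hist.rep_eq

text \<open>A larger index means a longer window and a smaller radius, so these sets decrease and
  form a countable neighbourhood base.\<close>

definition hist_nbhd :: "nat \<Rightarrow> 'b::real_normed_vector hist \<Rightarrow> 'b hist set" where
  "hist_nbhd n \<phi> =
     {\<psi>. \<forall>u\<in>{- real n..0}. norm (hist_apply \<psi> u - hist_apply \<phi> u) < 1 / (real n + 1)}"

lemma hist_nbhd_self [simp]: "\<phi> \<in> hist_nbhd n \<phi>"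
  by (simp add: hist_nbhd_def)

lemma hist_nbhd_mono:
  assumes "m \<le> n"
  shows "hist_nbhd n \<phi> \<subseteq> hist_nbhd m \<phi>"
proof -
  have "1 / (real n + 1) \<le> 1 / (real m + 1)"
    using assms by (intro divide_left_mono) auto
  moreover have "- real n \<le> - real m" using assms by simp
  ultimately show ?thesis
    unfolding hist_nbhd_def by (auto intro: less_le_trans)
qed

text \<open>The window is compact, so the strict bounds at its points leave a common positive
  margin, the one at the point of largest deviation.\<close>

lemma open_hist_nbhd: "open (hist_nbhd n \<phi>)"
  unfolding open_hist_def
proof
  fix \<psi> assume \<psi>: "\<psi> \<in> hist_nbhd n \<phi>"
  have "continuous_on {- real n..0} (\<lambda>u. norm (hist_apply \<psi> u - hist_apply \<phi> u))"
    by (intro continuous_intros continuous_on_subset[OF continuous_on_hist_apply]) auto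
  then obtain u0 where u0: "u0 \<in> {- real n..0}"
    "\<And>u. u \<in> {- real n..0} \<Longrightarrow>
      norm (hist_apply \<psi> u - hist_apply \<phi> u) \<le> norm (hist_apply \<psi> u0 - hist_apply \<phi> u0)"
    using continuous_attains_sup[of "{- real n..0}" "\<lambda>u. norm (hist_apply \<psi> u - hist_apply \<phi> u)"]
    by auto
  define e where "e = 1 / (real n + 1) - norm (hist_apply \<psi> u0 - hist_apply \<phi> u0)"
  have e: "e > 0" using \<psi> u0(1) by (simp add: e_def hist_nbhd_def)
  have "{\<zeta>. \<forall>s\<in>{- real n..0}. norm (hist_apply \<zeta> s - hist_apply \<psi> s) < e} \<subseteq> hist_nbhd n \<phi>"
  proof
    fix \<zeta> assume \<zeta>: "\<zeta> \<in> {\<zeta>. \<forall>s\<in>{- real n..0}. norm (hist_apply \<zeta> s - hist_apply \<psi> s) < e}"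
    have "norm (hist_apply \<zeta> u - hist_apply \<phi> u) < 1 / (real n + 1)" if "u \<in> {- real n..0}" for u
    proof -
      have "norm (hist_apply \<zeta> u - hist_apply \<psi> u) < e" using \<zeta> that by simp
      then show ?thesis
        using u0(2)[OF that]
          norm_triangle_ineq[of "hist_apply \<zeta> u - hist_apply \<psi> u" "hist_apply \<psi> u - hist_apply \<phi> u"]
        by (simp add: e_def)
    qed
    then show "\<zeta> \<in> hist_nbhd n \<phi>" by (simp add: hist_nbhd_def)
  qed
  with e show "\<exists>T e. 0 < e \<and>
     {\<zeta>. \<forall>s\<in>{-T..0}. norm (hist_apply \<zeta> s - hist_apply \<psi> s) < e} \<subseteq> hist_nbhd n \<phi>"
    by blast
qed

lemma hist_nbhd_base:
  assumes "open S" "\<phi> \<in> S"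
  obtains n where "hist_nbhd n \<phi> \<subseteq> S"
proof -
  obtain T e where Te: "0 < e" "{\<zeta>. \<forall>s\<in>{-T..0}. norm (hist_apply \<zeta> s - hist_apply \<phi> s) < e} \<subseteq> S"
    using assms unfolding open_hist_def by blast
  obtain n :: nat where n: "real n \<ge> max T (1 / e)"
    using real_arch_simple by blast
  have "1 / e < real n + 1" using n by simp
  then have "1 / (real n + 1) < e"
    using Te(1) by (simp add: field_simps)
  then have "hist_nbhd n \<phi> \<subseteq> {\<zeta>. \<forall>s\<in>{-T..0}. norm (hist_apply \<zeta> s - hist_apply \<phi> s) < e}"
    using n unfolding hist_nbhd_def by (auto intro: less_trans)
  with Te that show thesis by blast
qed

lemma tendsto_hist_iff:
  "(f \<longlongrightarrow> l) G \<longleftrightarrow> (\<forall>n. eventually (\<lambda>x. f x \<in> hist_nbhd n l) G)"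
proof
  assume "(f \<longlongrightarrow> l) G"
  then show "\<forall>n. eventually (\<lambda>x. f x \<in> hist_nbhd n l) G"
    using open_hist_nbhd hist_nbhd_self unfolding tendsto_def by blast
next
  assume *: "\<forall>n. eventually (\<lambda>x. f x \<in> hist_nbhd n l) G"
  show "(f \<longlongrightarrow> l) G"
  proof (rule topological_tendstoI)
    fix S :: "'b hist set" assume "open S" "l \<in> S"
    then obtain n where n: "hist_nbhd n l \<subseteq> S" by (rule hist_nbhd_base)
    have "eventually (\<lambda>x. f x \<in> hist_nbhd n l) G" using * by blast
    then show "eventually (\<lambda>x. f x \<in> S) G"
      by (rule eventually_mono) (use n in blast)
  qed
qed

section \<open>Segments of paths on the real line\<close>

definition hist_at :: "(real \<Rightarrow> 'b::real_normed_vector) \<Rightarrow> real \<Rightarrow> 'b hist" where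
  "hist_at x s = hist_of (\<lambda>u. x (s + u))"

lemma hist_apply_hist_at:
  assumes "continuous_on {..s} x" "u \<le> 0"
  shows "hist_apply (hist_at x s) u = x (s + u)"
  unfolding hist_at_def
  using assms(2)
  by (intro hist_apply_hist_of continuous_on_compose2[OF assms(1)] continuous_intros) auto

lemma hist_apply_hist_at_UNIV:
  assumes "continuous_on UNIV x" "u \<le> 0"
  shows "hist_apply (hist_at x s) u = x (s + u)"
  using assms by (auto intro: hist_apply_hist_at continuous_on_subset)

lemma hist_at_cong:
  assumes "\<And>r. r \<le> s \<Longrightarrow> x r = y r"
  shows "hist_at x s = hist_at y s"
proof -
  have "(\<lambda>u. if u \<le> 0 then x (s + u) else 0) = (\<lambda>u. if u \<le> 0 then y (s + u) else 0)"
    using assms by auto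
  then show ?thesis unfolding hist_at_def hist_of_def by simp
qed

lemma hist_at_mem_nbhd_iff:
  assumes "continuous_on UNIV x" "continuous_on UNIV y"
  shows "hist_at y s \<in> hist_nbhd n (hist_at x s) \<longleftrightarrow>
    (\<forall>r\<in>{s - real n..s}. norm (y r - x r) < 1 / (real n + 1))"
proof
  assume *: "hist_at y s \<in> hist_nbhd n (hist_at x s)"
  show "\<forall>r\<in>{s - real n..s}. norm (y r - x r) < 1 / (real n + 1)"
  proof
    fix r assume "r \<in> {s - real n..s}"
    then have "r - s \<in> {- real n..0}" by auto
    then have "norm (hist_apply (hist_at y s) (r - s) - hist_apply (hist_at x s) (r - s)) < 1 / (real n + 1)"
      using * unfolding hist_nbhd_def by blast
    then show "norm (y r - x r) < 1 / (real n + 1)"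
      using \<open>r - s \<in> _\<close> assms by (simp add: hist_apply_hist_at_UNIV)
  qed
qed (use assms in \<open>auto simp: hist_nbhd_def hist_apply_hist_at_UNIV\<close>)

lemma continuous_on_hist_at:
  assumes x: "continuous_on UNIV (x :: real \<Rightarrow> 'b::real_normed_vector)"
  shows "continuous_on S (hist_at x)"
proof -
  have "isCont (hist_at x) s" for s
    unfolding isCont_def tendsto_hist_iff
  proof
    fix n
    \<comment> \<open>For \<open>\<bar>r - s\<bar> < 1\<close> the windows of length
      \<open>n\<close> that end at \<open>r\<close> and at \<open>s\<close> both lie in
      \<open>K\<close>.\<close>
    define K where "K = {s - real n - 1..s + 1}"
    have "uniformly_continuous_on K x"
      unfolding K_def
      by (intro compact_uniformly_continuous continuous_on_subset[OF x]) auto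
    then obtain d where d: "d > 0"
      "\<And>r r'. r \<in> K \<Longrightarrow> r' \<in> K \<Longrightarrow> dist r' r < d \<Longrightarrow> dist (x r') (x r) < 1 / (real n + 1)"
      unfolding uniformly_continuous_on_def
      by (metis add_nonneg_pos of_nat_0_le_iff zero_less_divide_1_iff zero_less_one)
    have "hist_at x r \<in> hist_nbhd n (hist_at x s)" if "dist r s < min d 1" for r
      unfolding hist_nbhd_def
    proof (intro CollectI ballI)
      fix u assume u: "u \<in> {- real n..0}"
      have "dist (x (r + u)) (x (s + u)) < 1 / (real n + 1)"
        using that u by (intro d(2)) (auto simp: K_def dist_real_def)
      then show "norm (hist_apply (hist_at x r) u - hist_apply (hist_at x s) u) < 1 / (real n + 1)"
        using u x by (simp add: hist_apply_hist_at_UNIV dist_norm)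
    qed
    moreover have "min d 1 > 0" using d(1) by simp
    ultimately show "\<forall>\<^sub>F r in at s. hist_at x r \<in> hist_nbhd n (hist_at x s)"
      unfolding eventually_at by blast
  qed
  then show ?thesis
    by (simp add: continuous_at_imp_continuous_on)
qed

text \<open>The continuation uses the value at 0, since the representative itself is 0 on the
  positive half-line and may jump there.\<close>

definition hist_ext :: "'b::real_normed_vector hist \<Rightarrow> real \<Rightarrow> 'b" where
  "hist_ext \<phi> u = hist_apply \<phi> (min u 0)"

lemma continuous_on_hist_ext: "continuous_on S (hist_ext \<phi>)"
  unfolding hist_ext_def
  by (rule continuous_on_compose2[OF continuous_on_hist_apply]) (auto intro!: continuous_intros)

lemma hist_at_eq_iff:
  assumes "continuous_on UNIV x"
  shows "hist_at x s = \<phi> \<longleftrightarrow> (\<forall>u\<le>0. x (s + u) = hist_apply \<phi> u)"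
  using assms by (auto simp: hist_apply_hist_at_UNIV intro!: hist_eqI)

section \<open>Bounded sets of histories\<close>

lemma tvs_bounded_hist_imp:
  assumes "tvs_bounded (B :: 'b::real_normed_vector hist set)"
  shows "\<exists>M. \<forall>v\<in>B. \<forall>u\<in>{- real n..0}. norm (hist_apply v u) \<le> M"
proof -
  have "open (hist_nbhd n (0::'b hist)) \<and> 0 \<in> hist_nbhd n (0::'b hist)"
    using open_hist_nbhd by auto
  then have "\<exists>r>0. \<forall>s\<ge>r. B \<subseteq> (\<lambda>x. s *\<^sub>R x) ` hist_nbhd n 0"
    by (rule assms[unfolded tvs_bounded_def, rule_format])
  then obtain r where "r > 0" "\<forall>s\<ge>r. B \<subseteq> (\<lambda>x. s *\<^sub>R x) ` hist_nbhd n 0"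
    by (elim exE conjE)
  then have r: "r > 0" "B \<subseteq> (\<lambda>x. r *\<^sub>R x) ` hist_nbhd n 0"
    by simp_all
  have "norm (hist_apply v u) \<le> r * (1 / (real n + 1))" if v: "v \<in> B" and u: "u \<in> {- real n..0}" for v u
  proof -
    obtain x where x: "x \<in> hist_nbhd n 0" "v = r *\<^sub>R x" using r v by blast
    have "norm (hist_apply x u) < 1 / (real n + 1)"
      using x(1) u by (auto simp: hist_nbhd_def hist_apply_simps)
    then have "r * norm (hist_apply x u) \<le> r * (1 / (real n + 1))"
      using r(1) by (intro mult_left_mono) auto
    then show ?thesis using r(1) x(2) by (simp add: hist_apply_simps)
  qed
  then show ?thesis by blast
qed

text \<open>Converse passage, in the form used for \<open>C1_F\<close>: the directions in which
  \<open>g\<close> is differentiated have time component 0.\<close>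

lemma tvs_bounded_Times_hist:
  assumes "\<And>n. \<exists>M. \<forall>v\<in>B. \<forall>u\<in>{- real n..0}. norm (hist_apply v u) \<le> M"
  shows "tvs_bounded ({0::real} \<times> (B :: 'b::real_normed_vector hist set))"
  unfolding tvs_bounded_def
proof (intro allI impI)
  fix N :: "(real \<times> 'b hist) set" assume N: "open N \<and> 0 \<in> N"
  then have "(0, 0) \<in> N" by (simp add: zero_prod_def)
  then obtain N1 N2 where N12: "open N1" "open N2" "(0::real) \<in> N1" "(0::'b hist) \<in> N2" "N1 \<times> N2 \<subseteq> N"
    using N by (auto elim!: open_prod_elim)
  obtain n where n: "hist_nbhd n (0::'b hist) \<subseteq> N2" using hist_nbhd_base[OF N12(2,4)] .
  obtain M where M: "\<forall>v\<in>B. \<forall>u\<in>{- real n..0}. norm (hist_apply v u) \<le> M" using assms by blast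
  \<comment> \<open>Division by \<open>s \<ge> r\<close> brings values of norm at most
    \<open>M\<close> strictly below \<open>1 / (real n + 1)\<close>. The absolute value keeps
    \<open>r\<close> positive when \<open>B\<close> is empty and \<open>M\<close> negative.\<close>
  define r where "r = (\<bar>M\<bar> + 1) * (real n + 1)"
  have "r > 0" unfolding r_def by (intro mult_pos_pos) auto
  moreover have "{0} \<times> B \<subseteq> (\<lambda>x. s *\<^sub>R x) ` N" if s: "s \<ge> r" for s
  proof
    fix p assume "p \<in> {0::real} \<times> B"
    then obtain v where v: "p = (0, v)" "v \<in> B" by auto
    have s0: "s > 0" using s \<open>r > 0\<close> by simp
    have "(1 / s) *\<^sub>R v \<in> hist_nbhd n 0"
      unfolding hist_nbhd_def
    proof (intro CollectI ballI)
      fix u assume u: "u \<in> {- real n..0}"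
      have "norm (hist_apply v u) * (real n + 1) < (\<bar>M\<bar> + 1) * (real n + 1)"
        using M u v(2) by (intro mult_strict_right_mono) fastforce+
      also have "\<dots> \<le> s" using s by (simp add: r_def)
      finally show "norm (hist_apply ((1 / s) *\<^sub>R v) u - hist_apply 0 u) < 1 / (real n + 1)"
        using s0 by (simp add: hist_apply_simps field_simps)
    qed
    then have "(0, (1 / s) *\<^sub>R v) \<in> N" using n N12 by blast
    moreover have "p = s *\<^sub>R (0, (1 / s) *\<^sub>R v)" using s0 v by simp
    ultimately show "p \<in> (\<lambda>x. s *\<^sub>R x) ` N" by blast
  qed
  ultimately show "\<exists>r>0. \<forall>s\<ge>r. {0} \<times> B \<subseteq> (\<lambda>x. s *\<^sub>R x) ` N" by blast
qed

section \<open>Functional differential equations with Lipschitz right-hand side\<close>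

text \<open>Let \<open>M\<close> be the maximum of \<open>norm (z t)\<close> weighted by
  \<open>exp (- 2 * L * (t - a))\<close>. Integrating the bound on \<open>h\<close> reproduces only
  half of \<open>M\<close>, so \<open>M \<le> A + e + M / 2\<close>. The bound on \<open>h s\<close>
  is required for every bound of \<open>z\<close> on the window ending at \<open>s\<close>, so no
  running supremum has to be formed.\<close>

lemma functional_gronwall:
  fixes z :: "real \<Rightarrow> 'a::euclidean_space"
  assumes ab: "a \<le> b" and L: "1 \<le> L" and e: "0 \<le> e" and A: "0 \<le> A"
    and z: "continuous_on {a..b} z"
    and deriv: "\<And>s. s \<in> {a..b} \<Longrightarrow> (z has_vector_derivative h s) (at s within {a..b})"
    and init: "\<And>r. r \<in> {a - T..a} \<Longrightarrow> norm (z r) \<le> A" and T: "0 \<le> T"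
    and bound: "\<And>s M. s \<in> {a..b} \<Longrightarrow> (\<And>r. r \<in> {s - T..s} \<Longrightarrow> norm (z r) \<le> M) \<Longrightarrow>
      norm (h s) \<le> e + L * M"
    and t: "t \<in> {a - T..b}"
  shows "norm (z t) \<le> 2 * (A + e) * exp (2 * L * (b - a))"
proof -
  have "continuous_on {a..b} (\<lambda>t. exp (- 2 * L * (t - a)) * norm (z t))"
    by (intro continuous_intros z)
  then obtain t0 where t0: "t0 \<in> {a..b}"
    "\<And>t. t \<in> {a..b} \<Longrightarrow> exp (- 2 * L * (t - a)) * norm (z t) \<le> exp (- 2 * L * (t0 - a)) * norm (z t0)"
    using continuous_attains_sup[of "{a..b}" "\<lambda>t. exp (- 2 * L * (t - a)) * norm (z t)"] ab by auto
  \<comment> \<open>Including \<open>A\<close> makes \<open>M * E s\<close> a bound also on the part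
    of the window before \<open>a\<close>.\<close>
  define M where "M = max A (exp (- 2 * L * (t0 - a)) * norm (z t0))"
  define E where "E = (\<lambda>t. exp (2 * L * (t - a)))"
  have E1: "E t \<ge> 1" if "t \<ge> a" for t using that L by (simp add: E_def)
  have M0: "M \<ge> 0" using A by (simp add: M_def)
  have zM: "norm (z t) \<le> M * E t" if "t \<in> {a..b}" for t
  proof -
    have "E t * (exp (- 2 * L * (t - a)) * norm (z t)) \<le> E t * M"
      using t0(2)[OF that] by (intro mult_left_mono) (auto simp: E_def M_def)
    moreover have "E t * exp (- 2 * L * (t - a)) = 1"
      unfolding E_def by (simp flip: exp_add)
    ultimately show ?thesis by (simp add: mult.commute[of M] flip: mult.assoc)
  qed
  have hM: "norm (h s) \<le> e + L * (M * E s)" if s: "s \<in> {a..b}" for s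
  proof (rule bound[OF s])
    fix r assume r: "r \<in> {s - T..s}"
    show "norm (z r) \<le> M * E s"
    proof (cases "r \<le> a")
      case True
      then have "norm (z r) \<le> M * 1" using init[of r] r s by (auto simp: M_def)
      also have "\<dots> \<le> M * E s" using E1[of s] s M0 by (intro mult_left_mono) auto
      finally show ?thesis .
    next
      case False
      then have "norm (z r) \<le> M * E r" using r s by (intro zM) auto
      also have "\<dots> \<le> M * E s" using r M0 L by (intro mult_left_mono) (auto simp: E_def)
      finally show ?thesis .
    qed
  qed
  have main: "norm (z t) \<le> (A + e + M / 2) * E t" if t: "t \<in> {a..b}" for t
  proof -
    \<comment> \<open>\<open>B\<close> is an antiderivative of \<open>e + L * (M * E t)\<close>; the
      rate \<open>2 * L\<close> in \<open>E\<close> produces the factor 1/2.\<close>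
    define B where "B = (\<lambda>t. e * (t - a) + M / 2 * E t)"
    have "norm (z t - z a) \<le> B t - B a"
    proof (cases "a = t")
      case False
      then have at: "a < t" using t by auto
      show ?thesis
      proof (rule differentiable_bound_general[OF at])
        show "continuous_on {a..t} z" using t by (intro continuous_on_subset[OF z]) auto
        show "continuous_on {a..t} B" unfolding B_def E_def by (intro continuous_intros)
      next
        fix s assume s: "a < s" "s < t"
        have "(z has_vector_derivative h s) (at s within {a..b})" using s t by (intro deriv) auto
        moreover have "at s within {a..b} = at s" using s t by (intro at_within_interior) auto
        ultimately show "(z has_vector_derivative h s) (at s)" by simp
        show "(B has_vector_derivative (e + L * (M * E s))) (at s)"
          unfolding has_real_derivative_iff_has_vector_derivative[symmetric] B_def E_def
          by (auto intro!: derivative_eq_intros simp: field_simps)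
        show "norm (h s) \<le> e + L * (M * E s)" using s t by (intro hM) auto
      qed
    qed auto
    also have "\<dots> \<le> e * (t - a) + M / 2 * E t" using M0 by (simp add: B_def E_def)
    also have "e * (t - a) \<le> e * E t"
    proof (intro mult_left_mono e)
      have "t - a \<le> 2 * L * (t - a)" using t L mult_right_mono[of 1 "2 * L" "t - a"] by auto
      also have "\<dots> \<le> E t" unfolding E_def using exp_ge_add_one_self[of "2 * L * (t - a)"] by linarith
      finally show "t - a \<le> E t" .
    qed
    finally have "norm (z t - z a) \<le> e * E t + M / 2 * E t" by simp
    moreover have "norm (z a) \<le> A" using init[of a] T by simp
    moreover have "A \<le> A * E t" using A E1[of t] t mult_left_mono[of 1 "E t" A] by auto
    moreover have "norm (z t) \<le> norm (z t - z a) + norm (z a)"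
      using norm_triangle_ineq[of "z t - z a" "z a"] by simp
    ultimately have "norm (z t) \<le> e * E t + M / 2 * E t + A * E t" by linarith
    then show ?thesis by (simp add: algebra_simps)
  qed
  have "exp (- 2 * L * (t0 - a)) * norm (z t0) \<le> exp (- 2 * L * (t0 - a)) * ((A + e + M / 2) * E t0)"
    by (intro mult_left_mono main t0) auto
  also have "\<dots> = A + e + M / 2" unfolding E_def by (simp add: mult.left_commute flip: exp_add)
  finally have "M \<le> A + e + M / 2" using M0 A e unfolding M_def by auto
  then have M: "M \<le> 2 * (A + e)" by simp
  have Eb: "1 \<le> E b" using E1 ab by simp
  show ?thesis
  proof (cases "t \<le> a")
    case True
    then have "norm (z t) \<le> M * 1" using init[of t] t by (auto simp: M_def)
    also have "\<dots> \<le> 2 * (A + e) * E b" using M M0 Eb by (intro mult_mono) auto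
    finally show ?thesis by (simp add: E_def)
  next
    case False
    then have "norm (z t) \<le> M * E t" using t by (intro zM) auto
    also have "\<dots> \<le> 2 * (A + e) * E b" using M M0 t L A e
      by (intro mult_mono) (auto simp: E_def)
    finally show ?thesis by (simp add: E_def)
  qed
qed

text \<open>Picard iteration in a norm weighted by \<open>exp (- 2 * L * (t - a))\<close>, which is
  a contraction with factor 1/2 on the whole interval at once. \<open>H s\<close> takes a whole
  path, but by the Lipschitz assumption it depends only on the window ending at
  \<open>s\<close>.\<close>

lemma functional_ode_exists:
  fixes H :: "real \<Rightarrow> (real \<Rightarrow> 'a::euclidean_space) \<Rightarrow> 'a"
  assumes ab: "a \<le> b" and L: "1 \<le> L" and T: "0 \<le> T" and p: "continuous_on UNIV p"
    and cont: "\<And>x. continuous_on UNIV x \<Longrightarrow> continuous_on {a..b} (\<lambda>s. H s x)"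
    and lip: "\<And>x y s M. continuous_on UNIV x \<Longrightarrow> continuous_on UNIV y \<Longrightarrow> s \<in> {a..b} \<Longrightarrow>
      (\<And>r. r \<in> {s - T..s} \<Longrightarrow> norm (x r - y r) \<le> M) \<Longrightarrow> norm (H s x - H s y) \<le> L * M"
  obtains x where "continuous_on UNIV x" "\<And>t. t \<le> a \<Longrightarrow> x t = p t"
    "\<And>t. t \<in> {a..b} \<Longrightarrow> (x has_vector_derivative H t x) (at t within {a..b})"
proof -
  \<comment> \<open>Clamping times to \<open>{a..b}\<close> lets functions on the whole line stand
    for functions on the interval, so that the fixed point theorem for complete types applies to
    bounded continuous functions.\<close>
  define cl where "cl = (\<lambda>t::real. max a (min b t))"
  have cl: "cl t \<in> {a..b}" for t using ab by (auto simp: cl_def)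
  have ccl: "continuous_on S cl" for S unfolding cl_def by (intro continuous_intros)
  define E where "E = (\<lambda>t. exp (2 * L * (t - a)))"
  have Einv: "exp (- 2 * L * (t - a)) * E t = 1" for t
    unfolding E_def by (simp flip: exp_add)
  \<comment> \<open>\<open>w\<close> is the increment over \<open>p a\<close>, divided by the weight
    \<open>E\<close>. Before \<open>a\<close> the path \<open>X w\<close> equals \<open>p\<close> up
    to the constant \<open>w a\<close>, which vanishes at the fixed point because the integral over
    \<open>{a..a}\<close> does.\<close>
  define X where "X = (\<lambda>(w :: real \<Rightarrow>\<^sub>C 'a) t. p (min t a) + E (cl t) *\<^sub>R apply_bcontfun w (cl t))"
  have cX: "continuous_on UNIV (X w)" for w
    unfolding X_def E_def
    by (intro continuous_intros continuous_on_compose2[OF p] ccl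
        continuous_on_compose2[OF continuous_on_apply_bcontfun[of UNIV]]) auto
  have int: "(\<lambda>s. H s (X w)) integrable_on {a..t}" if "t \<in> {a..b}" for w t
    using that by (intro integrable_continuous_real continuous_on_subset[OF cont[OF cX]]) auto
  define J where "J = (\<lambda>w t. exp (- 2 * L * (t - a)) *\<^sub>R integral {a..t} (\<lambda>s. H s (X w)))"
  have cJ: "continuous_on {a..b} (J w)" for w
    unfolding J_def using cont[OF cX, of w]
    by (intro continuous_intros indefinite_integral_continuous_1 integrable_continuous_real)
  define K where "K = (\<lambda>w. Bcontfun (\<lambda>t. J w (cl t)))"
  have K: "apply_bcontfun (K w) t = J w (cl t)" for w t
  proof -
    have "compact (J w ` {a..b})" by (intro compact_continuous_image cJ) auto
    then obtain M where M: "\<And>y. y \<in> J w ` {a..b} \<Longrightarrow> norm y \<le> M"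
      using compact_imp_bounded bounded_iff by metis
    have "(\<lambda>t. J w (cl t)) \<in> bcontfun"
    proof (rule bcontfun_normI)
      show "continuous_on UNIV (\<lambda>t. J w (cl t))"
        by (rule continuous_on_compose2[OF cJ ccl]) (use cl in auto)
      show "norm (J w (cl t)) \<le> M" for t using M cl by blast
    qed
    then show ?thesis unfolding K_def by (simp add: Bcontfun_inverse)
  qed
  have "dist (K v) (K w) \<le> 1 / 2 * dist v w" for v w
  proof (rule dist_bound)
    fix t
    define u where "u = cl t"
    have u: "u \<in> {a..b}" using cl by (simp add: u_def)
    define d where "d = dist v w"
    have "norm (H s (X v) - H s (X w)) \<le> L * (E s * d)" if s: "s \<in> {a..b}" for s
    proof (rule lip[OF cX cX s])
      fix r assume r: "r \<in> {s - T..s}"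
      have "norm (X v r - X w r) = E (cl r) * dist (apply_bcontfun v (cl r)) (apply_bcontfun w (cl r))"
        by (simp add: X_def dist_norm E_def flip: scaleR_diff_right)
      also have "\<dots> \<le> E s * d"
        unfolding d_def using r s L
        by (intro mult_mono dist_bounded) (auto simp: E_def cl_def)
      finally show "norm (X v r - X w r) \<le> E s * d" .
    qed
    then have "norm (integral {a..u} (\<lambda>s. H s (X v) - H s (X w))) \<le> integral {a..u} (\<lambda>s. L * (E s * d))"
      using u unfolding E_def
      by (intro integral_norm_bound_integral integrable_diff int integrable_continuous_real continuous_intros) auto
    also have "\<dots> = E u * d / 2 - E a * d / 2"
    proof (rule integral_unique, rule fundamental_theorem_of_calculus)
      show "a \<le> u" using u by simp
      show "((\<lambda>s. E s * d / 2) has_vector_derivative L * (E s * d)) (at s within {a..u})" for s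
        unfolding has_real_derivative_iff_has_vector_derivative[symmetric] E_def
        by (auto intro!: derivative_eq_intros)
    qed
    also have "\<dots> \<le> E u * d / 2" by (simp add: E_def d_def)
    finally have *: "norm (integral {a..u} (\<lambda>s. H s (X v)) - integral {a..u} (\<lambda>s. H s (X w))) \<le> E u * d / 2"
      using integral_diff[OF int[OF u] int[OF u]] by simp
    have "dist (K v t) (K w t) =
        exp (- 2 * L * (u - a)) * norm (integral {a..u} (\<lambda>s. H s (X v)) - integral {a..u} (\<lambda>s. H s (X w)))"
      by (simp add: K J_def u_def dist_norm flip: scaleR_diff_right)
    also have "\<dots> \<le> exp (- 2 * L * (u - a)) * (E u * d / 2)"
      by (intro mult_left_mono *) auto
    also have "\<dots> = 1 / 2 * dist v w" using Einv[of u] by (simp add: d_def)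
    finally show "dist (K v t) (K w t) \<le> 1 / 2 * dist v w" .
  qed
  then obtain w where w: "K w = w" using banach_fix_type[of "1/2" K] by auto
  have Xw: "X w t = p (min t a) + integral {a..cl t} (\<lambda>s. H s (X w))" for t
  proof -
    have "apply_bcontfun w (cl t) = J w (cl t)"
      using K[of w "cl t"] w cl by (simp add: cl_def)
    then show ?thesis using Einv[of "cl t"] by (simp add: X_def J_def mult.commute)
  qed
  show thesis
  proof
    show "continuous_on UNIV (X w)" by (rule cX)
    show "X w t = p t" if "t \<le> a" for t
      using that ab by (simp add: Xw cl_def min_def)
  next
    fix t assume t: "t \<in> {a..b}"
    have "((\<lambda>t. p a + integral {a..t} (\<lambda>s. H s (X w))) has_vector_derivative 0 + H t (X w)) (at t within {a..b})"
      by (intro derivative_intros integral_has_vector_derivative cont[OF cX] t)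
    moreover have "X w t = p a + integral {a..t} (\<lambda>s. H s (X w))" if "t \<in> {a..b}" for t
      using that by (simp add: Xw cl_def)
    ultimately show "(X w has_vector_derivative H t (X w)) (at t within {a..b})"
      using t by (subst has_vector_derivative_cong_ev[where g = "\<lambda>t. p a + integral {a..t} (\<lambda>s. H s (X w))"]) auto
  qed
qed

text \<open>A finite subcover and the largest of its indices. This serves the construction of tubes
  and the uniform smallness of the variation of \<open>D\<close> along a path.\<close>

lemma compact_interval_uniform_index:
  fixes a b :: real
  assumes mono: "\<And>s m n. m \<le> n \<Longrightarrow> P s m \<Longrightarrow> P s n"
    and loc: "\<And>s0. s0 \<in> {a..b} \<Longrightarrow> \<exists>d>0. \<exists>n::nat. \<forall>s\<in>{a..b}. \<bar>s - s0\<bar> < d \<longrightarrow> P s n"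
  obtains n where "\<And>s. s \<in> {a..b} \<Longrightarrow> P s n"
proof -
  obtain d n where dn: "\<And>s0. s0 \<in> {a..b} \<Longrightarrow> d s0 > (0::real)"
    "\<And>s0 s. s0 \<in> {a..b} \<Longrightarrow> s \<in> {a..b} \<Longrightarrow> \<bar>s - s0\<bar> < d s0 \<Longrightarrow> P s (n s0 :: nat)"
    using loc by metis
  have "{a..b} \<subseteq> (\<Union>s0\<in>{a..b}. ball s0 (d s0))" using dn(1) by force
  then obtain C where C: "C \<subseteq> {a..b}" "finite C" "{a..b} \<subseteq> (\<Union>s0\<in>C. ball s0 (d s0))"
    by (rule compactE_image[OF compact_Icc open_ball])
  have "P s (Max (n ` C))" if s: "s \<in> {a..b}" for s
  proof -
    obtain s0 where s0: "s0 \<in> C" "s \<in> ball s0 (d s0)" using C(3) s by blast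
    then have "P s (n s0)" using dn(2)[of s0 s] C(1) s by (auto simp: dist_real_def)
    moreover have "n s0 \<le> Max (n ` C)" using s0(1) C(2) by (intro Max_ge) auto
    ultimately show ?thesis using mono by blast
  qed
  then show thesis by (rule that)
qed

section \<open>Smooth right-hand sides\<close>

text \<open>The index \<open>2 * n + 1\<close> halves the radius exactly, and its window contains
  the one of index \<open>n\<close>.\<close>

lemma hist_nbhd_triangle:
  assumes "\<psi> \<in> hist_nbhd (2 * n + 1) \<phi>" "\<xi> \<in> hist_nbhd (2 * n + 1) \<psi>"
  shows "\<xi> \<in> hist_nbhd n \<phi>"
  unfolding hist_nbhd_def
proof (intro CollectI ballI)
  fix u assume "u \<in> {- real n..0}"
  then have "u \<in> {- real (2 * n + 1)..0}" by auto
  then have "norm (hist_apply \<psi> u - hist_apply \<phi> u) < 1 / (real (2 * n + 1) + 1)"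
    "norm (hist_apply \<xi> u - hist_apply \<psi> u) < 1 / (real (2 * n + 1) + 1)"
    using assms unfolding hist_nbhd_def by blast+
  moreover have "1 / (real (2 * n + 1) + 1) + 1 / (real (2 * n + 1) + 1) = 1 / (real n + 1)"
    by (simp add: field_simps)
  moreover have "norm (hist_apply \<xi> u - hist_apply \<phi> u)
      \<le> norm (hist_apply \<xi> u - hist_apply \<psi> u) + norm (hist_apply \<psi> u - hist_apply \<phi> u)"
    using norm_triangle_ineq[of "hist_apply \<xi> u - hist_apply \<psi> u" "hist_apply \<psi> u - hist_apply \<phi> u"]
    by simp
  ultimately show "norm (hist_apply \<xi> u - hist_apply \<phi> u) < 1 / (real n + 1)" by linarith
qed

lemma hist_nbhd_segment:
  assumes "\<psi> \<in> hist_nbhd n \<phi>" "\<xi> \<in> hist_nbhd n \<phi>" "\<theta> \<in> {0..1}"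
  shows "\<psi> + \<theta> *\<^sub>R (\<xi> - \<psi>) \<in> hist_nbhd n \<phi>"
  unfolding hist_nbhd_def
proof (intro CollectI ballI)
  fix u assume u: "u \<in> {- real n..0}"
  have "convex (ball (hist_apply \<phi> u) (1 / (real n + 1)))" by (rule convex_ball)
  moreover have "hist_apply \<psi> u \<in> ball (hist_apply \<phi> u) (1 / (real n + 1))"
    "hist_apply \<xi> u \<in> ball (hist_apply \<phi> u) (1 / (real n + 1))"
    using assms u by (auto simp: hist_nbhd_def dist_norm norm_minus_commute)
  ultimately have "(1 - \<theta>) *\<^sub>R hist_apply \<psi> u + \<theta> *\<^sub>R hist_apply \<xi> u \<in> ball (hist_apply \<phi> u) (1 / (real n + 1))"
    using assms(3) by (auto simp: convex_alt)
  then show "norm (hist_apply (\<psi> + \<theta> *\<^sub>R (\<xi> - \<psi>)) u - hist_apply \<phi> u) < 1 / (real n + 1)"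
    by (simp add: dist_norm norm_minus_commute hist_apply_simps algebra_simps)
qed

lemma hist_bounded_on:
  obtains M where "0 \<le> M" "\<And>u. u \<in> {- real n..0} \<Longrightarrow> norm (hist_apply \<zeta> u) \<le> M"
proof -
  have "compact (hist_apply \<zeta> ` {- real n..0})"
    by (intro compact_continuous_image continuous_on_subset[OF continuous_on_hist_apply]) auto
  then obtain M where "M > 0" "\<And>y. y \<in> hist_apply \<zeta> ` {- real n..0} \<Longrightarrow> norm y \<le> M"
    using compact_imp_bounded bounded_pos by metis
  then show thesis by (intro that[of M]) auto
qed

lemma path_bounded_on:
  fixes w :: "real \<Rightarrow> 'a::real_normed_vector"
  assumes "continuous_on UNIV w"
  obtains M where "0 \<le> M" "\<And>r. r \<in> {c..d} \<Longrightarrow> norm (w r) \<le> M"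
proof -
  have "compact (w ` {c..d})"
    by (intro compact_continuous_image continuous_on_subset[OF assms]) auto
  then obtain M where "M > 0" "\<And>y. y \<in> w ` {c..d} \<Longrightarrow> norm y \<le> M"
    using compact_imp_bounded bounded_pos by metis
  then show thesis by (intro that[of M]) auto
qed

lemma tendsto_hist_line:
  fixes \<psi> :: "'b::real_normed_vector hist"
  shows "((\<lambda>t. \<psi> + t *\<^sub>R \<zeta>) \<longlongrightarrow> \<psi>) (at (0::real))"
  unfolding tendsto_hist_iff
proof
  fix n
  obtain M where M: "0 \<le> M" "\<And>u. u \<in> {- real n..0} \<Longrightarrow> norm (hist_apply \<zeta> u) \<le> M"
    using hist_bounded_on[of n \<zeta>] by blast
  define d where "d = 1 / ((M + 1) * (real n + 1))"
  have d: "d > 0" using M by (simp add: d_def)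
  have "\<psi> + t *\<^sub>R \<zeta> \<in> hist_nbhd n \<psi>" if t: "dist t 0 < d" for t
    unfolding hist_nbhd_def
  proof (intro CollectI ballI)
    fix u assume u: "u \<in> {- real n..0}"
    have "\<bar>t\<bar> * norm (hist_apply \<zeta> u) \<le> \<bar>t\<bar> * (M + 1)"
      using M(2)[OF u] by (intro mult_left_mono) auto
    also have "\<dots> < d * (M + 1)" using t M by (intro mult_strict_right_mono) auto
    also have "\<dots> = 1 / (real n + 1)" using M by (simp add: d_def)
    finally show "norm (hist_apply (\<psi> + t *\<^sub>R \<zeta>) u - hist_apply \<psi> u) < 1 / (real n + 1)"
      by (simp add: hist_apply_simps)
  qed
  then show "\<forall>\<^sub>F t in at 0. \<psi> + t *\<^sub>R \<zeta> \<in> hist_nbhd n \<psi>"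
    unfolding eventually_at using d by blast
qed

lemma obtain_nat_inverse_less:
  assumes "0 < d"
  obtains m :: nat where "n \<le> m" "1 / (real m + 1) < d"
proof -
  obtain k :: nat where k: "real k \<ge> 1 / d" using real_arch_simple by blast
  have "1 / d < real (max n k) + 1" using k by simp
  then have "1 / (real (max n k) + 1) < d" using assms by (simp add: field_simps)
  then show thesis by (intro that[of "max n k"]) auto
qed

text \<open>Common ground of both notions of smoothness: \<open>D p\<close> is the derivative of
  \<open>g\<close> at \<open>p\<close> in the history variable, known only through difference
  quotients and joint continuity.\<close>

locale smooth_fde =
  fixes V :: "(real \<times> 'a::euclidean_space hist) set"
    and g :: "real \<times> 'a hist \<Rightarrow> 'a"
    and D :: "real \<times> 'a hist \<Rightarrow> 'a hist \<Rightarrow> 'a"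
  assumes open_V: "open V"
    and cont_g: "continuous_on V g"
    and deriv: "\<And>p \<zeta>. p \<in> V \<Longrightarrow> (dir_quotient g p (0, \<zeta>) \<longlongrightarrow> D p \<zeta>) (at 0)"
    and cont_D: "continuous_on (V \<times> UNIV) (\<lambda>(p, \<zeta>). D p \<zeta>)"
begin

text \<open>For \<open>c \<noteq> 0\<close> substitute \<open>c * t\<close> for \<open>t\<close> in
  the difference quotient. Homogeneity is the part of linearity that allows a direction to be scaled
  into a neighbourhood of 0.\<close>

lemma D_scaleR:
  assumes "p \<in> V"
  shows "D p (c *\<^sub>R \<zeta>) = c *\<^sub>R D p \<zeta>"
proof (cases "c = 0")
  case True
  have "dir_quotient g p (0, 0 *\<^sub>R \<zeta>) = (\<lambda>t. 0)"
    by (auto simp: dir_quotient_def fun_eq_iff simp flip: zero_prod_def)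
  then have "((\<lambda>t. 0) \<longlongrightarrow> D p (0 *\<^sub>R \<zeta>)) (at (0::real))" using deriv[OF assms, of "0 *\<^sub>R \<zeta>"] by simp
  then have "D p (0 *\<^sub>R \<zeta>) = 0"
    by (simp add: tendsto_const_iff)
  with True show ?thesis by simp
next
  case False
  have "filterlim (\<lambda>t. c * t) (at 0) (at 0)"
    unfolding filterlim_at using False
    by (auto simp: eventually_at intro!: exI[of _ 1] tendsto_eq_intros)
  then have "((\<lambda>t. dir_quotient g p (0, \<zeta>) (c * t)) \<longlongrightarrow> D p \<zeta>) (at 0)"
    using filterlim_compose[OF deriv[OF assms, of \<zeta>]] by blast
  then have "((\<lambda>t. c *\<^sub>R dir_quotient g p (0, \<zeta>) (c * t)) \<longlongrightarrow> c *\<^sub>R D p \<zeta>) (at 0)"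
    by (intro tendsto_intros)
  moreover have "(\<lambda>t. c *\<^sub>R dir_quotient g p (0, \<zeta>) (c * t)) = dir_quotient g p (0, c *\<^sub>R \<zeta>)"
    using False by (simp add: dir_quotient_def fun_eq_iff mult.commute)
  ultimately have "(dir_quotient g p (0, c *\<^sub>R \<zeta>) \<longlongrightarrow> c *\<^sub>R D p \<zeta>) (at 0)" by simp
  then show ?thesis
    using tendsto_unique[OF _ deriv[OF assms]] by simp
qed

text \<open>Restricts \<open>g\<close> to a line in the history variable, which makes mean value
  estimates for functions of one real variable available.\<close>

lemma has_vector_derivative_line:
  assumes "(s, \<psi> + \<theta> *\<^sub>R \<zeta>) \<in> V"
  shows "((\<lambda>\<theta>. g (s, \<psi> + \<theta> *\<^sub>R \<zeta>)) has_vector_derivative D (s, \<psi> + \<theta> *\<^sub>R \<zeta>) \<zeta>) (at \<theta>)"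
proof -
  define d where "d = D (s, \<psi> + \<theta> *\<^sub>R \<zeta>) \<zeta>"
  define q where "q = (\<lambda>h. (1 / h) *\<^sub>R (g (s, \<psi> + (\<theta> + h) *\<^sub>R \<zeta>) - g (s, \<psi> + \<theta> *\<^sub>R \<zeta>)))"
  have "q = dir_quotient g (s, \<psi> + \<theta> *\<^sub>R \<zeta>) (0, \<zeta>)"
    by (simp add: q_def dir_quotient_def fun_eq_iff algebra_simps)
  then have "(q \<longlongrightarrow> d) (at 0)" using deriv[OF assms, of \<zeta>] by (simp add: d_def)
  then have "((\<lambda>h. norm (q h - d)) \<longlongrightarrow> 0) (at 0)"
    using LIM_zero tendsto_norm_zero by blast
  moreover have "norm (q h - d) =
      norm (g (s, \<psi> + (\<theta> + h) *\<^sub>R \<zeta>) - g (s, \<psi> + \<theta> *\<^sub>R \<zeta>) - h *\<^sub>R d) / norm h" if "h \<noteq> 0" for h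
  proof -
    have "q h - d = (1 / h) *\<^sub>R (g (s, \<psi> + (\<theta> + h) *\<^sub>R \<zeta>) - g (s, \<psi> + \<theta> *\<^sub>R \<zeta>) - h *\<^sub>R d)"
      using that by (simp add: q_def scaleR_diff_right)
    then show ?thesis by simp
  qed
  then have "\<forall>\<^sub>F h in at 0. norm (q h - d) =
      norm (g (s, \<psi> + (\<theta> + h) *\<^sub>R \<zeta>) - g (s, \<psi> + \<theta> *\<^sub>R \<zeta>) - h *\<^sub>R d) / norm h"
    by (auto simp: eventually_at intro!: exI[of _ 1])
  ultimately have "((\<lambda>h. norm (g (s, \<psi> + (\<theta> + h) *\<^sub>R \<zeta>) - g (s, \<psi> + \<theta> *\<^sub>R \<zeta>) - h *\<^sub>R d) / norm h) \<longlongrightarrow> 0) (at 0)"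
    using tendsto_cong by force
  then show ?thesis
    unfolding has_vector_derivative_def has_derivative_at d_def
    by (auto intro!: bounded_linear_intros)
qed

text \<open>One index is window length, inverse radius and bound of the derivative. The last clause
  bounds \<open>D\<close> by \<open>n\<close> times the seminorm over the window; letting
  \<open>M\<close> range over all bounds avoids naming the supremum.\<close>

definition tube :: "(real \<Rightarrow> 'a) \<Rightarrow> real \<Rightarrow> real \<Rightarrow> nat \<Rightarrow> bool" where
  "tube x a b n \<longleftrightarrow> (\<forall>s\<in>{a..b}. \<forall>\<psi>\<in>hist_nbhd n (hist_at x s). (s, \<psi>) \<in> V \<and>
     (\<forall>\<zeta> M. (\<forall>u\<in>{- real n..0}. norm (hist_apply \<zeta> u) \<le> M) \<longrightarrow> norm (D (s, \<psi>) \<zeta>) \<le> real n * M))"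

lemma tubeD:
  assumes "tube x a b n" "s \<in> {a..b}" "\<psi> \<in> hist_nbhd n (hist_at x s)"
  shows "(s, \<psi>) \<in> V"
    "(\<And>u. u \<in> {- real n..0} \<Longrightarrow> norm (hist_apply \<zeta> u) \<le> M) \<Longrightarrow> norm (D (s, \<psi>) \<zeta>) \<le> real n * M"
  using assms unfolding tube_def by blast+

text \<open>Since \<open>D (s0, \<psi>0) 0 = 0\<close>, continuity keeps the norm of
  \<open>D\<close> below 1 on a product of neighbourhoods. Any direction is scaled into the second
  factor, and homogeneity undoes the scaling.\<close>

lemma D_locally_bounded:
  assumes "(s0, \<psi>0) \<in> V"
  shows "\<exists>d>0. \<exists>n. \<forall>s \<psi>. \<bar>s - s0\<bar> < d \<longrightarrow> \<psi> \<in> hist_nbhd n \<psi>0 \<longrightarrow> (s, \<psi>) \<in> V \<and>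
    (\<forall>\<zeta> M. (\<forall>u\<in>{- real n..0}. norm (hist_apply \<zeta> u) \<le> M) \<longrightarrow> norm (D (s, \<psi>) \<zeta>) \<le> real n * M)"
proof -
  have "open ((\<lambda>(p, \<zeta>). D p \<zeta>) -` ball 0 1 \<inter> (V \<times> UNIV))"
    using cont_D open_V continuous_on_open_vimage[of "V \<times> UNIV"] open_Times open_UNIV by blast
  moreover have "D (s0, \<psi>0) 0 = 0" using D_scaleR[OF assms, of 0 0] by simp
  ultimately obtain N1 N2 where N: "open N1" "open N2" "(s0, \<psi>0) \<in> N1" "0 \<in> N2"
    "N1 \<times> N2 \<subseteq> (\<lambda>(p, \<zeta>). D p \<zeta>) -` ball 0 1 \<inter> (V \<times> UNIV)"
    using assms by (elim open_prod_elim[where x = "((s0, \<psi>0), 0)"]) auto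
  obtain A B where AB: "open A" "open B" "s0 \<in> A" "\<psi>0 \<in> B" "A \<times> B \<subseteq> N1"
    using N(1,3) by (elim open_prod_elim) auto
  obtain d where d: "d > 0" "\<And>s. \<bar>s - s0\<bar> < d \<Longrightarrow> s \<in> A"
    using AB(1,3) unfolding open_dist by (auto simp: dist_real_def)
  obtain n1 where n1: "hist_nbhd n1 \<psi>0 \<subseteq> B" using hist_nbhd_base[OF AB(2,4)] .
  obtain n2 where n2: "hist_nbhd n2 0 \<subseteq> N2" using hist_nbhd_base[OF N(2,4)] .
  \<comment> \<open>The summand 1 makes \<open>1 / real n\<close> at most the radius of
    \<open>hist_nbhd n2 0\<close>, and it makes \<open>n\<close> positive.\<close>
  define n where "n = max n1 (n2 + 1)"
  have n: "hist_nbhd n \<psi>0 \<subseteq> hist_nbhd n1 \<psi>0" by (simp add: n_def hist_nbhd_mono)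
  have "norm (D (s, \<psi>) \<zeta>) \<le> real n * M"
    if s: "\<bar>s - s0\<bar> < d" and \<psi>: "\<psi> \<in> hist_nbhd n \<psi>0"
      and M: "\<forall>u\<in>{- real n..0}. norm (hist_apply \<zeta> u) \<le> M" for s \<psi> \<zeta> M
  proof -
    have p: "(s, \<psi>) \<in> N1" using s \<psi> d n n1 AB by blast
    then have pV: "(s, \<psi>) \<in> V" using N by blast
    have M0: "M \<ge> 0" using M[rule_format, of 0] norm_ge_zero[of "hist_apply \<zeta> 0"] by (simp del: norm_ge_zero)
    \<comment> \<open>\<open>M\<close> may be 0, so the scaling divides by a larger
      \<open>M'\<close>, which tends to \<open>M\<close> afterwards.\<close>
    have "norm (D (s, \<psi>) \<zeta>) \<le> real n * M'" if "M < M'" for M'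
    proof -
      define c where "c = 1 / (real n * M')"
      have n0: "real n > 0" by (simp add: n_def)
      have M': "M' > 0" using that M0 by linarith
      have c: "c > 0" using M' n0 by (simp add: c_def)
      have "c *\<^sub>R \<zeta> \<in> hist_nbhd n2 0"
        unfolding hist_nbhd_def
      proof (intro CollectI ballI)
        fix u assume "u \<in> {- real n2..0}"
        then have "norm (hist_apply \<zeta> u) < M'" using M that by (auto simp: n_def intro!: le_less_trans[OF _ that])
        then have "c * norm (hist_apply \<zeta> u) < c * M'" using c by simp
        also have "\<dots> = 1 / real n" using M' by (simp add: c_def)
        also have "\<dots> \<le> 1 / (real n2 + 1)" by (intro divide_left_mono) (auto simp: n_def)
        finally show "norm (hist_apply (c *\<^sub>R \<zeta>) u - hist_apply 0 u) < 1 / (real n2 + 1)"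
          using c by (simp add: hist_apply_simps)
      qed
      then have "((s, \<psi>), c *\<^sub>R \<zeta>) \<in> N1 \<times> N2" using p n2 by blast
      then have "norm (D (s, \<psi>) (c *\<^sub>R \<zeta>)) < 1" using N(5) by auto
      then have "c * norm (D (s, \<psi>) \<zeta>) < 1" using c by (simp add: D_scaleR[OF pV])
      then show ?thesis using n0 M' by (simp add: c_def field_simps)
    qed
    then have *: "norm (D (s, \<psi>) \<zeta>) \<le> real n * (M + e)" if "e > 0" for e using that by simp
    show ?thesis
    proof (rule field_le_epsilon)
      fix e :: real assume "e > 0"
      then show "norm (D (s, \<psi>) \<zeta>) \<le> real n * M + e"
        using *[of "e / real n"] by (simp add: n_def distrib_left)
    qed
  qed
  moreover have "(s, \<psi>) \<in> V" if "\<bar>s - s0\<bar> < d" "\<psi> \<in> hist_nbhd n \<psi>0" for s \<psi>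
    using that d n n1 AB N by blast
  ultimately show ?thesis using d(1) by blast
qed

lemma hist_at_near:
  assumes "continuous_on UNIV (x :: real \<Rightarrow> 'a)"
  obtains d where "d > 0" "\<And>s. \<bar>s - s0\<bar> < d \<Longrightarrow> hist_at x s \<in> hist_nbhd n (hist_at x s0)"
proof -
  have "(hist_at x \<longlongrightarrow> hist_at x s0) (at s0)"
    using continuous_on_hist_at[OF assms, of UNIV] by (auto simp: continuous_on_def)
  then have "\<forall>\<^sub>F s in at s0. hist_at x s \<in> hist_nbhd n (hist_at x s0)"
    unfolding tendsto_hist_iff by blast
  then obtain d where "d > 0" "\<And>s. s \<noteq> s0 \<Longrightarrow> dist s s0 < d \<Longrightarrow> hist_at x s \<in> hist_nbhd n (hist_at x s0)"
    unfolding eventually_at by blast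
  then show thesis by (intro that[of d]) (auto simp: dist_real_def, metis hist_nbhd_self)
qed

lemma tube_mono:
  assumes t: "tube x a b m" and mn: "m \<le> n"
  shows "tube x a b n"
  unfolding tube_def
proof (intro ballI conjI allI impI)
  fix s \<psi> assume s: "s \<in> {a..b}" and "\<psi> \<in> hist_nbhd n (hist_at x s)"
  then have \<psi>: "\<psi> \<in> hist_nbhd m (hist_at x s)" using hist_nbhd_mono[OF mn] by blast
  show "(s, \<psi>) \<in> V" using tubeD(1)[OF t s \<psi>] .
  fix \<zeta> :: "'a hist" and M assume M: "\<forall>u\<in>{- real n..0}. norm (hist_apply \<zeta> u) \<le> M"
  then have "norm (D (s, \<psi>) \<zeta>) \<le> real m * M" using mn by (intro tubeD(2)[OF t s \<psi>]) auto
  moreover have "M \<ge> 0" using M[rule_format, of 0] norm_ge_zero[of "hist_apply \<zeta> 0"] by (simp del: norm_ge_zero)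
  ultimately show "norm (D (s, \<psi>) \<zeta>) \<le> real n * M"
    using mn mult_right_mono[of "real m" "real n" M] by simp
qed

text \<open>The condition is pointwise in time, so the covering argument runs over the degenerate
  tubes \<open>tube x s s n\<close>. The bound \<open>N\<close> lets a long enough window be
  requested, and \<open>1 \<le> n\<close> fits the Lipschitz constant in
  \<open>functional_gronwall\<close>.\<close>

lemma tube_exists:
  assumes x: "continuous_on UNIV x" and V: "\<And>s. s \<in> {a..b} \<Longrightarrow> (s, hist_at x s) \<in> V"
  obtains n where "N \<le> n" "1 \<le> n" "tube x a b n"
proof -
  have "\<exists>n. \<forall>s\<in>{a..b}. tube x s s n"
  proof (rule compact_interval_uniform_index[where P = "\<lambda>s n. tube x s s n" and a = a and b = b])
    show "tube x s s n" if "m \<le> n" "tube x s s m" for s m n using tube_mono that by blast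
  next
    fix s0 assume s0: "s0 \<in> {a..b}"
    obtain d n where dn: "d > 0" "\<And>s \<psi>. \<bar>s - s0\<bar> < d \<Longrightarrow> \<psi> \<in> hist_nbhd n (hist_at x s0) \<Longrightarrow> (s, \<psi>) \<in> V \<and>
    (\<forall>\<zeta> M. (\<forall>u\<in>{- real n..0}. norm (hist_apply \<zeta> u) \<le> M) \<longrightarrow> norm (D (s, \<psi>) \<zeta>) \<le> real n * M)"
      using D_locally_bounded[OF V[OF s0]] by blast
    obtain d' where d': "d' > 0" "\<And>s. \<bar>s - s0\<bar> < d' \<Longrightarrow> hist_at x s \<in> hist_nbhd (2 * n + 1) (hist_at x s0)"
      using hist_at_near[OF x] by blast
    have "tube x s s (2 * n + 1)" if s: "\<bar>s - s0\<bar> < min d d'" for s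
      unfolding tube_def
    proof (intro ballI)
      fix s' \<psi> assume "s' \<in> {s..s}" and \<psi>: "\<psi> \<in> hist_nbhd (2 * n + 1) (hist_at x s')"
      then have s': "s' = s" by simp
      have "\<psi> \<in> hist_nbhd n (hist_at x s0)"
        using hist_nbhd_triangle[OF d'(2)[of s] \<psi>[unfolded s']] s by simp
      then have *: "(s, \<psi>) \<in> V" "\<And>\<zeta> M. (\<forall>u\<in>{- real n..0}. norm (hist_apply \<zeta> u) \<le> M) \<Longrightarrow> norm (D (s, \<psi>) \<zeta>) \<le> real n * M"
        using dn(2)[of s \<psi>] s by auto
      have "norm (D (s, \<psi>) \<zeta>) \<le> real (2 * n + 1) * M"
        if M: "\<forall>u\<in>{- real (2 * n + 1)..0}. norm (hist_apply \<zeta> u) \<le> M" for \<zeta> M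
      proof -
        have "norm (D (s, \<psi>) \<zeta>) \<le> real n * M" using M by (intro *(2)) auto
        moreover have "M \<ge> 0" using M[rule_format, of 0] norm_ge_zero[of "hist_apply \<zeta> 0"] by (simp del: norm_ge_zero)
        ultimately show ?thesis using mult_right_mono[of "real n" "real (2 * n + 1)" M] by simp
      qed
      with * show "(s', \<psi>) \<in> V \<and> (\<forall>\<zeta> M. (\<forall>u\<in>{- real (2 * n + 1)..0}. norm (hist_apply \<zeta> u) \<le> M)
          \<longrightarrow> norm (D (s', \<psi>) \<zeta>) \<le> real (2 * n + 1) * M)"
        unfolding s' by blast
    qed
    then show "\<exists>d>0. \<exists>n. \<forall>s\<in>{a..b}. \<bar>s - s0\<bar> < d \<longrightarrow> tube x s s n"
      using dn(1) d'(1) by (intro exI[of _ "min d d'"]) auto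
  qed blast
  then obtain n where n: "\<And>s. s \<in> {a..b} \<Longrightarrow> tube x s s n" by blast
  then have "tube x a b n" unfolding tube_def by (metis atLeastAtMost_iff order_refl)
  then have "tube x a b (max n (max N 1))" by (rule tube_mono) simp
  then show thesis by (intro that[of "max n (max N 1)"]) auto
qed

text \<open>Mean value inequality on the segment from \<open>\<xi>\<close> to \<open>\<psi>\<close>,
  which stays in the tube because \<open>hist_nbhd\<close> is convex.\<close>

lemma tube_lipschitz:
  assumes t: "tube x a b n" and s: "s \<in> {a..b}"
    and \<psi>: "\<psi> \<in> hist_nbhd n (hist_at x s)" and \<xi>: "\<xi> \<in> hist_nbhd n (hist_at x s)"
    and M: "\<And>u. u \<in> {- real n..0} \<Longrightarrow> norm (hist_apply \<psi> u - hist_apply \<xi> u) \<le> M"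
  shows "norm (g (s, \<psi>) - g (s, \<xi>)) \<le> real n * M"
proof -
  define f where "f = (\<lambda>\<theta>. g (s, \<xi> + \<theta> *\<^sub>R (\<psi> - \<xi>)))"
  have f: "(f has_vector_derivative D (s, \<xi> + \<theta> *\<^sub>R (\<psi> - \<xi>)) (\<psi> - \<xi>)) (at \<theta>)"
    and D: "norm (D (s, \<xi> + \<theta> *\<^sub>R (\<psi> - \<xi>)) (\<psi> - \<xi>)) \<le> real n * M" if "\<theta> \<in> {0..1}" for \<theta>
  proof -
    have *: "\<xi> + \<theta> *\<^sub>R (\<psi> - \<xi>) \<in> hist_nbhd n (hist_at x s)"
      using hist_nbhd_segment[OF \<xi> \<psi> that] .
    show "(f has_vector_derivative D (s, \<xi> + \<theta> *\<^sub>R (\<psi> - \<xi>)) (\<psi> - \<xi>)) (at \<theta>)"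
      unfolding f_def by (intro has_vector_derivative_line tubeD(1)[OF t s *])
    show "norm (D (s, \<xi> + \<theta> *\<^sub>R (\<psi> - \<xi>)) (\<psi> - \<xi>)) \<le> real n * M"
      by (intro tubeD(2)[OF t s *]) (use M in \<open>simp add: hist_apply_simps\<close>)
  qed
  have "norm (f 1 - f 0) \<le> 1 * (real n * M) - 0 * (real n * M)"
  proof (rule differentiable_bound_general)
    show "continuous_on {0..1} f"
      using f by (intro continuous_at_imp_continuous_on ballI) (auto intro: has_vector_derivative_continuous)
    show "(f has_vector_derivative D (s, \<xi> + \<theta> *\<^sub>R (\<psi> - \<xi>)) (\<psi> - \<xi>)) (at \<theta>)"
      "norm (D (s, \<xi> + \<theta> *\<^sub>R (\<psi> - \<xi>)) (\<psi> - \<xi>)) \<le> real n * M" if "0 < \<theta>" "\<theta> < 1" for \<theta>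
      using f D that by auto
    show "((\<lambda>t. t * (real n * M)) has_vector_derivative real n * M) (at \<theta>)" for \<theta>
      unfolding has_real_derivative_iff_has_vector_derivative[symmetric]
      by (auto intro!: derivative_eq_intros)
  qed (auto intro!: continuous_intros)
  then show ?thesis by (simp add: f_def)
qed

text \<open>Takes the place of linearity of \<open>D (s, \<psi>)\<close>: the Lipschitz bound of
  \<open>g\<close> between \<open>\<psi> + h *\<^sub>R \<zeta>\<close> and
  \<open>\<psi> + h *\<^sub>R \<xi>\<close>, divided by \<open>\<bar>h\<bar>\<close>, survives the
  limit.\<close>

lemma tube_D_lipschitz:
  assumes t: "tube x a b n" and s: "s \<in> {a..b}" and \<psi>: "\<psi> \<in> hist_nbhd n (hist_at x s)"
    and M: "\<And>u. u \<in> {- real n..0} \<Longrightarrow> norm (hist_apply \<zeta> u - hist_apply \<xi> u) \<le> M"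
  shows "norm (D (s, \<psi>) \<zeta> - D (s, \<psi>) \<xi>) \<le> real n * M"
proof -
  have V: "(s, \<psi>) \<in> V" using tubeD(1)[OF t s \<psi>] .
  define q where "q = (\<lambda>h. dir_quotient g (s, \<psi>) (0, \<zeta>) h - dir_quotient g (s, \<psi>) (0, \<xi>) h)"
  have "(q \<longlongrightarrow> D (s, \<psi>) \<zeta> - D (s, \<psi>) \<xi>) (at 0)"
    unfolding q_def by (intro tendsto_diff deriv V)
  moreover have "\<forall>\<^sub>F h in at 0. norm (q h) \<le> real n * M"
  proof -
    have near: "\<forall>\<^sub>F h in at (0::real). \<psi> + h *\<^sub>R \<eta> \<in> hist_nbhd n (hist_at x s)" for \<eta>
      using topological_tendstoD[OF tendsto_hist_line open_hist_nbhd \<psi>] .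
    have "\<forall>\<^sub>F h::real in at 0. h \<noteq> 0" by (auto simp: eventually_at intro!: exI[of _ 1])
    then show ?thesis using near[of \<zeta>] near[of \<xi>]
    proof eventually_elim
      case (elim h)
      have "norm (g (s, \<psi> + h *\<^sub>R \<zeta>) - g (s, \<psi> + h *\<^sub>R \<xi>)) \<le> real n * (\<bar>h\<bar> * M)"
      proof (rule tube_lipschitz[OF t s elim(2,3)])
        fix u assume "u \<in> {- real n..0}"
        then show "norm (hist_apply (\<psi> + h *\<^sub>R \<zeta>) u - hist_apply (\<psi> + h *\<^sub>R \<xi>) u) \<le> \<bar>h\<bar> * M"
          using mult_left_mono[OF M, of u "\<bar>h\<bar>"] by (simp add: hist_apply_simps flip: scaleR_diff_right)
      qed
      moreover have "q h = (1 / h) *\<^sub>R (g (s, \<psi> + h *\<^sub>R \<zeta>) - g (s, \<psi> + h *\<^sub>R \<xi>))"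
        by (simp add: q_def dir_quotient_def algebra_simps)
      ultimately have "norm (q h) \<le> (1 / \<bar>h\<bar>) * (real n * (\<bar>h\<bar> * M))"
        using mult_left_mono[of _ "real n * (\<bar>h\<bar> * M)" "1 / \<bar>h\<bar>"] by simp
      then show ?case using elim(1) by simp
    qed
  qed
  ultimately show ?thesis
    using tendsto_upperbound[OF tendsto_norm, of q _ "at 0" "real n * M"] by simp
qed

lemma continuous_on_g_path:
  assumes "continuous_on UNIV y" "\<And>s. s \<in> S \<Longrightarrow> (s, hist_at y s) \<in> V"
  shows "continuous_on S (\<lambda>s. g (s, hist_at y s))"
  using assms by (intro continuous_on_compose2[OF cont_g] continuous_intros continuous_on_hist_at) auto

lemma continuous_on_D_path:
  assumes "continuous_on UNIV y" "continuous_on UNIV w" "\<And>s. s \<in> S \<Longrightarrow> (s, hist_at y s) \<in> V"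
  shows "continuous_on S (\<lambda>s. D (s, hist_at y s) (hist_at w s))"
proof -
  have "continuous_on S (\<lambda>s. (\<lambda>(p, \<zeta>). D p \<zeta>) ((s, hist_at y s), hist_at w s))"
    using assms by (intro continuous_on_compose2[OF cont_D] continuous_intros continuous_on_hist_at) auto
  then show ?thesis by simp
qed

text \<open>Paths are continuous on the whole line, so segments exist and vary continuously at every
  time; the equation constrains only values up to \<open>b\<close>.\<close>

definition sol :: "real \<Rightarrow> real \<Rightarrow> (real \<Rightarrow> 'a) \<Rightarrow> bool" where
  "sol a b x \<longleftrightarrow> continuous_on UNIV x \<and>
     (\<forall>t\<in>{a..b}. (t, hist_at x t) \<in> V \<and>
       (x has_vector_derivative g (t, hist_at x t)) (at t within {a..b}))"

lemma sol_subinterval: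
  assumes "sol a b x" "b' \<le> b"
  shows "sol a b' x"
proof -
  have "{a..b'} \<subseteq> {a..b}" using assms(2) by auto
  with assms(1) show ?thesis
    unfolding sol_def by (meson has_vector_derivative_within_subset subsetD)
qed

text \<open>\<open>y\<close> is not known to stay in the tube around \<open>x\<close>. If its
  deviation \<open>M\<close> on the window is below the radius, the tube gives the Lipschitz bound;
  otherwise \<open>1 \<le> (real n + 1) * M\<close> makes the crude bound \<open>norm (h s0)\<close>
  linear in \<open>M\<close> as well. One constant \<open>L\<close> covers both, so no continuation
  argument is needed.\<close>

lemma sol_unique:
  assumes x: "sol a b x" and y: "sol a b y" and init: "hist_at x a = hist_at y a" and t: "t \<le> b"
  shows "x t = y t"
proof -
  have cx: "continuous_on UNIV x" and cy: "continuous_on UNIV y" using x y by (auto simp: sol_def)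
  have pre: "x r = y r" if "r \<le> a" for r
    using init hist_apply_hist_at_UNIV[OF cx, of "r - a" a] hist_apply_hist_at_UNIV[OF cy, of "r - a" a] that
    by simp
  show ?thesis
  proof (cases "t \<le> a")
    case False
    then have ab: "a \<le> b" using t by simp
    obtain n where n: "1 \<le> n" "tube x a b n"
      using tube_exists[OF cx, of a b 1] x by (auto simp: sol_def)
    define h where "h = (\<lambda>s. g (s, hist_at x s) - g (s, hist_at y s))"
    have "continuous_on {a..b} (\<lambda>s. norm (h s))"
      unfolding h_def using x y by (intro continuous_intros continuous_on_g_path) (auto simp: sol_def)
    then obtain s0 where s0: "\<And>s. s \<in> {a..b} \<Longrightarrow> norm (h s) \<le> norm (h s0)"
      using continuous_attains_sup[of "{a..b}" "\<lambda>s. norm (h s)"] ab by fastforce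
    define L where "L = max (real n) (norm (h s0) * (real n + 1))"
    have L: "1 \<le> L" using n by (simp add: L_def)
    have "norm (x t - y t) \<le> 2 * (0 + 0) * exp (2 * L * (b - a))"
    proof (rule functional_gronwall[OF ab L, where h = h and T = "real n"])
      show "continuous_on {a..b} (\<lambda>t. x t - y t)"
        by (intro continuous_intros continuous_on_subset[OF cx] continuous_on_subset[OF cy]) auto
      show "((\<lambda>t. x t - y t) has_vector_derivative h s) (at s within {a..b})" if "s \<in> {a..b}" for s
        unfolding h_def using x y that by (intro derivative_intros) (auto simp: sol_def)
      show "norm (x r - y r) \<le> 0" if "r \<in> {a - real n..a}" for r using pre that by auto
      show "norm (h s) \<le> 0 + L * M"
        if s: "s \<in> {a..b}" and M: "\<And>r. r \<in> {s - real n..s} \<Longrightarrow> norm (x r - y r) \<le> M" for s M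
      proof -
        have M0: "M \<ge> 0" using M[of s] norm_ge_zero[of "x s - y s"] by (simp del: norm_ge_zero)
        show ?thesis
        proof (cases "M < 1 / (real n + 1)")
          case True
          have "norm (h s) \<le> real n * M"
            unfolding h_def
          proof (rule tube_lipschitz[OF n(2) s])
            show "hist_at y s \<in> hist_nbhd n (hist_at x s)"
              unfolding hist_at_mem_nbhd_iff[OF cx cy]
              using M True by (auto simp: norm_minus_commute[of "y _"] intro!: le_less_trans[OF _ True])
            show "norm (hist_apply (hist_at x s) u - hist_apply (hist_at y s) u) \<le> M" if "u \<in> {- real n..0}" for u
              using M[of "s + u"] that cx cy by (simp add: hist_apply_hist_at_UNIV)
          qed simp
          also have "\<dots> \<le> L * M" using M0 by (intro mult_right_mono) (auto simp: L_def)
          finally show ?thesis by simp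
        next
          case False
          then have "1 \<le> (real n + 1) * M" by (simp add: field_simps)
          then have "norm (h s0) * 1 \<le> norm (h s0) * ((real n + 1) * M)" by (intro mult_left_mono) auto
          also have "\<dots> = (norm (h s0) * (real n + 1)) * M" by simp
          also have "\<dots> \<le> L * M" using M0 by (intro mult_right_mono) (auto simp: L_def)
          finally show ?thesis using s0[OF s] by simp
        qed
      qed
      show "t \<in> {a - real n..b}" using t False n by auto
    qed auto
    then show ?thesis by simp
  qed (use pre in simp)
qed

end

section \<open>Continuous dependence on initial data\<close>

text \<open>Pointwise metric projection of \<open>y\<close> onto the closed ball of radius
  \<open>1 / (real n + 2)\<close> around \<open>x\<close>. The radius is strictly below that of
  \<open>hist_nbhd n\<close>, which is defined by strict inequalities.\<close>

definition trunc :: "nat \<Rightarrow> (real \<Rightarrow> 'a) \<Rightarrow> (real \<Rightarrow> 'a) \<Rightarrow> real \<Rightarrow> 'a::euclidean_space" where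
  "trunc n x y r = x r + closest_point (cball 0 (1 / (real n + 2))) (y r - x r)"

lemma closest_point_cball_0:
  fixes v :: "'a::euclidean_space"
  shows "norm (closest_point (cball 0 (1 / (real n + 2))) v) < 1 / (real n + 1)"
proof -
  have "closest_point (cball 0 (1 / (real n + 2))) v \<in> cball 0 (1 / (real n + 2))"
    by (intro closest_point_in_set) auto
  then have "norm (closest_point (cball 0 (1 / (real n + 2))) v) \<le> 1 / (real n + 2)"
    by (simp only: mem_cball_0)
  also have "\<dots> < 1 / (real n + 1)" by (intro divide_strict_left_mono) auto
  finally show ?thesis .
qed

lemma continuous_on_trunc:
  fixes x :: "real \<Rightarrow> 'a::euclidean_space"
  assumes "continuous_on S x" "continuous_on S y"
  shows "continuous_on S (trunc n x y)"
  unfolding trunc_def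
  by (intro continuous_intros assms continuous_on_compose2[OF continuous_on_closest_point[of _ UNIV]]) auto

lemma trunc_eq: "norm (y r - x r) \<le> 1 / (real n + 2) \<Longrightarrow> trunc n x y r = y r"
  by (simp add: trunc_def closest_point_self)

lemma norm_trunc_diff_le: "norm (trunc n x y r - trunc n x z r) \<le> norm (y r - z r)"
proof -
  have "dist (closest_point (cball 0 (1 / (real n + 2))) (y r - x r))
      (closest_point (cball 0 (1 / (real n + 2))) (z r - x r)) \<le> dist (y r - x r) (z r - x r)"
    by (rule closest_point_lipschitz) auto
  then show ?thesis by (simp add: trunc_def dist_norm)
qed

lemma hist_at_trunc_mem_nbhd:
  assumes "continuous_on UNIV x" "continuous_on UNIV y"
  shows "hist_at (trunc n x y) s \<in> hist_nbhd n (hist_at x s)"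
  unfolding hist_at_mem_nbhd_iff[OF assms(1) continuous_on_trunc[OF assms]]
  using closest_point_cball_0 by (auto simp: trunc_def)

context smooth_fde
begin

lemma hist_at_diff_bound:
  assumes "continuous_on UNIV (x :: real \<Rightarrow> 'a)" "continuous_on UNIV y"
    and "\<And>r. r \<in> {s - real n..s} \<Longrightarrow> norm (x r - y r) \<le> M" and "u \<in> {- real n..0}"
  shows "norm (hist_apply (hist_at x s) u - hist_apply (hist_at y s) u) \<le> M"
  using assms(3)[of "s + u"] assms(1,2,4) by (simp add: hist_apply_hist_at_UNIV)

text \<open>Before \<open>s - real n\<close> the truncated path may differ from \<open>y\<close>,
  but \<open>tube_lipschitz\<close> with \<open>M = 0\<close> shows that \<open>g\<close> does not
  notice.\<close>

lemma truncated_rhs_eq: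
  assumes t: "tube x a b n" and s: "s \<in> {a..b}" and x: "continuous_on UNIV x" and y: "continuous_on UNIV y"
    and near: "\<And>r. r \<in> {s - real n..s} \<Longrightarrow> norm (y r - x r) \<le> 1 / (real n + 2)"
  shows "(s, hist_at y s) \<in> V" "g (s, hist_at (trunc n x y) s) = g (s, hist_at y s)"
    "hist_at y s \<in> hist_nbhd n (hist_at x s)"
proof -
  have "1 / (real n + 2) < 1 / (real n + 1)" by (intro divide_strict_left_mono) auto
  then show nb: "hist_at y s \<in> hist_nbhd n (hist_at x s)"
    unfolding hist_at_mem_nbhd_iff[OF x y] using near by (auto intro!: le_less_trans[OF near])
  show "(s, hist_at y s) \<in> V" using tubeD(1)[OF t s nb] .
  have "norm (g (s, hist_at (trunc n x y) s) - g (s, hist_at y s)) \<le> real n * 0"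
  proof (rule tube_lipschitz[OF t s hist_at_trunc_mem_nbhd[OF x y] nb])
    fix u assume "u \<in> {- real n..0}"
    then show "norm (hist_apply (hist_at (trunc n x y) s) u - hist_apply (hist_at y s) u) \<le> 0"
      by (intro hist_at_diff_bound[OF continuous_on_trunc[OF x y] y]) (auto simp: trunc_eq near)
  qed
  then show "g (s, hist_at (trunc n x y) s) = g (s, hist_at y s)" by simp
qed

text \<open>The bound is global in \<open>y\<close> and \<open>z\<close> because both are first
  moved into the tube by a map that does not increase distances.\<close>

lemma truncated_rhs_lipschitz:
  assumes t: "tube x a b n" and s: "s \<in> {a..b}" and x: "continuous_on UNIV x"
    and y: "continuous_on UNIV y" and z: "continuous_on UNIV z"
    and M: "\<And>r. r \<in> {s - real n..s} \<Longrightarrow> norm (y r - z r) \<le> M"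
  shows "norm (g (s, hist_at (trunc n x y) s) - g (s, hist_at (trunc n x z) s)) \<le> real n * M"
  by (rule tube_lipschitz[OF t s hist_at_trunc_mem_nbhd[OF x y] hist_at_trunc_mem_nbhd[OF x z]],
      rule hist_at_diff_bound[OF continuous_on_trunc[OF x y] continuous_on_trunc[OF x z]])
    (auto intro: order_trans[OF norm_trunc_diff_le M])

lemma truncated_solution_exists:
  assumes t: "tube x a b n" and n: "1 \<le> n" and x: "continuous_on UNIV x"
    and p: "continuous_on UNIV p" and t0: "a \<le> t0" "t0 \<le> b"
  obtains y where "continuous_on UNIV y" "\<And>r. r \<le> t0 \<Longrightarrow> y r = p r"
    "\<And>s. s \<in> {t0..b} \<Longrightarrow> (y has_vector_derivative g (s, hist_at (trunc n x y) s)) (at s within {t0..b})"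
proof (rule functional_ode_exists[of t0 b "real n" "real n" p "\<lambda>s y. g (s, hist_at (trunc n x y) s)"])
  show "continuous_on {t0..b} (\<lambda>s. g (s, hist_at (trunc n x y) s))" if y: "continuous_on UNIV y" for y
    using tubeD(1)[OF t _ hist_at_trunc_mem_nbhd[OF x y]] t0
    by (intro continuous_on_g_path continuous_on_trunc x y) auto
  show "norm (g (s, hist_at (trunc n x y) s) - g (s, hist_at (trunc n x z) s)) \<le> real n * M"
    if "continuous_on UNIV y" "continuous_on UNIV z" "s \<in> {t0..b}"
      "\<And>r. r \<in> {s - real n..s} \<Longrightarrow> norm (y r - z r) \<le> M" for y z s M
    using that t0 by (intro truncated_rhs_lipschitz[OF t _ x]) auto
qed (use that n p t0 in auto)

lemma open_path_domain:
  assumes x: "continuous_on UNIV x" and V: "(s0, hist_at x s0) \<in> V"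
  obtains d where "d > 0" "\<And>s. \<bar>s - s0\<bar> < d \<Longrightarrow> (s, hist_at x s) \<in> V"
proof -
  have "open ((\<lambda>s. (s, hist_at x s)) -` V)"
    by (intro open_vimage open_V continuous_intros continuous_on_hist_at x)
  moreover have "s0 \<in> (\<lambda>s. (s, hist_at x s)) -` V" using V by simp
  ultimately obtain d where d: "d > 0" "ball s0 d \<subseteq> (\<lambda>s. (s, hist_at x s)) -` V"
    unfolding open_contains_ball by blast
  have "(s, hist_at x s) \<in> V" if "\<bar>s - s0\<bar> < d" for s
    using d(2) that by (auto simp: subset_iff dist_real_def abs_minus_commute)
  with d(1) show thesis by (rule that)
qed

text \<open>The reference path is \<open>\<phi>\<close> continued constantly, with a tube on a short
  interval. The truncated solution agrees with it up to \<open>t0\<close>, hence by continuity stays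
  within the truncation radius for a while.\<close>

lemma local_solution_exists:
  assumes V: "(t0, \<phi>) \<in> V"
  obtains b x where "t0 < b" "sol t0 b x" "hist_at x t0 = \<phi>"
proof -
  define x where "x = (\<lambda>t. hist_ext \<phi> (t - t0))"
  have x: "continuous_on UNIV x"
    unfolding x_def by (intro continuous_on_compose2[OF continuous_on_hist_ext[of UNIV]] continuous_intros) auto
  have hx: "hist_at x t0 = \<phi>"
    unfolding hist_at_eq_iff[OF x] by (simp add: x_def hist_ext_def)
  obtain d where d: "d > 0" "\<And>s. \<bar>s - t0\<bar> < d \<Longrightarrow> (s, hist_at x s) \<in> V"
    using open_path_domain[OF x, of t0] V hx by metis
  define b0 where "b0 = t0 + d / 2"
  obtain n where n: "1 \<le> n" "tube x t0 b0 n"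
    using tube_exists[OF x, of t0 b0 1] d by (auto simp: b0_def)
  obtain y where y: "continuous_on UNIV y" "\<And>r. r \<le> t0 \<Longrightarrow> y r = x r"
    "\<And>s. s \<in> {t0..b0} \<Longrightarrow> (y has_vector_derivative g (s, hist_at (trunc n x y) s)) (at s within {t0..b0})"
    using truncated_solution_exists[OF n(2,1) x x, of t0] d by (auto simp: b0_def)
  have "continuous_on UNIV (\<lambda>r. norm (y r - x r))" by (intro continuous_intros x y)
  then have "((\<lambda>r. norm (y r - x r)) \<longlongrightarrow> norm (y t0 - x t0)) (at t0)"
    by (simp add: continuous_on_def)
  then have "\<forall>\<^sub>F r in at t0. norm (y r - x r) < 1 / (real n + 2)"
    using y(2)[of t0] by (intro order_tendstoD(2)) auto
  then obtain e where e: "e > 0" "\<And>r. r \<noteq> t0 \<Longrightarrow> dist r t0 < e \<Longrightarrow> norm (y r - x r) < 1 / (real n + 2)"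
    unfolding eventually_at by blast
  define b where "b = min b0 (t0 + e / 2)"
  have b: "t0 < b" "b \<le> b0" using d e by (auto simp: b_def b0_def)
  have near: "norm (y r - x r) \<le> 1 / (real n + 2)" if "r \<le> b" for r
    using that y(2)[of r] e(2)[of r] e(1) by (cases "r \<le> t0") (auto simp: dist_real_def b_def less_imp_le)
  have "sol t0 b y"
    unfolding sol_def
  proof (intro conjI ballI y(1))
    fix s assume s: "s \<in> {t0..b}"
    then have s': "s \<in> {t0..b0}" using b by auto
    note eq = truncated_rhs_eq[OF n(2) s' x y(1)]
    show "(s, hist_at y s) \<in> V" using s near by (intro eq) auto
    have "g (s, hist_at (trunc n x y) s) = g (s, hist_at y s)" using s near by (intro eq) auto
    then show "(y has_vector_derivative g (s, hist_at y s)) (at s within {t0..b})"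
      using y(3)[OF s'] b(2) by (auto elim!: has_vector_derivative_within_subset)
  qed
  moreover have "hist_at y t0 = \<phi>" using hist_at_cong[of t0 y x] y(2) hx by simp
  ultimately show thesis using b that by blast
qed

lemma path_uniformly_near:
  fixes x :: "real \<Rightarrow> 'a"
  assumes "continuous_on UNIV x" "e > 0"
  obtains d where "d > 0" "d \<le> 1" "\<And>r \<tau>. r \<in> {c..d'} \<Longrightarrow> \<bar>\<tau>\<bar> < d \<Longrightarrow> norm (x (r + \<tau>) - x r) < e"
proof -
  have "uniformly_continuous_on {c - 1..d' + 1} x"
    by (intro compact_uniformly_continuous continuous_on_subset[OF assms(1)]) auto
  then obtain d where d: "d > 0"
    "\<And>r r'. r \<in> {c - 1..d' + 1} \<Longrightarrow> r' \<in> {c - 1..d' + 1} \<Longrightarrow> dist r' r < d \<Longrightarrow> dist (x r') (x r) < e"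
    unfolding uniformly_continuous_on_def using assms(2) by blast
  show thesis
  proof
    show "norm (x (r + \<tau>) - x r) < e" if "r \<in> {c..d'}" "\<bar>\<tau>\<bar> < min d 1" for r \<tau>
      using d(2)[of r "r + \<tau>"] that by (auto simp: dist_norm abs_less_iff)
  qed (use d in auto)
qed

text \<open>
  A solution starting at a nearby time \<open>t0'\<close> is compared with the time shift of \<open>x\<close> that has
  its initial segment at \<open>t0'\<close>; the solution \<open>x\<close> itself need not solve the equation before \<open>t0\<close>.
\<close>

lemma sol_continuous_dependence:
  assumes x: "sol t0 b x" and b': "t0 < b'" "b' < b"
  obtains m :: nat where "\<And>t0' \<phi>. \<bar>t0' - t0\<bar> < 1 / (real m + 1) \<Longrightarrow> \<phi> \<in> hist_nbhd m (hist_at x t0) \<Longrightarrow>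
    \<exists>y. sol t0' b' y \<and> hist_at y t0' = \<phi> \<and> (\<forall>r\<in>{t0' - real N..b'}. norm (y r - x r) < 1 / (real N + 1))"
proof -
  have cx: "continuous_on UNIV x" and Vx: "\<And>s. s \<in> {t0..b} \<Longrightarrow> (s, hist_at x s) \<in> V"
    using x by (auto simp: sol_def)
  obtain \<eta> where \<eta>: "\<eta> > 0" "\<And>s. \<bar>s - t0\<bar> < \<eta> \<Longrightarrow> (s, hist_at x s) \<in> V"
    using open_path_domain[OF cx Vx[of t0]] b' by auto
  \<comment> \<open>Starting times slightly before \<open>t0\<close> must lie in the interval of the
    tube; there \<open>x\<close> is only a path with
    \<open>(s, hist_at x s) \<in> V\<close>.\<close>
  define a where "a = t0 - \<eta> / 2"
  have a: "a < t0" using \<eta> by (simp add: a_def)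
  have "(s, hist_at x s) \<in> V" if "s \<in> {a..b}" for s
    using \<eta> Vx that by (cases "s < t0") (auto simp: a_def)
  then obtain n where n: "N \<le> n" "1 \<le> n" "tube x a b n" using tube_exists[OF cx, of a b N] by blast
  \<comment> \<open>Half of the truncation radius: one half for the distance from \<open>y\<close>
    to the shifted path, one for the distance from the shifted path to \<open>x\<close>.\<close>
  define \<kappa> where "\<kappa> = 1 / (2 * (real n + 2))"
  have \<kappa>: "\<kappa> > 0" by (simp add: \<kappa>_def)
  have \<kappa>2: "\<kappa> + \<kappa> = 1 / (real n + 2)" by (simp add: \<kappa>_def field_simps)
  define E where "E = exp (2 * real n * (b - a))"
  have E: "E \<ge> 1" using a b' by (simp add: E_def)
  \<comment> \<open>With initial error and defect at most \<open>c\<close>, the Gronwall bound is at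
    most \<open>\<kappa> / 2\<close>.\<close>
  define c where "c = \<kappa> / (8 * E)"
  have c: "c > 0" using \<kappa> E by (simp add: c_def)
  have cE: "2 * (c + c) * E < \<kappa>" using \<kappa> E by (simp add: c_def)

  obtain d1 where d1: "d1 > 0" "d1 \<le> 1"
    "\<And>r \<tau>. r \<in> {a - real n - 1..b} \<Longrightarrow> \<bar>\<tau>\<bar> < d1 \<Longrightarrow> norm (x (r + \<tau>) - x r) < \<kappa>"
    using path_uniformly_near[OF cx \<kappa>] by blast
  \<comment> \<open>The shifted path has derivative \<open>F (s + \<tau>, 0)\<close> at
    \<open>s\<close>, while the equation asks for \<open>F (s, \<tau>)\<close>. Uniform continuity
    of \<open>F\<close> on \<open>K\<close> makes this defect small.\<close>
  define F where "F = (\<lambda>(s, \<tau>). g (s, hist_at x (s + \<tau>)))"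
  define K where "K = {a..b} \<times> {- d1 / 2..d1 / 2}"
  have near: "hist_at (\<lambda>r. x (r + \<tau>)) s \<in> hist_nbhd n (hist_at x s)
      \<and> (\<forall>r\<in>{s - real n..s}. norm (x (r + \<tau>) - x r) \<le> 1 / (real n + 2))"
    if "s \<in> {a..b}" "\<bar>\<tau>\<bar> < d1" for s \<tau>
  proof -
    have cx': "continuous_on UNIV (\<lambda>r. x (r + \<tau>))"
      by (intro continuous_on_compose2[OF cx] continuous_intros) auto
    have *: "norm (x (r + \<tau>) - x r) < \<kappa>" if r: "r \<in> {s - real n..s}" for r
      using r \<open>s \<in> {a..b}\<close> \<open>\<bar>\<tau>\<bar> < d1\<close> by (intro d1(3)) auto
    moreover have "\<kappa> \<le> 1 / (real n + 1)" "\<kappa> \<le> 1 / (real n + 2)"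
      unfolding \<kappa>_def by (intro divide_left_mono; simp)+
    ultimately show ?thesis
      unfolding hist_at_mem_nbhd_iff[OF cx cx'] by (auto intro!: less_le_trans[OF *] order_trans[OF less_imp_le[OF *]])
  qed
  have shift: "hist_at (\<lambda>r. x (r + \<tau>)) s = hist_at x (s + \<tau>)" for s \<tau>
    unfolding hist_at_def by (simp add: algebra_simps)
  have "continuous_on K F"
    unfolding F_def split_def
  proof (rule continuous_on_compose2[OF cont_g])
    show "continuous_on K (\<lambda>p. (fst p, hist_at x (fst p + snd p)))"
      by (intro continuous_intros continuous_on_compose2[OF continuous_on_hist_at[OF cx, of UNIV]]) auto
    show "(\<lambda>p. (fst p, hist_at x (fst p + snd p))) ` K \<subseteq> V"
    proof
      fix q assume "q \<in> (\<lambda>p. (fst p, hist_at x (fst p + snd p))) ` K"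
      then obtain s \<tau> where st: "q = (s, hist_at x (s + \<tau>))" "s \<in> {a..b}" "\<tau> \<in> {- d1 / 2..d1 / 2}"
        by (auto simp: K_def)
      then have "\<bar>\<tau>\<bar> < d1" using d1(1) by (auto simp: abs_if)
      then show "q \<in> V" using tubeD(1)[OF n(3) st(2)] near[OF st(2)] st(1) shift by metis
    qed
  qed
  moreover have "compact K" unfolding K_def by (intro compact_Times compact_Icc)
  ultimately have "uniformly_continuous_on K F" by (rule compact_uniformly_continuous)
  then obtain d2 where d2: "d2 > 0" "\<And>p q. p \<in> K \<Longrightarrow> q \<in> K \<Longrightarrow> dist q p < d2 \<Longrightarrow> dist (F q) (F p) < c"
    unfolding uniformly_continuous_on_def using c by metis

  \<comment> \<open>The entry \<open>\<eta> / 2\<close> keeps \<open>t0'\<close> at or above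
    \<open>a\<close>, \<open>b - b'\<close> keeps the shifted path on the interval where
    \<open>x\<close> is a solution, \<open>b' - t0\<close> keeps \<open>t0'\<close> below
    \<open>b'\<close>, and \<open>c\<close> bounds the initial error.\<close>
  define d where "d = Min {d1 / 2, d2 / 2, \<eta> / 2, b - b', b' - t0, c}"
  have d: "d > 0" using d1(1) d2(1) \<eta>(1) b' c by (simp add: d_def)
  have dle: "d \<le> d1 / 2" "d \<le> d2 / 2" "d \<le> \<eta> / 2" "d \<le> b - b'" "d \<le> b' - t0" "d \<le> c"
    unfolding d_def by (rule Min_le; simp)+
  obtain m where m: "n \<le> m" "1 / (real m + 1) < d" using obtain_nat_inverse_less[OF d] .
  show thesis
  proof (rule that)
    fix t0' \<phi> assume t0': "\<bar>t0' - t0\<bar> < 1 / (real m + 1)" and \<phi>: "\<phi> \<in> hist_nbhd m (hist_at x t0)"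
    define \<tau> where "\<tau> = t0 - t0'"
    have \<tau>: "\<bar>\<tau>\<bar> < d" using t0' m by (simp add: \<tau>_def)
    have t0'_bds: "a \<le> t0'" "t0' < b'" "b' + \<tau> \<le> b"
      using \<tau> dle a unfolding \<tau>_def a_def by linarith+
    define p where "p = (\<lambda>t. hist_ext \<phi> (t - t0'))"
    have p: "continuous_on UNIV p"
      unfolding p_def by (intro continuous_on_compose2[OF continuous_on_hist_ext[of UNIV]] continuous_intros) auto
    obtain y where y: "continuous_on UNIV y" "\<And>r. r \<le> t0' \<Longrightarrow> y r = p r"
      "\<And>s. s \<in> {t0'..b} \<Longrightarrow> (y has_vector_derivative g (s, hist_at (trunc n x y) s)) (at s within {t0'..b})"
      using truncated_solution_exists[OF n(3,2) cx p, of t0'] t0'_bds b' by auto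
    define xs where "xs = (\<lambda>r. x (r + \<tau>))"
    have cxs: "continuous_on UNIV xs"
      unfolding xs_def by (intro continuous_on_compose2[OF cx] continuous_intros) auto
    define h where "h = (\<lambda>s. g (s, hist_at (trunc n x y) s) - g (s + \<tau>, hist_at x (s + \<tau>)))"
    have yxs: "norm (y r - xs r) < \<kappa>" if r: "r \<in> {t0' - real n..b'}" for r
    proof -
      have "norm (y r - xs r) \<le> 2 * (c + c) * exp (2 * real n * (b' - t0'))"
      proof (rule functional_gronwall[where h = h and T = "real n"])
        show "t0' \<le> b'" using t0'_bds by simp
        show "continuous_on {t0'..b'} (\<lambda>r. y r - xs r)"
          by (intro continuous_intros continuous_on_subset[OF y(1)] continuous_on_subset[OF cxs]) auto
        show "((\<lambda>r. y r - xs r) has_vector_derivative h s) (at s within {t0'..b'})" if s: "s \<in> {t0'..b'}" for s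
        proof -
          have "(y has_vector_derivative g (s, hist_at (trunc n x y) s)) (at s within {t0'..b'})"
            using y(3)[of s] s b' by (auto elim!: has_vector_derivative_within_subset)
          moreover have "(xs has_vector_derivative g (s + \<tau>, hist_at x (s + \<tau>))) (at s within {t0'..b'})"
          proof -
            have "s + \<tau> \<in> {t0..b}" using s t0'_bds by (auto simp: \<tau>_def)
            then have "(x has_vector_derivative g (s + \<tau>, hist_at x (s + \<tau>))) (at (s + \<tau>) within {t0..b})"
              using x by (auto simp: sol_def)
            then have "(x has_vector_derivative g (s + \<tau>, hist_at x (s + \<tau>)))
                (at (s + \<tau>) within (\<lambda>s. s + \<tau>) ` {t0'..b'})"
              by (rule has_vector_derivative_within_subset) (use t0'_bds in \<open>auto simp: \<tau>_def\<close>)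
            moreover have "((\<lambda>s. s + \<tau>) has_vector_derivative 1) (at s within {t0'..b'})"
              by (auto intro!: derivative_eq_intros)
            ultimately show ?thesis
              using vector_diff_chain_within[of "\<lambda>s. s + \<tau>" 1 s "{t0'..b'}" x] by (simp add: xs_def o_def)
          qed
          ultimately show ?thesis unfolding h_def by (intro derivative_intros)
        qed
        show "norm (y r - xs r) \<le> c" if r: "r \<in> {t0' - real n..t0'}" for r
        proof -
          have "r - t0' \<in> {- real m..0}" using r m by auto
          then have "norm (hist_apply \<phi> (r - t0') - hist_apply (hist_at x t0) (r - t0')) < 1 / (real m + 1)"
            using \<phi> unfolding hist_nbhd_def by blast
          moreover have "y r = hist_apply \<phi> (r - t0')" using y(2)[of r] r by (simp add: p_def hist_ext_def)
          moreover have "xs r = hist_apply (hist_at x t0) (r - t0')"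
            using r by (simp add: hist_apply_hist_at_UNIV[OF cx] xs_def \<tau>_def algebra_simps)
          ultimately show ?thesis using m dle by simp
        qed
        show "norm (h s) \<le> c + real n * M"
          if s: "s \<in> {t0'..b'}" and M: "\<And>r. r \<in> {s - real n..s} \<Longrightarrow> norm (y r - xs r) \<le> M" for s M
        proof -
          have s': "s \<in> {a..b}" using s t0'_bds b' by auto
          have "norm (g (s, hist_at (trunc n x y) s) - g (s, hist_at (trunc n x xs) s)) \<le> real n * M"
            using M by (intro truncated_rhs_lipschitz[OF n(3) s' cx y(1) cxs]) auto
          moreover have "g (s, hist_at (trunc n x xs) s) = g (s, hist_at xs s)"
            using near[OF s', of \<tau>] \<tau> dle d1(1)
            by (intro truncated_rhs_eq[OF n(3) s' cx cxs]) (auto simp: xs_def)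
          moreover have "hist_at xs s = hist_at x (s + \<tau>)" unfolding xs_def by (rule shift)
          moreover have "dist (F (s, \<tau>)) (F (s + \<tau>, 0)) < c"
          proof (rule d2(2))
            have "\<bar>\<tau>\<bar> \<le> d1 / 2" using \<tau> dle by linarith
            then show "(s, \<tau>) \<in> K" using s' by (auto simp: K_def abs_le_iff)
            have "s + \<tau> \<in> {a..b}" using s t0'_bds a by (auto simp: \<tau>_def)
            then show "(s + \<tau>, 0) \<in> K" using d1 by (simp add: K_def)
            have "dist (s, \<tau>) (s + \<tau>, 0) \<le> dist s (s + \<tau>) + dist \<tau> 0"
              using sqrt_sum_squares_le_sum[of "dist s (s + \<tau>)" "\<bar>\<tau>\<bar>"] by (simp add: dist_prod_def)
            also have "\<dots> < d2" using \<tau> dle by (simp add: dist_real_def)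
            finally show "dist (s, \<tau>) (s + \<tau>, 0) < d2" .
          qed
          ultimately show ?thesis
            using norm_triangle_ineq[of "g (s, hist_at (trunc n x y) s) - g (s, hist_at (trunc n x xs) s)"
                "g (s, hist_at x (s + \<tau>)) - g (s + \<tau>, hist_at x (s + \<tau>))"]
            by (simp add: h_def F_def dist_norm)
        qed
      qed (use n c r in auto)
      also have "\<dots> \<le> 2 * (c + c) * E"
        unfolding E_def using c t0'_bds b' by (intro mult_left_mono) (auto intro!: mult_left_mono)
      also have "\<dots> < \<kappa>" by (rule cE)
      finally show ?thesis .
    qed
    have yx: "norm (y r - x r) < 1 / (real n + 2)" if r: "r \<in> {t0' - real n..b'}" for r
    proof -
      have "norm (xs r - x r) < \<kappa>"
        unfolding xs_def using r t0'_bds b' \<tau> dle d1(1) by (intro d1(3)) auto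
      then show ?thesis
        using yxs[OF r] \<kappa>2 norm_triangle_ineq[of "y r - xs r" "xs r - x r"] by simp
    qed
    have "sol t0' b' y"
      unfolding sol_def
    proof (intro conjI ballI y(1))
      fix s assume s: "s \<in> {t0'..b'}"
      then have s': "s \<in> {a..b}" "s \<in> {t0'..b}" using t0'_bds b' by auto
      note eq = truncated_rhs_eq[OF n(3) s'(1) cx y(1)]
      show "(s, hist_at y s) \<in> V" using s by (intro eq less_imp_le[OF yx]) auto
      have "g (s, hist_at (trunc n x y) s) = g (s, hist_at y s)"
        using s by (intro eq less_imp_le[OF yx]) auto
      then show "(y has_vector_derivative g (s, hist_at y s)) (at s within {t0'..b'})"
        using y(3)[OF s'(2)] b' by (auto elim!: has_vector_derivative_within_subset)
    qed
    moreover have "hist_at y t0' = \<phi>"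
      unfolding hist_at_eq_iff[OF y(1)] using y(2) by (auto simp: p_def hist_ext_def)
    moreover have "norm (y r - x r) < 1 / (real N + 1)" if "r \<in> {t0' - real N..b'}" for r
    proof -
      have "norm (y r - x r) < 1 / (real n + 2)" using that n by (intro yx) auto
      also have "\<dots> \<le> 1 / (real N + 1)" using n by (intro divide_left_mono) auto
      finally show ?thesis .
    qed
    ultimately show "\<exists>y. sol t0' b' y \<and> hist_at y t0' = \<phi> \<and>
        (\<forall>r\<in>{t0' - real N..b'}. norm (y r - x r) < 1 / (real N + 1))" by blast
  qed
qed

end

section \<open>The linear variational equation\<close>

text \<open>
  Continuity of \<open>p \<mapsto> D p\<close> uniformly over the directions in \<open>W\<close>: \<open>C\<^sup>1\<^sub>M\<^sub>B\<close> yields it for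
  compact \<open>W\<close>, and \<open>C\<^sup>1\<^sub>F\<close> for all bounded \<open>W\<close>.
\<close>

definition D_equicont ::
    "'p::topological_space set \<Rightarrow> ('p \<Rightarrow> 'd \<Rightarrow> 'w::real_normed_vector) \<Rightarrow> 'd set \<Rightarrow> bool" where
  "D_equicont V D W \<longleftrightarrow> (\<forall>p\<in>V. \<forall>e>0. \<exists>N. open N \<and> p \<in> N \<and>
     (\<forall>q\<in>N \<inter> V. \<forall>\<zeta>\<in>W. norm (D q \<zeta> - D p \<zeta>) < e))"

context smooth_fde
begin

definition lin_sol :: "real \<Rightarrow> real \<Rightarrow> (real \<Rightarrow> 'a) \<Rightarrow> (real \<Rightarrow> 'a) \<Rightarrow> bool" where
  "lin_sol a b x w \<longleftrightarrow> continuous_on UNIV w \<and>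
     (\<forall>t\<in>{a..b}. (w has_vector_derivative D (t, hist_at x t) (hist_at w t)) (at t within {a..b}))"

text \<open>By \<open>tube_D_lipschitz\<close> the right-hand side is Lipschitz on all histories, so
  the solution reaches \<open>b\<close> without truncation.\<close>

lemma lin_sol_exists:
  assumes x: "sol a b x" and ab: "a \<le> b"
  obtains w where "lin_sol a b x w" "hist_at w a = v"
proof -
  have cx: "continuous_on UNIV x" and Vx: "\<And>s. s \<in> {a..b} \<Longrightarrow> (s, hist_at x s) \<in> V"
    using x by (auto simp: sol_def)
  obtain n where n: "1 \<le> n" "tube x a b n" using tube_exists[OF cx Vx, of a b 1] by blast
  define p where "p = (\<lambda>t. hist_ext v (t - a))"
  have p: "continuous_on UNIV p"
    unfolding p_def by (intro continuous_on_compose2[OF continuous_on_hist_ext[of UNIV]] continuous_intros) auto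
  obtain w where w: "continuous_on UNIV w" "\<And>t. t \<le> a \<Longrightarrow> w t = p t"
    "\<And>t. t \<in> {a..b} \<Longrightarrow> (w has_vector_derivative D (t, hist_at x t) (hist_at w t)) (at t within {a..b})"
  proof (rule functional_ode_exists[of a b "real n" "real n" p "\<lambda>s w. D (s, hist_at x s) (hist_at w s)"])
    show "continuous_on {a..b} (\<lambda>s. D (s, hist_at x s) (hist_at w s))" if "continuous_on UNIV w" for w
      using Vx by (intro continuous_on_D_path cx that)
    show "norm (D (s, hist_at x s) (hist_at w s) - D (s, hist_at x s) (hist_at z s)) \<le> real n * M"
      if "continuous_on UNIV w" "continuous_on UNIV z" "s \<in> {a..b}"
        "\<And>r. r \<in> {s - real n..s} \<Longrightarrow> norm (w r - z r) \<le> M" for w z s M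
      by (rule tube_D_lipschitz[OF n(2) that(3) hist_nbhd_self], rule hist_at_diff_bound)
        (use that in auto)
  qed (use ab n p in auto)
  have "hist_at w a = v"
    unfolding hist_at_eq_iff[OF w(1)] using w(2) by (auto simp: p_def hist_ext_def)
  with w(1,3) show thesis by (intro that[of w]) (auto simp: lin_sol_def)
qed

text \<open>\<open>z\<close> is an approximate solution along \<open>y\<close> with defect at most
  \<open>e\<close>. It will be a solution along \<open>x\<close> when dependence on the path is
  studied, and the zero function when solutions are to be bounded.\<close>

lemma lin_sol_gronwall:
  assumes ab: "a \<le> b" and n: "tube x a b n" "1 \<le> n"
    and y: "\<And>s. s \<in> {a..b} \<Longrightarrow> hist_at y s \<in> hist_nbhd n (hist_at x s)"
    and w: "lin_sol a b y w" and c: "0 \<le> c"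
    and z: "continuous_on UNIV z" and e: "0 \<le> e"
    and deriv: "\<And>s. s \<in> {a..b} \<Longrightarrow> (z has_vector_derivative h s) (at s within {a..b})"
    and h: "\<And>s. s \<in> {a..b} \<Longrightarrow> norm (h s - D (s, hist_at y s) (hist_at z s)) \<le> e"
    and init: "\<And>r. r \<in> {a - real n..a} \<Longrightarrow> norm (w r - z r) \<le> c"
    and t: "t \<in> {a - real n..b}"
  shows "norm (w t - z t) \<le> 2 * (c + e) * exp (2 * real n * (b - a))"
proof (rule functional_gronwall[where T = "real n" and
      h = "\<lambda>s. D (s, hist_at y s) (hist_at w s) - h s"])
  have cw: "continuous_on UNIV w" using w by (simp add: lin_sol_def)
  show "continuous_on {a..b} (\<lambda>t. w t - z t)"
    by (intro continuous_intros continuous_on_subset[OF cw] continuous_on_subset[OF z]) auto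
  show "((\<lambda>t. w t - z t) has_vector_derivative D (s, hist_at y s) (hist_at w s) - h s) (at s within {a..b})"
    if "s \<in> {a..b}" for s
    using w that deriv by (intro derivative_intros) (auto simp: lin_sol_def)
  show "norm (D (s, hist_at y s) (hist_at w s) - h s) \<le> e + real n * M"
    if s: "s \<in> {a..b}" and M: "\<And>r. r \<in> {s - real n..s} \<Longrightarrow> norm (w r - z r) \<le> M" for s M
  proof -
    have "norm (D (s, hist_at y s) (hist_at w s) - D (s, hist_at y s) (hist_at z s)) \<le> real n * M"
      by (rule tube_D_lipschitz[OF n(1) s y[OF s]], rule hist_at_diff_bound[OF cw z M])
    then show ?thesis
      using h[OF s] norm_triangle_ineq4[of "D (s, hist_at y s) (hist_at w s) - D (s, hist_at y s) (hist_at z s)"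
          "h s - D (s, hist_at y s) (hist_at z s)"] by simp
  qed
qed (use ab n c e init t in auto)

text \<open>Joint continuity at each \<open>(p, \<zeta>)\<close> gives a product neighbourhood on
  which \<open>D\<close> stays within \<open>e / 2\<close> of \<open>D p \<zeta>\<close>. Finitely
  many second factors cover \<open>W\<close>; the intersection of the corresponding first factors is
  the required neighbourhood of \<open>p\<close>.\<close>

lemma D_equicont_compact:
  assumes W: "compact W"
  shows "D_equicont V D W"
  unfolding D_equicont_def
proof (intro ballI allI impI)
  fix p and e :: real assume p: "p \<in> V" and e: "e > 0"
  define Q where "Q = (\<lambda>(N1, N2). open N1 \<and> open N2 \<and> p \<in> N1 \<and>
    (\<forall>q\<in>N1 \<inter> V. \<forall>\<xi>\<in>N2. norm (D q \<xi> - D p \<xi>) < e))"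
  have "\<exists>N. Q N \<and> \<zeta> \<in> snd N" for \<zeta>
  proof -
    define B where "B = ball (D p \<zeta>) (e / 2)"
    have "open ((\<lambda>(p, \<zeta>). D p \<zeta>) -` B \<inter> (V \<times> UNIV))"
      using cont_D open_V continuous_on_open_vimage[of "V \<times> UNIV"] open_Times open_UNIV
      unfolding B_def by blast
    moreover have "(p, \<zeta>) \<in> (\<lambda>(p, \<zeta>). D p \<zeta>) -` B \<inter> (V \<times> UNIV)"
      using p e by (simp add: B_def)
    ultimately obtain N1 N2 where N: "open N1" "open N2" "p \<in> N1" "\<zeta> \<in> N2"
      "N1 \<times> N2 \<subseteq> (\<lambda>(p, \<zeta>). D p \<zeta>) -` B \<inter> (V \<times> UNIV)"
      by (elim open_prod_elim[where x = "(p, \<zeta>)"]) auto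
    have "norm (D q \<xi> - D p \<xi>) < e" if "q \<in> N1" "\<xi> \<in> N2" for q \<xi>
    proof -
      have "D q \<xi> \<in> B" "D p \<xi> \<in> B" using that N by auto
      then have "dist (D q \<xi>) (D p \<xi>) < e"
        unfolding B_def mem_ball by (metis dist_commute dist_triangle_half_r)
      then show ?thesis by (simp add: dist_norm)
    qed
    then have "Q (N1, N2)" using N by (auto simp: Q_def)
    then show ?thesis using N(4) by (intro exI[of _ "(N1, N2)"]) simp
  qed
  then obtain N where N: "\<And>\<zeta>. Q (N \<zeta>)" "\<And>\<zeta>. \<zeta> \<in> snd (N \<zeta>)" by metis
  have "open (snd (N \<zeta>))" for \<zeta> using N(1)[of \<zeta>] by (auto simp: Q_def)
  moreover have "W \<subseteq> (\<Union>\<zeta>\<in>W. snd (N \<zeta>))" using N(2) by blast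
  ultimately obtain C where C: "C \<subseteq> W" "finite C" "W \<subseteq> (\<Union>\<zeta>\<in>C. snd (N \<zeta>))"
    using compactE_image[OF W, of W "\<lambda>\<zeta>. snd (N \<zeta>)"] by metis
  have "open (\<Inter>\<zeta>\<in>C. fst (N \<zeta>))" "p \<in> (\<Inter>\<zeta>\<in>C. fst (N \<zeta>))"
    using N(1) C(2) by (auto simp: Q_def split_def)
  moreover have "norm (D q \<xi> - D p \<xi>) < e" if q: "q \<in> (\<Inter>\<zeta>\<in>C. fst (N \<zeta>)) \<inter> V" and \<xi>: "\<xi> \<in> W" for q \<xi>
  proof -
    obtain \<zeta> where "\<zeta> \<in> C" "\<xi> \<in> snd (N \<zeta>)" using C(3) \<xi> by blast
    then show ?thesis using N(1)[of \<zeta>] q by (auto simp: Q_def split_def)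
  qed
  ultimately show "\<exists>N. open N \<and> p \<in> N \<and> (\<forall>q\<in>N \<inter> V. \<forall>\<zeta>\<in>W. norm (D q \<zeta> - D p \<zeta>) < e)"
    by blast
qed

text \<open>Near a time \<open>s0\<close> both values are compared with the derivative at
  \<open>(s0, hist_at x s0)\<close>, each up to \<open>e / 2\<close>; compactness of the interval
  then gives a common index.\<close>

lemma D_equicont_path:
  assumes W: "D_equicont V D W" and x: "continuous_on UNIV x"
    and V: "\<And>s. s \<in> {a..b} \<Longrightarrow> (s, hist_at x s) \<in> V" and e: "0 < e"
  obtains n where "\<And>s \<psi> \<zeta>. s \<in> {a..b} \<Longrightarrow> \<psi> \<in> hist_nbhd n (hist_at x s) \<Longrightarrow> (s, \<psi>) \<in> V \<Longrightarrow> \<zeta> \<in> W \<Longrightarrow>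
    norm (D (s, \<psi>) \<zeta> - D (s, hist_at x s) \<zeta>) < e"
proof -
  define P where "P = (\<lambda>s n. \<forall>\<psi>\<in>hist_nbhd n (hist_at x s). (s, \<psi>) \<in> V \<longrightarrow>
    (\<forall>\<zeta>\<in>W. norm (D (s, \<psi>) \<zeta> - D (s, hist_at x s) \<zeta>) < e))"
  have "\<exists>n. \<forall>s\<in>{a..b}. P s n"
  proof (rule compact_interval_uniform_index[where P = P and a = a and b = b])
    show "P s n" if "m \<le> n" "P s m" for s m n
      using that hist_nbhd_mono[OF that(1)] unfolding P_def by blast
  next
    fix s0 assume s0: "s0 \<in> {a..b}"
    define p where "p = (s0, hist_at x s0)"
    have p: "p \<in> V" using V[OF s0] by (simp add: p_def)
    have "0 < e / 2" using e by simp
    with W p obtain N where "open N \<and> p \<in> N \<and> (\<forall>q\<in>N \<inter> V. \<forall>\<zeta>\<in>W. norm (D q \<zeta> - D p \<zeta>) < e / 2)"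
      unfolding D_equicont_def by metis
    then have N: "open N" "p \<in> N" "\<And>q \<zeta>. q \<in> N \<Longrightarrow> q \<in> V \<Longrightarrow> \<zeta> \<in> W \<Longrightarrow> norm (D q \<zeta> - D p \<zeta>) < e / 2"
      by auto
    obtain A B where AB: "open A" "open B" "s0 \<in> A" "hist_at x s0 \<in> B" "A \<times> B \<subseteq> N"
      using N(1,2) unfolding p_def by (elim open_prod_elim) auto
    obtain d where d: "d > 0" "\<And>s. \<bar>s - s0\<bar> < d \<Longrightarrow> s \<in> A"
      using AB(1,3) unfolding open_dist by (auto simp: dist_real_def)
    obtain n where n: "hist_nbhd n (hist_at x s0) \<subseteq> B" using hist_nbhd_base[OF AB(2,4)] .
    obtain d' where d': "d' > 0" "\<And>s. \<bar>s - s0\<bar> < d' \<Longrightarrow> hist_at x s \<in> hist_nbhd (2 * n + 1) (hist_at x s0)"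
      using hist_at_near[OF x] by blast
    have "P s (2 * n + 1)" if s: "s \<in> {a..b}" "\<bar>s - s0\<bar> < min d d'" for s
      unfolding P_def
    proof (intro ballI impI)
      have mem: "(s, \<psi>) \<in> N" if "\<psi> \<in> hist_nbhd (2 * n + 1) (hist_at x s)" for \<psi>
        using hist_nbhd_triangle[OF d'(2)[of s] that] s d(2)[of s] n AB(5) by auto
      fix \<psi> \<zeta> assume \<psi>: "\<psi> \<in> hist_nbhd (2 * n + 1) (hist_at x s)" "(s, \<psi>) \<in> V" and \<zeta>: "\<zeta> \<in> W"
      have "norm (D (s, \<psi>) \<zeta> - D p \<zeta>) < e / 2" "norm (D (s, hist_at x s) \<zeta> - D p \<zeta>) < e / 2"
        using N(3)[OF mem \<psi>(2) \<zeta>] N(3)[OF mem V[OF s(1)] \<zeta>] \<psi>(1) by auto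
      then show "norm (D (s, \<psi>) \<zeta> - D (s, hist_at x s) \<zeta>) < e"
        using norm_triangle_ineq4[of "D (s, \<psi>) \<zeta> - D p \<zeta>" "D (s, hist_at x s) \<zeta> - D p \<zeta>"] by simp
    qed
    then show "\<exists>d>0. \<exists>n. \<forall>s\<in>{a..b}. \<bar>s - s0\<bar> < d \<longrightarrow> P s n"
      using d(1) d'(1) by (intro exI[of _ "min d d'"] conjI exI[of _ "2 * n + 1"]) auto
  qed blast
  then show thesis using that unfolding P_def by blast
qed

text \<open>In the equation along \<open>y\<close> the solution \<open>z\<close> along
  \<open>x\<close> has the defect \<open>D (s, hist_at x s) - D (s, hist_at y s)\<close> at
  \<open>hist_at z s\<close>. Only segments of \<open>z\<close> have to lie in \<open>W\<close>, and
  \<open>m\<close> serves all such \<open>z\<close> at once.\<close>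

lemma lin_sol_continuous_dependence:
  assumes x: "sol a b x" and ab: "a \<le> b" and W: "D_equicont V D W"
  obtains m :: nat where "\<And>y w z t. continuous_on UNIV y \<Longrightarrow>
    (\<And>r. r \<in> {a - real m..b} \<Longrightarrow> norm (y r - x r) < 1 / (real m + 1)) \<Longrightarrow>
    lin_sol a b y w \<Longrightarrow> lin_sol a b x z \<Longrightarrow> (\<And>s. s \<in> {a..b} \<Longrightarrow> hist_at z s \<in> W) \<Longrightarrow>
    hist_at w a \<in> hist_nbhd m (hist_at z a) \<Longrightarrow>
    t \<in> {a - real N..b} \<Longrightarrow> norm (w t - z t) < 1 / (real N + 1)"
proof -
  have cx: "continuous_on UNIV x" and Vx: "\<And>s. s \<in> {a..b} \<Longrightarrow> (s, hist_at x s) \<in> V"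
    using x by (auto simp: sol_def)
  obtain n where n: "N \<le> n" "1 \<le> n" "tube x a b n" using tube_exists[OF cx Vx, of a b N] by blast
  define E where "E = exp (2 * real n * (b - a))"
  have E: "E > 0" by (simp add: E_def)
  \<comment> \<open>Initial error and defect are both at most \<open>c\<close>, which makes the
    Gronwall bound half of \<open>1 / (real N + 1)\<close>.\<close>
  define c where "c = 1 / (8 * E * (real N + 1))"
  have c: "c > 0" using E by (simp add: c_def)
  have "2 * (c + c) * E = 1 / 2 * (1 / (real N + 1))" using E by (simp add: c_def)
  also have "\<dots> < 1 * (1 / (real N + 1))" by (intro mult_strict_right_mono) auto
  finally have cE: "2 * (c + c) * E < 1 / (real N + 1)" by simp
  obtain n1 where n1: "\<And>s \<psi> \<zeta>. s \<in> {a..b} \<Longrightarrow> \<psi> \<in> hist_nbhd n1 (hist_at x s) \<Longrightarrow> (s, \<psi>) \<in> V \<Longrightarrow> \<zeta> \<in> W \<Longrightarrow>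
      norm (D (s, \<psi>) \<zeta> - D (s, hist_at x s) \<zeta>) < c"
    using D_equicont_path[OF W cx Vx c, of a b] by blast
  obtain m where m: "max n n1 \<le> m" "1 / (real m + 1) < c" using obtain_nat_inverse_less[OF c] .
  show thesis
  proof (rule that)
    fix y w z t
    assume y: "continuous_on UNIV y" and near: "\<And>r. r \<in> {a - real m..b} \<Longrightarrow> norm (y r - x r) < 1 / (real m + 1)"
      and w: "lin_sol a b y w" and z: "lin_sol a b x z" and zW: "\<And>s. s \<in> {a..b} \<Longrightarrow> hist_at z s \<in> W"
      and init: "hist_at w a \<in> hist_nbhd m (hist_at z a)" and t: "t \<in> {a - real N..b}"
    have cw: "continuous_on UNIV w" and cz: "continuous_on UNIV z" using w z by (auto simp: lin_sol_def)
    have ym: "hist_at y s \<in> hist_nbhd m (hist_at x s)" if "s \<in> {a..b}" for s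
      unfolding hist_at_mem_nbhd_iff[OF cx y] using near that by auto
    have yn: "hist_at y s \<in> hist_nbhd n (hist_at x s)" "hist_at y s \<in> hist_nbhd n1 (hist_at x s)"
      if "s \<in> {a..b}" for s
      using ym[OF that] hist_nbhd_mono[of n m] hist_nbhd_mono[of n1 m] m by auto
    have "norm (w t - z t) \<le> 2 * (c + c) * exp (2 * real n * (b - a))"
    proof (rule lin_sol_gronwall[OF ab n(3,2) yn(1) w _ cz, where h = "\<lambda>s. D (s, hist_at x s) (hist_at z s)"])
      show "norm (D (s, hist_at x s) (hist_at z s) - D (s, hist_at y s) (hist_at z s)) \<le> c" if s: "s \<in> {a..b}" for s
        using n1[OF s yn(2)[OF s] tubeD(1)[OF n(3) s yn(1)[OF s]] zW[OF s]] by (simp add: norm_minus_commute)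
      show "norm (w r - z r) \<le> c" if "r \<in> {a - real n..a}" for r
      proof -
        have "r \<in> {a - real m..a}" using that m by auto
        then have "norm (w r - z r) < 1 / (real m + 1)"
          using init unfolding hist_at_mem_nbhd_iff[OF cz cw] by blast
        with m show ?thesis by simp
      qed
    qed (use z c t n in \<open>auto simp: lin_sol_def\<close>)
    also have "\<dots> < 1 / (real N + 1)" using cE by (simp add: E_def)
    finally show "norm (w t - z t) < 1 / (real N + 1)" .
  qed
qed

text \<open>The quotient \<open>(u - x) / h\<close> is compared with \<open>w\<close>. Its defect is
  split at the prediction \<open>hist_at x s + h *\<^sub>R hist_at w s\<close>: the distance from
  the segment of \<open>u\<close> gives a Lipschitz term in the very difference to be estimated, and
  the linearization error is small because the segments of \<open>w\<close> form a compact
  set.\<close>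

lemma sol_difference_quotient:
  assumes x: "sol t0 b x" and b': "t0 < b'" "b' < b" and w: "lin_sol t0 b' x w"
  obtains d where "d > 0" "\<And>h. h \<noteq> 0 \<Longrightarrow> \<bar>h\<bar> < d \<Longrightarrow>
    \<exists>u. sol t0 b' u \<and> hist_at u t0 = hist_at x t0 + h *\<^sub>R hist_at w t0 \<and>
      (\<forall>r\<in>{t0 - real N..b'}. norm ((1 / h) *\<^sub>R (u r - x r) - w r) < 1 / (real N + 1))"
proof -
  have x': "sol t0 b' x" using sol_subinterval[OF x] b' by simp
  have cx: "continuous_on UNIV x" and Vx: "\<And>s. s \<in> {t0..b'} \<Longrightarrow> (s, hist_at x s) \<in> V"
    using x' by (auto simp: sol_def)
  have cw: "continuous_on UNIV w" using w by (simp add: lin_sol_def)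
  obtain n where n: "N \<le> n" "1 \<le> n" "tube x t0 b' n" using tube_exists[OF cx Vx, of t0 b' N] by blast
  define E where "E = exp (2 * real n * (b' - t0))"
  have E: "E > 0" by (simp add: E_def)
  define c where "c = 1 / (8 * E * (real N + 1))"
  have c: "c > 0" using E by (simp add: c_def)
  have "2 * (0 + c) * E = 1 / 4 * (1 / (real N + 1))" using E by (simp add: c_def)
  also have "\<dots> < 1 * (1 / (real N + 1))" by (intro mult_strict_right_mono) auto
  finally have cE: "2 * (0 + c) * E < 1 / (real N + 1)" by simp
  have "compact (hist_at w ` {t0..b'})"
    by (intro compact_continuous_image continuous_on_hist_at cw compact_Icc)
  then have "D_equicont V D (hist_at w ` {t0..b'})" by (rule D_equicont_compact)
  from D_equicont_path[OF this cx Vx c, of t0 b'] obtain n1 where n1: "\<And>s \<psi>. s \<in> {t0..b'} \<Longrightarrow> \<psi> \<in> hist_nbhd n1 (hist_at x s) \<Longrightarrow> (s, \<psi>) \<in> V \<Longrightarrow>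
      norm (D (s, \<psi>) (hist_at w s) - D (s, hist_at x s) (hist_at w s)) < c"
    by (metis imageI)
  obtain m where m: "\<And>t0' \<phi>. \<bar>t0' - t0\<bar> < 1 / (real m + 1) \<Longrightarrow> \<phi> \<in> hist_nbhd m (hist_at x t0) \<Longrightarrow>
    \<exists>y. sol t0' b' y \<and> hist_at y t0' = \<phi> \<and> (\<forall>r\<in>{t0' - real n..b'}. norm (y r - x r) < 1 / (real n + 1))"
    using sol_continuous_dependence[OF x b', where N = n] by blast
  define k where "k = max (max n n1) m"
  obtain M where M: "0 \<le> M" "\<And>r. r \<in> {t0 - real k..b'} \<Longrightarrow> norm (w r) \<le> M"
    using path_bounded_on[OF cw, of "t0 - real k" b'] by auto
  \<comment> \<open>Chosen so that \<open>\<bar>\<theta>\<bar> < d\<close> keeps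
    \<open>\<theta> *\<^sub>R w\<close> below \<open>1 / (real k + 1)\<close> on all windows of
    length \<open>k\<close> ending in \<open>{t0..b'}\<close>.\<close>
  define d where "d = 1 / ((M + 1) * (real k + 1))"
  have d: "d > 0" using M by (simp add: d_def)
  have line: "hist_at x s + \<theta> *\<^sub>R hist_at w s \<in> hist_nbhd k (hist_at x s)"
    if s: "s \<in> {t0..b'}" and \<theta>: "\<bar>\<theta>\<bar> < d" for s \<theta>
    unfolding hist_nbhd_def
  proof (intro CollectI ballI)
    fix u assume u: "u \<in> {- real k..0}"
    have "\<bar>\<theta>\<bar> * norm (w (s + u)) \<le> \<bar>\<theta>\<bar> * (M + 1)"
      using M(2)[of "s + u"] s u by (intro mult_left_mono) auto
    also have "\<dots> < d * (M + 1)" using \<theta> M by (intro mult_strict_right_mono) auto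
    also have "\<dots> = 1 / (real k + 1)" using M by (simp add: d_def)
    finally show "norm (hist_apply (hist_at x s + \<theta> *\<^sub>R hist_at w s) u - hist_apply (hist_at x s) u) < 1 / (real k + 1)"
      using u by (simp add: hist_apply_simps hist_apply_hist_at_UNIV[OF cw])
  qed
  have line': "hist_at x s + \<theta> *\<^sub>R hist_at w s \<in> hist_nbhd n (hist_at x s)"
    "hist_at x s + \<theta> *\<^sub>R hist_at w s \<in> hist_nbhd n1 (hist_at x s)"
    "hist_at x s + \<theta> *\<^sub>R hist_at w s \<in> hist_nbhd m (hist_at x s)"
    if "s \<in> {t0..b'}" "\<bar>\<theta>\<bar> < d" for s \<theta>
  proof -
    have "n \<le> k" "n1 \<le> k" "m \<le> k" by (auto simp: k_def)
    then show "hist_at x s + \<theta> *\<^sub>R hist_at w s \<in> hist_nbhd n (hist_at x s)"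
      "hist_at x s + \<theta> *\<^sub>R hist_at w s \<in> hist_nbhd n1 (hist_at x s)"
      "hist_at x s + \<theta> *\<^sub>R hist_at w s \<in> hist_nbhd m (hist_at x s)"
      using line[OF that] hist_nbhd_mono by blast+
  qed
  show thesis
  proof (rule that[OF d])
    fix h :: real assume h0: "h \<noteq> 0" and h: "\<bar>h\<bar> < d"
    obtain u where u: "sol t0 b' u" "hist_at u t0 = hist_at x t0 + h *\<^sub>R hist_at w t0"
      "\<And>r. r \<in> {t0 - real n..b'} \<Longrightarrow> norm (u r - x r) < 1 / (real n + 1)"
      using m[of t0 "hist_at x t0 + h *\<^sub>R hist_at w t0"] line'(3)[of t0 h] h b' by auto
    have cu: "continuous_on UNIV u" using u by (simp add: sol_def)
    define z where "z = (\<lambda>r. (1 / h) *\<^sub>R (u r - x r))"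
    have cz: "continuous_on UNIV z" unfolding z_def by (intro continuous_intros cu cx)
    define f where "f = (\<lambda>s. (1 / h) *\<^sub>R (g (s, hist_at u s) - g (s, hist_at x s)) - D (s, hist_at x s) (hist_at w s))"
    have "norm (z r - w r) < 1 / (real N + 1)" if r: "r \<in> {t0 - real N..b'}" for r
    proof -
      have "norm (z r - w r) \<le> 2 * (0 + c) * exp (2 * real n * (b' - t0))"
      proof (rule functional_gronwall[where T = "real n" and h = f])
        show "continuous_on {t0..b'} (\<lambda>r. z r - w r)"
          by (intro continuous_intros continuous_on_subset[OF cz] continuous_on_subset[OF cw]) auto
        show "((\<lambda>r. z r - w r) has_vector_derivative f s) (at s within {t0..b'})" if "s \<in> {t0..b'}" for s
          unfolding z_def f_def using u(1) x' w that
          by (intro has_vector_derivative_diff bounded_linear.has_vector_derivative[OF bounded_linear_scaleR_right])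
            (auto simp: sol_def lin_sol_def)
        show "norm (z r - w r) \<le> 0" if "r \<in> {t0 - real n..t0}" for r
        proof -
          have "hist_apply (hist_at u t0) (r - t0) = hist_apply (hist_at x t0 + h *\<^sub>R hist_at w t0) (r - t0)"
            using u(2) by simp
          then have "u r = x r + h *\<^sub>R w r"
            using that by (simp add: hist_apply_simps hist_apply_hist_at_UNIV cu cx cw)
          then show ?thesis using h0 by (simp add: z_def)
        qed
        show "norm (f s) \<le> c + real n * M'"
          if s: "s \<in> {t0..b'}" and M': "\<And>r. r \<in> {s - real n..s} \<Longrightarrow> norm (z r - w r) \<le> M'" for s M'
        proof -
          \<comment> \<open>On the window, the segment of \<open>u\<close> minus
            \<open>\<xi>\<close> is \<open>h\<close> times the difference of \<open>z\<close> and
            \<open>w\<close>; division by \<open>h\<close> therefore returns the bound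
            \<open>M'\<close> itself.\<close>
          define \<xi> where "\<xi> = hist_at x s + h *\<^sub>R hist_at w s"
          have "norm (g (s, hist_at u s) - g (s, \<xi>)) \<le> real n * (\<bar>h\<bar> * M')"
          proof (rule tube_lipschitz[OF n(3) s])
            show "\<xi> \<in> hist_nbhd n (hist_at x s)" unfolding \<xi>_def using line'(1)[OF s h] .
            show "hist_at u s \<in> hist_nbhd n (hist_at x s)"
              unfolding hist_at_mem_nbhd_iff[OF cx cu] using u(3) s by auto
            fix v assume v: "v \<in> {- real n..0}"
            have "u (s + v) - (x (s + v) + h *\<^sub>R w (s + v)) = h *\<^sub>R (z (s + v) - w (s + v))"
              using h0 by (simp add: z_def algebra_simps)
            then show "norm (hist_apply (hist_at u s) v - hist_apply \<xi> v) \<le> \<bar>h\<bar> * M'"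
              using M'[of "s + v"] v
              by (simp add: \<xi>_def hist_apply_simps hist_apply_hist_at_UNIV cu cx cw mult_left_mono)
          qed
          then have 1: "norm ((1 / h) *\<^sub>R (g (s, hist_at u s) - g (s, \<xi>))) \<le> real n * M'"
            using h0 mult_left_mono[of "norm (g (s, hist_at u s) - g (s, \<xi>))" "real n * (\<bar>h\<bar> * M')" "1 / \<bar>h\<bar>"]
            by simp
          define F where "F = (\<lambda>\<theta>. g (s, hist_at x s + \<theta> *\<^sub>R hist_at w s))"
          define F' where "F' = (\<lambda>\<theta>. D (s, hist_at x s + \<theta> *\<^sub>R hist_at w s) (hist_at w s))"
          have seg: "\<bar>\<theta>\<bar> < d" if "\<theta> \<in> closed_segment 0 h" for \<theta>
            using that h by (auto simp: closed_segment_eq_real_ivl split: if_splits)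
          \<comment> \<open>The derivative along the line varies by at most \<open>c\<close>, so the
            linearization at 0 errs by at most \<open>\<bar>h\<bar> * c\<close>.\<close>
          have "norm (F h - F 0 - (h - 0) *\<^sub>R F' 0) \<le> norm (h - 0) * c"
          proof (rule vector_differentiable_bound_linearization[where S = "closed_segment 0 h"])
            fix \<theta> assume \<theta>: "\<theta> \<in> closed_segment 0 h"
            have \<theta>V: "(s, hist_at x s + \<theta> *\<^sub>R hist_at w s) \<in> V"
              using tubeD(1)[OF n(3) s line'(1)[OF s seg[OF \<theta>]]] .
            show "(F has_vector_derivative F' \<theta>) (at \<theta> within closed_segment 0 h)"
              unfolding F_def F'_def
              by (rule has_vector_derivative_at_within[OF has_vector_derivative_line[OF \<theta>V]])
            show "norm (F' \<theta> - F' 0) \<le> c"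
              using n1[OF s line'(2)[OF s seg[OF \<theta>]] \<theta>V] by (simp add: F'_def)
          qed auto
          then have "norm (g (s, \<xi>) - g (s, hist_at x s) - h *\<^sub>R D (s, hist_at x s) (hist_at w s)) \<le> \<bar>h\<bar> * c"
            by (simp add: F_def F'_def \<xi>_def)
          then have "norm ((1 / h) *\<^sub>R (g (s, \<xi>) - g (s, hist_at x s) - h *\<^sub>R D (s, hist_at x s) (hist_at w s))) \<le> c"
            using h0 mult_left_mono[of _ "\<bar>h\<bar> * c" "1 / \<bar>h\<bar>"] by simp
          moreover have "f s = (1 / h) *\<^sub>R (g (s, hist_at u s) - g (s, \<xi>)) +
              (1 / h) *\<^sub>R (g (s, \<xi>) - g (s, hist_at x s) - h *\<^sub>R D (s, hist_at x s) (hist_at w s))"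
            using h0 by (simp add: f_def algebra_simps)
          ultimately show ?thesis using 1
            by (simp add: norm_triangle_le add.commute add_mono)
        qed
      qed (use b' n c r in auto)
      also have "\<dots> < 1 / (real N + 1)" using cE by (simp add: E_def)
      finally show ?thesis .
    qed
    then show "\<exists>u. sol t0 b' u \<and> hist_at u t0 = hist_at x t0 + h *\<^sub>R hist_at w t0 \<and>
      (\<forall>r\<in>{t0 - real N..b'}. norm ((1 / h) *\<^sub>R (u r - x r) - w r) < 1 / (real N + 1))"
      using u(1,2) by (auto simp: z_def)
  qed
qed

end

section \<open>Maximal solutions and the process\<close>

lemma time_hist_apply: "u \<le> 0 \<Longrightarrow> hist_apply (time_hist t) u = t + u"
  unfolding time_hist_def by (intro hist_apply_hist_of continuous_intros) auto

lemma segment_eq: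
  assumes "\<And>r. r \<le> t \<Longrightarrow> y r = (t0 + r, x (t0 + r))"
  shows "segment y t = (time_hist (t0 + t), hist_at x (t0 + t))"
proof -
  have "hist_of (\<lambda>s. fst (y (t + s))) = time_hist (t0 + t)"
    using hist_at_cong[of t "\<lambda>r. fst (y r)" "\<lambda>r. t0 + r"] assms
    unfolding hist_at_def time_hist_def by (simp flip: add.assoc)
  moreover have "hist_of (\<lambda>s. snd (y (t + s))) = hist_at x (t0 + t)"
    using hist_at_cong[of t "\<lambda>r. snd (y r)" "\<lambda>r. x (t0 + r)"] assms
    unfolding hist_at_def by (simp add: add.assoc)
  ultimately show ?thesis by (simp add: segment_def)
qed

lemma U_g_time_hist: "(time_hist t0, \<phi>) \<in> U_g V \<longleftrightarrow> (t0, \<phi>) \<in> V"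
  by (simp add: U_g_def time_hist_apply)

lemma solution_domain:
  assumes "0 < c"
  shows "{s + t |s t. s \<le> 0 \<and> t \<in> {t. 0 \<le> t \<and> ereal t < c}} = {r. ereal r < c}"
proof (intro equalityI subsetI)
  fix r assume "r \<in> {s + t |s t. s \<le> 0 \<and> t \<in> {t. 0 \<le> t \<and> ereal t < c}}"
  then obtain s t where "r = s + t" "s \<le> 0" "ereal t < c" by auto
  then show "r \<in> {r. ereal r < c}" by (auto intro: le_less_trans[of _ "ereal t"])
next
  fix r assume r: "r \<in> {r. ereal r < c}"
  show "r \<in> {s + t |s t. s \<le> 0 \<and> t \<in> {t. 0 \<le> t \<and> ereal t < c}}"
  proof (cases "r \<le> 0")
    case True
    then show ?thesis using assms by (intro CollectI exI[of _ r] exI[of _ 0]) (auto simp: zero_ereal_def)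
  next
    case False
    then show ?thesis using r by (intro CollectI exI[of _ 0] exI[of _ r]) auto
  qed
qed

locale vector_fde = smooth_fde V g D
  for V :: "(real \<times> (real ^ 'n::finite) hist) set" and g D
begin

text \<open>Each local solution lasts strictly beyond \<open>t\<close>, so \<open>{..<b}\<close> is
  an open neighbourhood of \<open>t\<close> on which \<open>x\<close> may be replaced by
  \<open>z\<close>; the derivative within the possibly half-open interval follows from the one
  within \<open>{0..b}\<close>.\<close>

lemma is_solution_if_locally_sol:
  assumes c: "0 < c"
    and loc: "\<And>t. 0 \<le> t \<Longrightarrow> ereal t < c \<Longrightarrow> \<exists>b>t. \<exists>z. sol t0 (t0 + b) z \<and> (\<forall>r\<le>t0 + b. x r = z r)"
  shows "is_solution V g {t. 0 \<le> t \<and> ereal t < c} (\<lambda>t. (t0 + t, x (t0 + t)))"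
    (is "is_solution V g ?I ?y")
  unfolding is_solution_def solution_domain[OF c]
proof (intro conjI ballI)
  have "isCont ?y r" if r: "ereal r < c" for r
  proof -
    have "ereal (max 0 r) < c" using c r by (auto simp: max_def zero_ereal_def)
    then obtain b z where b: "max 0 r < b" and z: "sol t0 (t0 + b) z" "\<forall>r\<le>t0 + b. x r = z r"
      using loc[of "max 0 r"] by auto
    have cz: "continuous_on UNIV z" using z(1) by (simp add: sol_def)
    have "isCont (\<lambda>t. (t0 + t, z (t0 + t))) r"
      using continuous_on_compose2[OF cz, of UNIV "\<lambda>t. t0 + t"]
      by (intro continuous_intros) (auto simp: continuous_on_eq_continuous_at intro!: continuous_intros)
    moreover have "\<forall>\<^sub>F t in nhds r. ?y t = (t0 + t, z (t0 + t))"
      using z(2) b by (auto simp: eventually_nhds intro!: exI[of _ "{..<b}"])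
    ultimately show ?thesis by (subst isCont_cong)
  qed
  then show "continuous_on {r. ereal r < c} ?y"
    by (intro continuous_at_imp_continuous_on) auto
next
  fix t assume t: "t \<in> ?I"
  then obtain b z where b: "t < b" and z: "sol t0 (t0 + b) z" "\<forall>r\<le>t0 + b. x r = z r"
    using loc[of t] by auto
  have seg: "segment ?y t = (time_hist (t0 + t), hist_at z (t0 + t))"
    using hist_at_cong[of "t0 + t" x z] z(2) b segment_eq[of t ?y t0 x] by auto
  have t': "t0 + t \<in> {t0..t0 + b}" using t b by auto
  then show "segment ?y t \<in> U_g V"
    unfolding seg U_g_time_hist using z(1) by (auto simp: sol_def)
  have "(\<lambda>t. t0 + t) ` {0..b} = {t0..t0 + b}" by (simp add: add.commute)
  then have "(z has_vector_derivative g (t0 + t, hist_at z (t0 + t))) (at (t0 + t) within (\<lambda>t. t0 + t) ` {0..b})"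
    using z(1) t' unfolding sol_def by metis
  moreover have "((\<lambda>t. t0 + t) has_vector_derivative 1) (at t within {0..b})"
    by (auto intro!: derivative_eq_intros)
  ultimately have "((\<lambda>t. z (t0 + t)) has_vector_derivative g (t0 + t, hist_at z (t0 + t))) (at t within {0..b})"
    using vector_diff_chain_within[of "\<lambda>t. t0 + t" 1 t "{0..b}" z] by (simp add: o_def)
  then have "((\<lambda>t. (t0 + t, z (t0 + t))) has_vector_derivative (1, g (t0 + t, hist_at z (t0 + t)))) (at t within {0..b})"
    by (intro has_vector_derivative_Pair) (auto intro!: derivative_eq_intros)
  then have "(?y has_vector_derivative (1, g (t0 + t, hist_at z (t0 + t)))) (at t within {0..b})"
    by (rule has_vector_derivative_transform[rotated 2]) (use t b z(2) in auto)
  then have "(?y has_vector_derivative (1, g (t0 + t, hist_at z (t0 + t)))) (at t within ?I \<inter> {..<b})"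
    by (rule has_vector_derivative_within_subset) auto
  moreover have "at t within ?I \<inter> {..<b} = at t within ?I"
    by (rule at_within_nhd[of t "{..<b}"]) (use b in auto)
  ultimately show "(?y has_vector_derivative f_g g (segment ?y t)) (at t within ?I)"
    unfolding seg f_g_def by (simp add: time_hist_apply)
qed

text \<open>The first component starts as \<open>t0 + s\<close> and has derivative 1, hence is
  \<open>t0 + t\<close>. The second component then satisfies the nonautonomous equation.\<close>

lemma sol_if_is_solution:
  assumes y: "is_solution V g {t. 0 \<le> t \<and> ereal t < c} y" and init: "segment y 0 = (time_hist t0, \<phi>)"
    and b: "0 \<le> b" "ereal b < c"
  obtains x where "sol t0 (t0 + b) x" "hist_at x t0 = \<phi>" "\<And>t. t \<le> b \<Longrightarrow> y t = (t0 + t, x (t0 + t))"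
proof -
  let ?I = "{t. 0 \<le> t \<and> ereal t < c}"
  have c: "0 < c" using b by (metis ereal_less_eq(5) le_less_trans)
  have cy: "continuous_on {r. ereal r < c} y"
    using y unfolding is_solution_def solution_domain[OF c] by simp
  have below: "ereal r < c" if "r \<le> b" for r using that b(2) by (auto intro: le_less_trans[of _ "ereal b"])
  have cyb: "continuous_on {..b} y" using below by (intro continuous_on_subset[OF cy]) auto
  have derivy: "(y has_vector_derivative f_g g (segment y t)) (at t within {0..b})" if "t \<in> {0..b}" for t
    using y that below unfolding is_solution_def by (auto elim!: has_vector_derivative_within_subset)
  have shift: "continuous_on {..0} (\<lambda>s. y (t + s))" if "t \<le> b" for t
    using that by (intro continuous_on_compose2[OF cyb] continuous_intros) auto
  have fst0: "fst (y s) = t0 + s" if "s \<le> 0" for s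
  proof -
    have "hist_apply (hist_of (\<lambda>s. fst (y (0 + s)))) s = fst (y (0 + s))"
      using that b by (intro hist_apply_hist_of continuous_on_fst shift) auto
    then show ?thesis using init that by (simp add: segment_def time_hist_apply)
  qed
  have fstb: "fst (y t) = t0 + t" if "t \<in> {0..b}" for t
  proof -
    have "((\<lambda>t. fst (y t) - t) has_vector_derivative 0) (at s within {0..b})" if s: "s \<in> {0..b}" for s
    proof -
      have "((\<lambda>t. fst (y t)) has_vector_derivative fst (f_g g (segment y s))) (at s within {0..b})"
        by (rule bounded_linear.has_vector_derivative[OF bounded_linear_fst derivy[OF s]])
      then have "((\<lambda>t. fst (y t)) has_vector_derivative 1) (at s within {0..b})" by (simp add: f_g_def)
      then show ?thesis by (auto intro!: derivative_eq_intros)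
    qed
    then obtain k where k: "\<And>s. s \<in> {0..b} \<Longrightarrow> fst (y s) - s = k"
      using has_vector_derivative_zero_constant[of "{0..b}" "\<lambda>t. fst (y t) - t"] by auto
    show ?thesis using k[of 0] k[OF that] fst0[of 0] b by auto
  qed
  have fsty: "fst (y t) = t0 + t" if "t \<le> b" for t using fst0 fstb that by (cases "t \<le> 0") auto
  \<comment> \<open>Frozen after time \<open>t0 + b\<close> to obtain a continuous path on the whole
    line.\<close>
  define x where "x = (\<lambda>r. snd (y (min r (t0 + b) - t0)))"
  have cx: "continuous_on UNIV x"
    unfolding x_def by (intro continuous_on_snd continuous_on_compose2[OF cyb] continuous_intros) auto
  have yx: "y t = (t0 + t, x (t0 + t))" if "t \<le> b" for t
    using fsty[OF that] that by (simp add: x_def prod_eq_iff)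
  have seg: "segment y t = (time_hist (t0 + t), hist_at x (t0 + t))" if "t \<le> b" for t
    using that yx by (intro segment_eq) auto
  have "sol t0 (t0 + b) x"
    unfolding sol_def
  proof (intro conjI ballI cx)
    fix r assume r: "r \<in> {t0..t0 + b}"
    define t where "t = r - t0"
    have t: "t \<in> {0..b}" "r = t0 + t" using r by (auto simp: t_def)
    have "t \<in> ?I" using t below by auto
    then have "segment y t \<in> U_g V" using y unfolding is_solution_def by blast
    then show "(r, hist_at x r) \<in> V" using t by (simp add: seg U_g_time_hist)
    have "((\<lambda>t. snd (y t)) has_vector_derivative snd (f_g g (segment y t))) (at t within {0..b})"
      by (rule bounded_linear.has_vector_derivative[OF bounded_linear_snd derivy[OF t(1)]])
    then have "((\<lambda>t. snd (y t)) has_vector_derivative g (r, hist_at x r)) (at (r - t0) within (\<lambda>r. r - t0) ` {t0..t0 + b})"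
      using t by (simp add: seg f_g_def time_hist_apply image_diff_atLeastAtMost t_def[symmetric])
    moreover have "((\<lambda>r. r - t0) has_vector_derivative 1) (at r within {t0..t0 + b})"
      by (auto intro!: derivative_eq_intros)
    ultimately have "((\<lambda>r. snd (y (r - t0))) has_vector_derivative g (r, hist_at x r)) (at r within {t0..t0 + b})"
      using vector_diff_chain_within[of "\<lambda>r. r - t0" 1 r "{t0..t0 + b}" "\<lambda>t. snd (y t)"] by (simp add: o_def)
    then show "(x has_vector_derivative g (r, hist_at x r)) (at r within {t0..t0 + b})"
      by (rule has_vector_derivative_transform[OF r, rotated]) (simp add: x_def)
  qed
  moreover have "hist_at x t0 = \<phi>" using seg[of 0] b init by simp
  ultimately show thesis using that yx by blast
qed

section \<open>Maximal solutions\<close>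

definition sol_times :: "real \<Rightarrow> (real ^ 'n) hist \<Rightarrow> real set" where
  "sol_times t0 \<phi> = {b. 0 < b \<and> (\<exists>x. sol t0 (t0 + b) x \<and> hist_at x t0 = \<phi>)}"

lemma solution_length_le:
  assumes sol: "is_solution V g {t. 0 \<le> t \<and> ereal t < c} y" "segment y 0 = (time_hist t0, \<phi>)"
    and nonneg: "0 \<le> Sup (ereal ` sol_times t0 \<phi>)" (is "0 \<le> ?C")
  shows "c \<le> ?C"
proof (rule ccontr)
  assume "\<not> c \<le> ?C"
  then have "?C < c" by simp
  then obtain d where d: "?C < ereal d" "ereal d < c" using ereal_dense2 by blast
  have "0 < ereal d" using nonneg d(1) by (rule le_less_trans)
  then have "0 < d" by simp
  then obtain x where "sol t0 (t0 + d) x" "hist_at x t0 = \<phi>"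
    using sol_if_is_solution[OF sol, of d] d(2) by auto
  then have "d \<in> sol_times t0 \<phi>" using \<open>0 < d\<close> by (auto simp: sol_times_def)
  then have "ereal d \<le> ?C" by (intro SUP_upper)
  with d(1) show False by simp
qed

text \<open>By uniqueness the solutions on all intervals paste to one solution \<open>Y\<close> of
  length \<open>C\<close>. No solution is longer, and every maximal solution is a restriction of
  \<open>Y\<close>, hence has the same length.\<close>

lemma maximal_solution:
  assumes V: "(t0, \<phi>) \<in> V"
  defines "C \<equiv> Sup (ereal ` sol_times t0 \<phi>)"
  shows "\<exists>y. is_maximal_solution V g (time_hist t0, \<phi>) C y"
    and "is_maximal_solution V g (time_hist t0, \<phi>) c y \<Longrightarrow> c = C"
proof -
  define is_sol where "is_sol = (\<lambda>b x. 0 < b \<and> sol t0 (t0 + b) x \<and> hist_at x t0 = \<phi>)"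
  have is_sol_times: "is_sol b x \<Longrightarrow> b \<in> sol_times t0 \<phi>" for b x
    by (auto simp: is_sol_def sol_times_def)
  \<comment> \<open>The value does not depend on the solution chosen: two of them agree up to the
    smaller of their end points.\<close>
  define X where "X = (\<lambda>r. THE v. \<exists>b x. is_sol b x \<and> r \<le> t0 + b \<and> v = x r)"
  have X: "X r = x r" if "is_sol b x" "r \<le> t0 + b" for b x r
    unfolding X_def
  proof (rule the_equality)
    show "\<exists>b z. is_sol b z \<and> r \<le> t0 + b \<and> x r = z r" using that by blast
    fix v assume "\<exists>b z. is_sol b z \<and> r \<le> t0 + b \<and> v = z r"
    then obtain b' z where z: "is_sol b' z" "r \<le> t0 + b'" "v = z r" by blast
    have "sol t0 (t0 + min b b') x" "sol t0 (t0 + min b b') z"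
      using that z by (auto simp: is_sol_def intro: sol_subinterval)
    then show "v = x r"
      using sol_unique[of t0 "t0 + min b b'" x z r] that z by (auto simp: is_sol_def)
  qed
  obtain b x where bx: "t0 < b" "sol t0 b x" "hist_at x t0 = \<phi>" using local_solution_exists[OF V] .
  then have b0: "is_sol (b - t0) x" by (simp add: is_sol_def)
  then have "ereal (b - t0) \<le> C" unfolding C_def by (intro SUP_upper is_sol_times)
  then have C: "0 < C" using bx(1) by (intro less_le_trans[of 0 "ereal (b - t0)" C]) auto
  have len: "c \<le> C"
    if "is_solution V g {t. 0 \<le> t \<and> ereal t < c} y" "segment y 0 = (time_hist t0, \<phi>)" for c y
    using solution_length_le[OF that less_imp_le[OF C[unfolded C_def]]] unfolding C_def .
  have ext: "\<exists>b>t. \<exists>x. is_sol b x" if "ereal t < C" for t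
    using that unfolding C_def less_Sup_iff by (auto simp: sol_times_def is_sol_def)
  define Y where "Y = (\<lambda>t. (t0 + t, X (t0 + t)))"
  have Y: "is_solution V g {t. 0 \<le> t \<and> ereal t < C} Y"
    unfolding Y_def
  proof (rule is_solution_if_locally_sol[OF C])
    fix t assume "0 \<le> t" "ereal t < C"
    then obtain b x where "t < b" "is_sol b x" using ext by blast
    then show "\<exists>b>t. \<exists>z. sol t0 (t0 + b) z \<and> (\<forall>r\<le>t0 + b. X r = z r)"
      using X by (auto simp: is_sol_def intro!: exI[of _ b] exI[of _ x])
  qed
  have Y0: "segment Y 0 = (time_hist t0, \<phi>)"
    using segment_eq[of 0 Y t0 X] hist_at_cong[of t0 X x] X[OF b0] bx by (simp add: Y_def)
  show "\<exists>y. is_maximal_solution V g (time_hist t0, \<phi>) C y"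
    unfolding is_maximal_solution_def
  proof (intro exI[of _ Y] conjI allI impI C Y Y0)
    fix c' z assume z: "C \<le> c' \<and> is_solution V g {t. 0 \<le> t \<and> ereal t < c'} z \<and> (\<forall>t. ereal t < C \<longrightarrow> z t = Y t)"
    have "z r = Y r" if "r \<le> 0" for r using z that le_less_trans[OF _ C, of "ereal r"] by simp
    then have "segment z 0 = (time_hist t0, \<phi>)"
      using segment_eq[of 0 z t0 X] segment_eq[of 0 Y t0 X] Y0 by (simp add: Y_def)
    then have "c' \<le> C" using z by (intro len) auto
    with z show "c' = C" by simp
  qed
  assume y: "is_maximal_solution V g (time_hist t0, \<phi>) c y"
  then have ys: "is_solution V g {t. 0 \<le> t \<and> ereal t < c} y" "segment y 0 = (time_hist t0, \<phi>)" "0 < c"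
    by (auto simp: is_maximal_solution_def)
  have cC: "c \<le> C" using ys by (intro len) auto
  \<comment> \<open>This makes \<open>Y\<close> an extension of \<open>y\<close>, so maximality of
    \<open>y\<close> gives \<open>c = C\<close>.\<close>
  moreover have "Y t = y t" if t: "ereal t < c" for t
  proof -
    have "ereal (max t 0) < c" using t ys(3) by (auto simp: max_def zero_ereal_def)
    then obtain b where b: "ereal (max t 0) < ereal b" "ereal b < c" using ereal_dense2 by blast
    then have "0 \<le> b" by simp
    then obtain x where x: "sol t0 (t0 + b) x" "hist_at x t0 = \<phi>" "\<And>t. t \<le> b \<Longrightarrow> y t = (t0 + t, x (t0 + t))"
      using sol_if_is_solution[OF ys(1,2) _ b(2)] by blast
    have "is_sol b x" using x b by (auto simp: is_sol_def)
    then show ?thesis using X[of b x "t0 + t"] x(3)[of t] b by (simp add: Y_def)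
  qed
  ultimately show "c = C" using y Y unfolding is_maximal_solution_def by metis
qed

lemma t_max_eq:
  assumes "(t0, \<phi>) \<in> V"
  shows "t_max V g (time_hist t0, \<phi>) = Sup (ereal ` sol_times t0 \<phi>)"
  unfolding t_max_def using maximal_solution[OF assms] by (intro the_equality) blast+

text \<open>Removes the autonomous equation from the domain. The inequality \<open>t < b\<close> is
  strict because \<open>t - t0\<close> must be below a supremum of lengths.\<close>

lemma process_dom_iff:
  "(t, t0, \<phi>) \<in> process_dom V g \<longleftrightarrow> t0 \<le> t \<and> (\<exists>b>t. \<exists>x. sol t0 b x \<and> hist_at x t0 = \<phi>)"
proof (cases "t0 \<le> t \<and> (t0, \<phi>) \<in> V")
  case True
  then have "(t, t0, \<phi>) \<in> process_dom V g \<longleftrightarrow> (\<exists>b\<in>sol_times t0 \<phi>. t - t0 < b)"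
    by (simp add: process_dom_def Omega_g_def U_g_time_hist t_max_eq less_SUP_iff)
  also have "\<dots> \<longleftrightarrow> (\<exists>b>t. \<exists>x. sol t0 b x \<and> hist_at x t0 = \<phi>)"
  proof
    assume "\<exists>b\<in>sol_times t0 \<phi>. t - t0 < b"
    then obtain b where "b \<in> sol_times t0 \<phi>" "t - t0 < b" by blast
    then show "\<exists>b>t. \<exists>x. sol t0 b x \<and> hist_at x t0 = \<phi>"
      by (intro exI[of _ "t0 + b"]) (auto simp: sol_times_def)
  next
    assume "\<exists>b>t. \<exists>x. sol t0 b x \<and> hist_at x t0 = \<phi>"
    then obtain b where "b > t" "\<exists>x. sol t0 b x \<and> hist_at x t0 = \<phi>" by blast
    then show "\<exists>b\<in>sol_times t0 \<phi>. t - t0 < b"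
      using True by (intro bexI[of _ "b - t0"]) (auto simp: sol_times_def)
  qed
  finally show ?thesis using True by simp
next
  case False
  have "(t0, \<phi>) \<in> V" if "t0 \<le> t" "b > t" "sol t0 b x" "hist_at x t0 = \<phi>" for b x
    using that by (force simp: sol_def)
  then show ?thesis
    using False by (auto simp: process_dom_def Omega_g_def U_g_time_hist)
qed

text \<open>\<open>y_max\<close> is some maximal solution, fixed only by choice; uniqueness allows
  the process to be computed from any solution that reaches beyond \<open>t\<close>.\<close>

lemma process_eq:
  assumes x: "sol t0 b x" and t: "t0 \<le> t" "t < b"
  shows "process V g t t0 (hist_at x t0) = hist_at x t"
proof -
  define \<phi> where "\<phi> = hist_at x t0"
  have V: "(t0, \<phi>) \<in> V" using x t by (auto simp: \<phi>_def sol_def)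
  define y where "y = y_max V g (time_hist t0, \<phi>)"
  have "is_maximal_solution V g (time_hist t0, \<phi>) (t_max V g (time_hist t0, \<phi>)) y"
    unfolding y_def y_max_def t_max_eq[OF V] by (rule someI_ex[OF maximal_solution(1)[OF V]])
  then have y: "is_solution V g {s. 0 \<le> s \<and> ereal s < t_max V g (time_hist t0, \<phi>)} y"
    "segment y 0 = (time_hist t0, \<phi>)"
    by (auto simp: is_maximal_solution_def)
  have "(t, t0, \<phi>) \<in> process_dom V g" using x t by (auto simp: process_dom_iff \<phi>_def)
  then have "ereal (t - t0) < t_max V g (time_hist t0, \<phi>)" by (simp add: process_dom_def Omega_g_def)
  then obtain z where z: "sol t0 (t0 + (t - t0)) z" "hist_at z t0 = \<phi>"
    "\<And>s. s \<le> t - t0 \<Longrightarrow> y s = (t0 + s, z (t0 + s))"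
    using sol_if_is_solution[OF y, of "t - t0"] t by auto
  have "process V g t t0 \<phi> = hist_at z t"
    using segment_eq[of "t - t0" y t0 z] z(3) by (simp add: process_def Sigma_g_def y_def)
  also have "\<dots> = hist_at x t"
    using sol_unique[of t0 t z x] z(1,2) sol_subinterval[OF x, of t] t
    by (intro hist_at_cong) (auto simp: \<phi>_def)
  finally show ?thesis by (simp add: \<phi>_def)
qed

end

section \<open>Smoothness of the process\<close>

context vector_fde
begin

text \<open>One neighbourhood yields both openness of the domain and continuity, since
  \<open>sol_continuous_dependence\<close> provides existence and closeness together.\<close>

lemma process_near:
  assumes dom: "(t, t0, \<phi>) \<in> process_dom V g"
  obtains W where "open W" "(t, t0, \<phi>) \<in> W"
    "\<And>t' t0' \<phi>'. (t', t0', \<phi>') \<in> W \<Longrightarrow> t0' \<le> t' \<Longrightarrow> (t', t0', \<phi>') \<in> process_dom V g \<and>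
      process V g t' t0' \<phi>' \<in> hist_nbhd n (process V g t t0 \<phi>)"
proof -
  obtain b x where t: "t0 \<le> t" "t < b" and x: "sol t0 b x" and \<phi>: "hist_at x t0 = \<phi>"
    using dom process_dom_iff by blast
  have cx: "continuous_on UNIV x" using x by (simp add: sol_def)
  \<comment> \<open>Half of the radius is spent on \<open>hist_at y t'\<close> against
    \<open>hist_at x t'\<close>, half on \<open>hist_at x t'\<close> against
    \<open>hist_at x t\<close>.\<close>
  define N where "N = 2 * n + 1"
  define b' where "b' = (t + b) / 2"
  have b': "t < b'" "b' < b" "t0 < b'" using t by (auto simp: b'_def)
  obtain m where m: "\<And>t0' \<phi>. \<bar>t0' - t0\<bar> < 1 / (real m + 1) \<Longrightarrow> \<phi> \<in> hist_nbhd m (hist_at x t0) \<Longrightarrow>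
    \<exists>y. sol t0' b' y \<and> hist_at y t0' = \<phi> \<and> (\<forall>r\<in>{t0' - real N..b'}. norm (y r - x r) < 1 / (real N + 1))"
    using sol_continuous_dependence[OF x b'(3,2), where N = N] by blast
  obtain d where d: "d > 0" "\<And>s. \<bar>s - t\<bar> < d \<Longrightarrow> hist_at x s \<in> hist_nbhd N (hist_at x t)"
    using hist_at_near[OF cx] by blast
  define W where "W = ({..<b'} \<inter> ball t d) \<times> ball t0 (1 / (real m + 1)) \<times> hist_nbhd m \<phi>"
  show thesis
  proof
    show "open W" unfolding W_def by (intro open_Times open_Int open_hist_nbhd) auto
    show "(t, t0, \<phi>) \<in> W" using b' d by (simp add: W_def)
    fix t' t0' \<phi>' assume W: "(t', t0', \<phi>') \<in> W" and t': "t0' \<le> t'"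
    have "\<bar>t0' - t0\<bar> < 1 / (real m + 1)" "\<phi>' \<in> hist_nbhd m (hist_at x t0)"
      using W \<phi> by (auto simp: W_def dist_real_def abs_minus_commute)
    then obtain y where y: "sol t0' b' y" "hist_at y t0' = \<phi>'"
      "\<And>r. r \<in> {t0' - real N..b'} \<Longrightarrow> norm (y r - x r) < 1 / (real N + 1)"
      using m by blast
    have cy: "continuous_on UNIV y" using y by (simp add: sol_def)
    have tb: "t' < b'" and td: "\<bar>t' - t\<bar> < d" using W by (auto simp: W_def dist_real_def abs_minus_commute)
    have "hist_at y t' \<in> hist_nbhd N (hist_at x t')"
      unfolding hist_at_mem_nbhd_iff[OF cx cy] using y(3) t' tb by auto
    then have "hist_at y t' \<in> hist_nbhd n (hist_at x t)"
      using hist_nbhd_triangle d(2)[OF td] unfolding N_def by blast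
    moreover have "process V g t' t0' \<phi>' = hist_at y t'" using process_eq[OF y(1) t' tb] y(2) by simp
    moreover have "process V g t t0 \<phi> = hist_at x t" using process_eq[OF x t] \<phi> by simp
    ultimately show "(t', t0', \<phi>') \<in> process_dom V g \<and>
        process V g t' t0' \<phi>' \<in> hist_nbhd n (process V g t t0 \<phi>)"
      using process_dom_iff t' tb y by auto
  qed
qed

lemma openin_process_dom: "openin (top_of_set {(t, t0, \<phi>). t0 \<le> t}) (process_dom V g)"
proof (subst openin_subopen, intro ballI)
  fix p assume p: "p \<in> process_dom V g"
  obtain t t0 \<phi> where pe: "p = (t, t0, \<phi>)" by (cases p)
  obtain W where W: "open W" "p \<in> W" "\<And>t' t0' \<phi>'. (t', t0', \<phi>') \<in> W \<Longrightarrow> t0' \<le> t' \<Longrightarrow> (t', t0', \<phi>') \<in> process_dom V g"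
    using process_near[OF p[unfolded pe]] pe by metis
  have "p \<in> {(t, t0, \<phi>). t0 \<le> t}" using p by (auto simp: process_dom_def)
  then show "\<exists>T. openin (top_of_set {(t, t0, \<phi>). t0 \<le> t}) T \<and> p \<in> T \<and> T \<subseteq> process_dom V g"
    using W by (intro exI[of _ "{(t, t0, \<phi>). t0 \<le> t} \<inter> W"]) (auto intro: openin_open_Int)
qed

lemma continuous_on_process: "continuous_on (process_dom V g) (\<lambda>(t, t0, \<phi>). process V g t t0 \<phi>)"
  unfolding continuous_on_def tendsto_hist_iff
proof (intro ballI allI)
  fix p n assume p: "p \<in> process_dom V g"
  obtain t t0 \<phi> where pe: "p = (t, t0, \<phi>)" by (cases p)
  obtain W where W: "open W" "p \<in> W" "\<And>t' t0' \<phi>'. (t', t0', \<phi>') \<in> W \<Longrightarrow> t0' \<le> t' \<Longrightarrow>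
      process V g t' t0' \<phi>' \<in> hist_nbhd n (process V g t t0 \<phi>)"
    using process_near[OF p[unfolded pe]] pe by metis
  show "\<forall>\<^sub>F q in at p within process_dom V g. (case q of (t, t0, \<phi>) \<Rightarrow> process V g t t0 \<phi>)
      \<in> hist_nbhd n (case p of (t, t0, \<phi>) \<Rightarrow> process V g t t0 \<phi>)"
    unfolding eventually_at_topological using W
    by (intro exI[of _ W]) (auto simp: pe process_dom_def)
qed

lemma mem_process_dom_at:
  "\<phi> \<in> process_dom_at V g t t0 \<longleftrightarrow> t0 \<le> t \<and> (\<exists>b>t. \<exists>x. sol t0 b x \<and> hist_at x t0 = \<phi>)"
  by (simp add: process_dom_at_def process_dom_iff)

lemma open_process_dom_at:
  assumes "t0 \<le> t"
  shows "open (process_dom_at V g t t0)"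
proof (subst open_subopen, intro ballI)
  fix \<phi> assume "\<phi> \<in> process_dom_at V g t t0"
  then obtain W where W: "open W" "(t, t0, \<phi>) \<in> W"
    "\<And>t' t0' \<phi>'. (t', t0', \<phi>') \<in> W \<Longrightarrow> t0' \<le> t' \<Longrightarrow> (t', t0', \<phi>') \<in> process_dom V g"
    unfolding process_dom_at_def using process_near by (metis mem_Collect_eq)
  have "open ((\<lambda>\<phi>. (t, t0, \<phi>)) -` W)" by (intro open_vimage W continuous_intros)
  then show "\<exists>T. open T \<and> \<phi> \<in> T \<and> T \<subseteq> process_dom_at V g t t0"
    using W assms by (intro exI[of _ "(\<lambda>\<phi>. (t, t0, \<phi>)) -` W"]) (auto simp: process_dom_at_def)
qed

section \<open>Directional derivatives of the process\<close>

lemma process_has_dir_deriv: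
  assumes x: "sol t0 b x" and t: "t0 \<le> t" "t < b'" "b' < b" and w: "lin_sol t0 b' x w"
  shows "(dir_quotient (process V g t t0) (hist_at x t0) (hist_at w t0) \<longlongrightarrow> hist_at w t) (at 0)"
  unfolding tendsto_hist_iff
proof
  fix N
  have b': "t0 < b'" using t by simp
  have cx: "continuous_on UNIV x" and cw: "continuous_on UNIV w" using x w by (auto simp: sol_def lin_sol_def)
  obtain d where d: "d > 0" "\<And>h. h \<noteq> 0 \<Longrightarrow> \<bar>h\<bar> < d \<Longrightarrow>
    \<exists>u. sol t0 b' u \<and> hist_at u t0 = hist_at x t0 + h *\<^sub>R hist_at w t0 \<and>
      (\<forall>r\<in>{t0 - real N..b'}. norm ((1 / h) *\<^sub>R (u r - x r) - w r) < 1 / (real N + 1))"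
    using sol_difference_quotient[OF x b' t(3) w, where N = N] by blast
  have "dir_quotient (process V g t t0) (hist_at x t0) (hist_at w t0) h \<in> hist_nbhd N (hist_at w t)"
    if h: "h \<noteq> 0" "\<bar>h\<bar> < d" for h
  proof -
    obtain u where u: "sol t0 b' u" "hist_at u t0 = hist_at x t0 + h *\<^sub>R hist_at w t0"
      "\<And>r. r \<in> {t0 - real N..b'} \<Longrightarrow> norm ((1 / h) *\<^sub>R (u r - x r) - w r) < 1 / (real N + 1)"
      using d(2)[OF h] by blast
    have cu: "continuous_on UNIV u" using u by (simp add: sol_def)
    have "dir_quotient (process V g t t0) (hist_at x t0) (hist_at w t0) h = (1 / h) *\<^sub>R (hist_at u t - hist_at x t)"
      using process_eq[OF u(1) t(1,2)] process_eq[OF x t(1)] u(2) t by (simp add: dir_quotient_def)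
    then show ?thesis
      unfolding hist_nbhd_def using u(3) t
      by (auto simp: hist_apply_simps hist_apply_hist_at_UNIV cu cx cw)
  qed
  then show "\<forall>\<^sub>F h in at 0. dir_quotient (process V g t t0) (hist_at x t0) (hist_at w t0) h \<in> hist_nbhd N (hist_at w t)"
    unfolding eventually_at using d(1) by (intro exI[of _ d]) (auto simp: dist_real_def)
qed

lemma process_dir_deriv_eq:
  assumes "sol t0 b x" "t0 \<le> t" "t < b'" "b' < b" "lin_sol t0 b' x w"
  shows "dir_deriv (process V g t t0) (hist_at x t0) (hist_at w t0) = hist_at w t"
  unfolding dir_deriv_def by (rule tendsto_Lim[OF _ process_has_dir_deriv[OF assms]]) simp

text \<open>Nearby solutions are obtained only on intervals shorter than that of \<open>x\<close>;
  \<open>b'\<close> leaves room on both sides.\<close>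

lemma process_dom_at_cases:
  assumes "\<phi> \<in> process_dom_at V g t t0"
  obtains b b' x where "t0 \<le> t" "t < b'" "b' < b" "sol t0 b x" "hist_at x t0 = \<phi>"
proof -
  obtain b x where "t0 \<le> t" "t < b" "sol t0 b x" "hist_at x t0 = \<phi>"
    using assms by (auto simp: mem_process_dom_at)
  then show thesis using dense[of t b] that by blast
qed

lemma has_dir_deriv_process:
  assumes "\<phi> \<in> process_dom_at V g t t0"
  shows "has_dir_deriv (process V g t t0) \<phi> v"
proof -
  obtain b b' x where x: "t0 \<le> t" "t < b'" "b' < b" "sol t0 b x" "hist_at x t0 = \<phi>"
    using process_dom_at_cases[OF assms] .
  obtain w where "lin_sol t0 b' x w" "hist_at w t0 = v"
    using lin_sol_exists[of t0 b' x v] sol_subinterval[OF x(4), of b'] x by auto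
  then show ?thesis
    unfolding has_dir_deriv_def using process_has_dir_deriv[OF x(4,1,2,3)] x(5) by blast
qed

text \<open>Here \<open>m\<close> depends on \<open>W\<close> but not on \<open>z\<close>. This
  uniformity serves both cases: the segments of a single variational solution for
  \<open>C1_MB\<close>, those of all solutions starting in a bounded set for
  \<open>C1_F\<close>.\<close>

lemma process_dir_deriv_near:
  assumes x: "sol t0 b x" and t: "t0 \<le> t" "t < b'" "b' < b" and W: "D_equicont V D W"
  obtains m where "\<And>\<phi> z v. \<phi> \<in> hist_nbhd m (hist_at x t0) \<Longrightarrow> lin_sol t0 b' x z \<Longrightarrow>
    (\<And>s. s \<in> {t0..b'} \<Longrightarrow> hist_at z s \<in> W) \<Longrightarrow> v \<in> hist_nbhd m (hist_at z t0) \<Longrightarrow>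
    dir_deriv (process V g t t0) \<phi> v \<in> hist_nbhd n (hist_at z t)"
proof -
  \<comment> \<open>The nearby solution \<open>y\<close> has to live beyond \<open>b'\<close>,
    because its directional derivative is read off from a variational solution on
    \<open>{t0..b'}\<close>.\<close>
  obtain b'' where b'': "b' < b''" "b'' < b" using dense[OF t(3)] by blast
  have t0b': "t0 \<le> b'" using t by simp
  have x': "sol t0 b' x" using sol_subinterval[OF x] t by simp
  have cx: "continuous_on UNIV x" using x by (simp add: sol_def)
  obtain m1 where m1: "\<And>y w z t. continuous_on UNIV y \<Longrightarrow>
    (\<And>r. r \<in> {t0 - real m1..b'} \<Longrightarrow> norm (y r - x r) < 1 / (real m1 + 1)) \<Longrightarrow>
    lin_sol t0 b' y w \<Longrightarrow> lin_sol t0 b' x z \<Longrightarrow> (\<And>s. s \<in> {t0..b'} \<Longrightarrow> hist_at z s \<in> W) \<Longrightarrow>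
    hist_at w t0 \<in> hist_nbhd m1 (hist_at z t0) \<Longrightarrow>
    t \<in> {t0 - real n..b'} \<Longrightarrow> norm (w t - z t) < 1 / (real n + 1)"
    using lin_sol_continuous_dependence[OF x' t0b' W, where N = n] by blast
  have "t0 < b''" using t b'' by simp
  then obtain m2 where m2: "\<And>t0' \<phi>. \<bar>t0' - t0\<bar> < 1 / (real m2 + 1) \<Longrightarrow> \<phi> \<in> hist_nbhd m2 (hist_at x t0) \<Longrightarrow>
    \<exists>y. sol t0' b'' y \<and> hist_at y t0' = \<phi> \<and> (\<forall>r\<in>{t0' - real m1..b''}. norm (y r - x r) < 1 / (real m1 + 1))"
    using sol_continuous_dependence[OF x _ b''(2), where N = m1] by blast
  show thesis
  proof (rule that)
    fix \<phi> z v assume \<phi>: "\<phi> \<in> hist_nbhd (max m1 m2) (hist_at x t0)" and z: "lin_sol t0 b' x z"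
      and zW: "\<And>s. s \<in> {t0..b'} \<Longrightarrow> hist_at z s \<in> W" and v: "v \<in> hist_nbhd (max m1 m2) (hist_at z t0)"
    have "\<phi> \<in> hist_nbhd m2 (hist_at x t0)" using \<phi> hist_nbhd_mono[of m2 "max m1 m2"] by auto
    then obtain y where y: "sol t0 b'' y" "hist_at y t0 = \<phi>"
      "\<And>r. r \<in> {t0 - real m1..b''} \<Longrightarrow> norm (y r - x r) < 1 / (real m1 + 1)"
      using m2[of t0 \<phi>] by auto
    have "sol t0 b' y" using sol_subinterval[OF y(1)] b'' by simp
    then obtain w where w: "lin_sol t0 b' y w" "hist_at w t0 = v" using lin_sol_exists[OF _ t0b'] by blast
    have cy: "continuous_on UNIV y" and cw: "continuous_on UNIV w" and cz: "continuous_on UNIV z"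
      using y w z by (auto simp: sol_def lin_sol_def)
    have "norm (w r - z r) < 1 / (real n + 1)" if "r \<in> {t0 - real n..b'}" for r
    proof (rule m1[OF cy _ w(1) z zW _ that])
      show "norm (y r - x r) < 1 / (real m1 + 1)" if "r \<in> {t0 - real m1..b'}" for r
        using y(3) that b'' by auto
      show "hist_at w t0 \<in> hist_nbhd m1 (hist_at z t0)"
        using v w(2) hist_nbhd_mono[of m1 "max m1 m2"] by auto
    qed
    then have "hist_at w t \<in> hist_nbhd n (hist_at z t)"
      unfolding hist_at_mem_nbhd_iff[OF cz cw] using t by auto
    then show "dir_deriv (process V g t t0) \<phi> v \<in> hist_nbhd n (hist_at z t)"
      using process_dir_deriv_eq[OF y(1) t(1,2) b''(1) w(1)] y(2) w(2) by simp
  qed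
qed

lemma C1_MB_process:
  assumes "t0 \<le> t"
  shows "C1_MB (process_dom_at V g t t0) (\<lambda>\<phi>. process V g t t0 \<phi>)"
  unfolding C1_MB_def
proof (intro conjI ballI allI)
  have "continuous_on (process_dom_at V g t t0) ((\<lambda>(t, t0, \<phi>). process V g t t0 \<phi>) \<circ> (\<lambda>\<phi>. (t, t0, \<phi>)))"
    by (intro continuous_on_compose continuous_intros continuous_on_subset[OF continuous_on_process])
      (auto simp: process_dom_at_def)
  then show "continuous_on (process_dom_at V g t t0) (\<lambda>\<phi>. process V g t t0 \<phi>)" by (simp add: o_def)
  show "has_dir_deriv (process V g t t0) \<phi> v" if "\<phi> \<in> process_dom_at V g t t0" for \<phi> v
    using has_dir_deriv_process[OF that] .
  show "continuous_on (process_dom_at V g t t0 \<times> UNIV) (\<lambda>(\<phi>, v). dir_deriv (process V g t t0) \<phi> v)"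
    unfolding continuous_on_def tendsto_hist_iff
  proof (intro ballI allI)
    fix p n assume "p \<in> process_dom_at V g t t0 \<times> (UNIV :: (real ^ 'n) hist set)"
    then obtain \<phi> v where p: "p = (\<phi>, v)" "\<phi> \<in> process_dom_at V g t t0" by auto
    obtain b b' x where x: "t0 \<le> t" "t < b'" "b' < b" "sol t0 b x" "hist_at x t0 = \<phi>"
      using process_dom_at_cases[OF p(2)] .
    obtain z where z: "lin_sol t0 b' x z" "hist_at z t0 = v"
      using lin_sol_exists[of t0 b' x v] sol_subinterval[OF x(4), of b'] x by auto
    have cz: "continuous_on UNIV z" using z by (simp add: lin_sol_def)
    \<comment> \<open>Continuity at one direction \<open>v\<close> needs only the segments of the
      variational solution starting at \<open>v\<close>; nearby directions enter through their
      distance from \<open>v\<close>.\<close>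
    have W: "D_equicont V D (hist_at z ` {t0..b'})"
      by (intro D_equicont_compact compact_continuous_image continuous_on_hist_at cz compact_Icc)
    obtain m where m: "\<And>\<phi> z' v. \<phi> \<in> hist_nbhd m (hist_at x t0) \<Longrightarrow> lin_sol t0 b' x z' \<Longrightarrow>
        (\<And>s. s \<in> {t0..b'} \<Longrightarrow> hist_at z' s \<in> hist_at z ` {t0..b'}) \<Longrightarrow> v \<in> hist_nbhd m (hist_at z' t0) \<Longrightarrow>
        dir_deriv (process V g t t0) \<phi> v \<in> hist_nbhd n (hist_at z' t)"
      using process_dir_deriv_near[OF x(4,1,2,3) W] by blast
    have "dir_deriv (process V g t t0) \<phi> v = hist_at z t"
      using process_dir_deriv_eq[OF x(4,1,2,3) z(1)] x z by simp
    moreover have "dir_deriv (process V g t t0) \<phi>' v' \<in> hist_nbhd n (hist_at z t)"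
      if "(\<phi>', v') \<in> hist_nbhd m \<phi> \<times> hist_nbhd m v" for \<phi>' v'
      using that x z by (intro m) auto
    moreover have "open (hist_nbhd m \<phi> \<times> hist_nbhd m v)" by (intro open_Times open_hist_nbhd)
    ultimately show "\<forall>\<^sub>F q in at p within process_dom_at V g t t0 \<times> UNIV.
        (case q of (\<phi>, v) \<Rightarrow> dir_deriv (process V g t t0) \<phi> v)
        \<in> hist_nbhd n (case p of (\<phi>, v) \<Rightarrow> dir_deriv (process V g t t0) \<phi> v)"
      unfolding eventually_at_topological p(1)
      by (intro exI[of _ "hist_nbhd m \<phi> \<times> hist_nbhd m v"]) auto
  qed
qed

end

section \<open>Uniform convergence on bounded sets\<close>

lemma topspace_Lc_topology: "topspace Lc_topology = continuous_linear_maps"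
proof -
  have "Lc_open continuous_linear_maps"
    unfolding Lc_open_def using tvs_bounded_empty by blast
  then show ?thesis
    unfolding topspace_def openin_Lc_topology by (auto simp: Lc_open_def)
qed

text \<open>The uniform bound \<open>d < e\<close> leaves the margin that openness requires; strict
  inequalities at the single points of an infinite \<open>B\<close> would not.\<close>

lemma openin_Lc_uniformly_near:
  fixes A :: "'a::{real_vector,topological_space} \<Rightarrow> 'w::real_normed_vector"
  assumes "tvs_bounded B"
  shows "openin Lc_topology {A' \<in> continuous_linear_maps. \<exists>d<e. \<forall>v\<in>B. norm (A' v - A v) \<le> d}"
  unfolding openin_Lc_topology Lc_open_def
proof (intro conjI ballI)
  fix A' assume "A' \<in> {A' \<in> continuous_linear_maps. \<exists>d<e. \<forall>v\<in>B. norm (A' v - A v) \<le> d}"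
  then obtain d where d: "d < e" "\<And>v. v \<in> B \<Longrightarrow> norm (A' v - A v) \<le> d" by blast
  have "\<exists>d<e. \<forall>v\<in>B. norm (A'' v - A v) \<le> d" if "\<forall>v\<in>B. A'' v - A' v \<in> ball 0 ((e - d) / 2)" for A''
  proof (intro exI[of _ "d + (e - d) / 2"] conjI ballI)
    show "d + (e - d) / 2 < e" using d(1) by (simp add: field_simps)
    fix v assume v: "v \<in> B"
    then have "norm (A'' v - A' v) < (e - d) / 2" using that by simp
    then show "norm (A'' v - A v) \<le> d + (e - d) / 2"
      using d(2)[OF v] norm_triangle_ineq[of "A'' v - A' v" "A' v - A v"] by (simp add: field_simps)
  qed
  then show "\<exists>B' N. tvs_bounded B' \<and> open N \<and> 0 \<in> N \<and> {A'' \<in> continuous_linear_maps. \<forall>v\<in>B'. A'' v - A' v \<in> N}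
      \<subseteq> {A' \<in> continuous_linear_maps. \<exists>d<e. \<forall>v\<in>B. norm (A' v - A v) \<le> d}"
    using assms d(1) by (intro exI[of _ B] exI[of _ "ball 0 ((e - d) / 2)"]) auto
qed blast

text \<open>Boundedness in every seminorm; \<open>tvs_bounded_hist_imp\<close> and
  \<open>tvs_bounded_Times_hist\<close> translate from and to von Neumann boundedness.\<close>

definition hist_bounded :: "'b::real_normed_vector hist set \<Rightarrow> bool" where
  "hist_bounded B \<longleftrightarrow> (\<forall>n::nat. \<exists>M. \<forall>v\<in>B. \<forall>u\<in>{- real n..0}. norm (hist_apply v u) \<le> M)"

text \<open>The neighbourhood of \<open>p\<close> is the preimage under \<open>dir_deriv g\<close>
  of an open set of maps uniformly close to \<open>dir_deriv g p\<close> on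
  \<open>{0} \<times> B\<close>.\<close>

lemma C1_F_imp_D_equicont:
  fixes g :: "real \<times> 'b::real_normed_vector hist \<Rightarrow> 'w::real_normed_vector"
  assumes V: "open V" and g: "C1_F V g" and B: "hist_bounded B"
  shows "D_equicont V (\<lambda>p \<zeta>. dir_deriv g p (0, \<zeta>)) B"
  unfolding D_equicont_def
proof (intro ballI allI impI)
  fix p and e :: real assume p: "p \<in> V" and e: "e > 0"
  define U where "U = {A \<in> continuous_linear_maps. \<exists>d<e. \<forall>v\<in>{0::real} \<times> B. norm (A v - dir_deriv g p v) \<le> d}"
  have "tvs_bounded ({0::real} \<times> B)"
    using B tvs_bounded_Times_hist unfolding hist_bounded_def by blast
  then have "openin Lc_topology U" unfolding U_def by (rule openin_Lc_uniformly_near)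
  moreover have "continuous_map (top_of_set V) Lc_topology (dir_deriv g)" using g by (simp add: C1_F_def)
  ultimately have "openin (top_of_set V) {q \<in> V. dir_deriv g q \<in> U}"
    by (auto simp: continuous_map_def)
  then have "open {q \<in> V. dir_deriv g q \<in> U}" using V by (simp add: openin_open_eq)
  moreover have "dir_deriv g p \<in> U"
    unfolding U_def using g p e by (auto simp: C1_F_def intro!: exI[of _ 0])
  moreover have "norm (dir_deriv g q (0, \<zeta>) - dir_deriv g p (0, \<zeta>)) < e" if "dir_deriv g q \<in> U" "\<zeta> \<in> B" for q \<zeta>
    using that unfolding U_def by force
  ultimately show "\<exists>N. open N \<and> p \<in> N \<and>
      (\<forall>q\<in>N \<inter> V. \<forall>\<zeta>\<in>B. norm (dir_deriv g q (0, \<zeta>) - dir_deriv g p (0, \<zeta>)) < e)"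
    using p by (intro exI[of _ "{q \<in> V. dir_deriv g q \<in> U}"]) auto
qed

text \<open>
  Neighbourhoods in the space of histories are unbounded, so the uniform continuity on bounded sets is
  applied to a sequence of directions, which is bounded because it converges.
\<close>

lemma C1_F_imp_continuous_on_dir_deriv:
  fixes g :: "real \<times> 'b::real_normed_vector hist \<Rightarrow> 'w::real_normed_vector"
  assumes V: "open V" and g: "C1_F V g"
  shows "continuous_on (V \<times> UNIV) (\<lambda>(p, \<zeta>). dir_deriv g p (0, \<zeta>))"
  unfolding continuous_on_def
proof
  fix P assume "P \<in> V \<times> (UNIV :: 'b hist set)"
  then obtain s0 \<psi>0 \<zeta>0 where P: "P = ((s0, \<psi>0), \<zeta>0)" "(s0, \<psi>0) \<in> V" by auto
  define D where "D = (\<lambda>p \<zeta>. dir_deriv g p (0, \<zeta>))"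
  define p0 where "p0 = (s0, \<psi>0)"
  define A where "A = (\<lambda>k::nat. ball s0 (1 / (real k + 1)) \<times> hist_nbhd k \<psi>0)"
  have openA: "open (A k)" for k unfolding A_def by (intro open_Times open_ball open_hist_nbhd)
  have A_base: "\<exists>K. \<forall>k\<ge>K. A k \<subseteq> N" if N: "open N" "p0 \<in> N" for N
  proof -
    obtain N1 N2 where N12: "open N1" "open N2" "s0 \<in> N1" "\<psi>0 \<in> N2" "N1 \<times> N2 \<subseteq> N"
      using N unfolding p0_def by (elim open_prod_elim) auto
    obtain n where n: "hist_nbhd n \<psi>0 \<subseteq> N2" using hist_nbhd_base[OF N12(2,4)] .
    obtain d where d: "d > 0" "ball s0 d \<subseteq> N1" using N12(1,3) open_contains_ball by blast
    obtain K where K: "n \<le> K" "1 / (real K + 1) < d" using obtain_nat_inverse_less[OF d(1)] .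
    have "A k \<subseteq> N" if k: "k \<ge> K" for k
    proof -
      have "1 / (real k + 1) \<le> 1 / (real K + 1)" using k by (intro divide_left_mono) auto
      then have "ball s0 (1 / (real k + 1)) \<subseteq> N1" using K d by (auto simp: subset_iff)
      moreover have "hist_nbhd k \<psi>0 \<subseteq> N2" using n hist_nbhd_mono[of n k] K k by auto
      ultimately show ?thesis using N12 unfolding A_def by blast
    qed
    then show ?thesis by blast
  qed
  have near: "\<exists>k. \<forall>p\<in>A k \<inter> V. \<forall>\<zeta>\<in>hist_nbhd k \<zeta>0. dist (D p \<zeta>) (D p0 \<zeta>0) < e" if e: "e > 0" for e
  proof (rule ccontr)
    assume "\<not> ?thesis"
    then have "\<forall>k. \<exists>p \<zeta>. p \<in> A k \<inter> V \<and> \<zeta> \<in> hist_nbhd k \<zeta>0 \<and> \<not> dist (D p \<zeta>) (D p0 \<zeta>0) < e" by blast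
    then obtain p \<zeta> where p: "\<And>k. p k \<in> A k" "\<And>k. p k \<in> V" and \<zeta>: "\<And>k. \<zeta> k \<in> hist_nbhd k \<zeta>0"
      and far: "\<And>k. \<not> dist (D (p k) (\<zeta> k)) (D p0 \<zeta>0) < e" by (metis IntD1 IntD2)
    have "hist_bounded (range \<zeta>)"
      unfolding hist_bounded_def
    proof
      fix n :: nat
      have bd: "\<exists>M. \<forall>u\<in>{- real n..0}. norm (hist_apply v u) \<le> M" for v :: "'b hist"
        by (rule hist_bounded_on[of n v]) blast
      then have "\<forall>k. \<exists>M. \<forall>u\<in>{- real n..0}. norm (hist_apply (\<zeta> k) u) \<le> M" by blast
      then obtain M where M: "\<And>k u. u \<in> {- real n..0} \<Longrightarrow> norm (hist_apply (\<zeta> k) u) \<le> M k"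
        by metis
      obtain M0 where M0: "\<And>u. u \<in> {- real n..0} \<Longrightarrow> norm (hist_apply \<zeta>0 u) \<le> M0"
        using bd by blast
      \<comment> \<open>Terms with \<open>k > n\<close> stay within 1 of \<open>\<zeta>0\<close> on
        the window of length \<open>n\<close>; the finitely many others are bounded one by
        one.\<close>
      have "norm (hist_apply (\<zeta> k) u) \<le> max (M0 + 1) (Max (M ` {..n}))" if u: "u \<in> {- real n..0}" for k u
      proof (cases "k \<le> n")
        case True
        have "norm (hist_apply (\<zeta> k) u) \<le> M k" by (rule M[OF u])
        also have "\<dots> \<le> Max (M ` {..n})" using True by (intro Max_ge) auto
        finally show ?thesis by simp
      next
        case False
        have "\<zeta> k \<in> hist_nbhd n \<zeta>0" using \<zeta> hist_nbhd_mono[of n k] False by fastforce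
        then have "norm (hist_apply (\<zeta> k) u - hist_apply \<zeta>0 u) < 1 / (real n + 1)"
          using u by (simp add: hist_nbhd_def)
        also have "\<dots> \<le> 1" by simp
        finally show ?thesis
          using M0[OF u] norm_triangle_ineq2[of "hist_apply (\<zeta> k) u" "hist_apply \<zeta>0 u"] by simp
      qed
      then show "\<exists>M. \<forall>v\<in>range \<zeta>. \<forall>u\<in>{- real n..0}. norm (hist_apply v u) \<le> M" by blast
    qed
    then have "D_equicont V D (range \<zeta>)" unfolding D_def by (rule C1_F_imp_D_equicont[OF V g])
    moreover have "e / 2 > 0" "p0 \<in> V" using e P by (auto simp: p0_def)
    ultimately have "\<exists>N. open N \<and> p0 \<in> N \<and> (\<forall>q\<in>N \<inter> V. \<forall>\<zeta>\<in>range \<zeta>. norm (D q \<zeta> - D p0 \<zeta>) < e / 2)"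
      unfolding D_equicont_def by blast
    then obtain N where N: "open N" "p0 \<in> N" "\<And>q k. q \<in> N \<Longrightarrow> q \<in> V \<Longrightarrow> norm (D q (\<zeta> k) - D p0 (\<zeta> k)) < e / 2"
      by auto
    obtain K where K: "\<And>k. k \<ge> K \<Longrightarrow> A k \<subseteq> N" using A_base[OF N(1,2)] by blast
    \<comment> \<open>Equicontinuity handles the change of the point at direction
      \<open>\<zeta> k\<close>. The other half of \<open>e\<close> goes to the change of direction
      at the fixed point \<open>p0\<close>, where continuity of the linear map suffices.\<close>
    have "continuous_on UNIV (dir_deriv g p0)"
      using g P by (auto simp: C1_F_def continuous_linear_maps_def p0_def)
    then have "continuous_on UNIV (D p0)"
      unfolding D_def by (rule continuous_on_compose2) (auto intro!: continuous_intros)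
    then have "open (D p0 -` ball (D p0 \<zeta>0) (e / 2))" by (intro open_vimage open_ball)
    then obtain n where n: "hist_nbhd n \<zeta>0 \<subseteq> D p0 -` ball (D p0 \<zeta>0) (e / 2)"
      using hist_nbhd_base[of _ \<zeta>0] e by (metis centre_in_ball half_gt_zero vimageI2)
    define k where "k = max K n"
    have "p k \<in> N" using K[of k] p(1)[of k] unfolding k_def by auto
    then have "norm (D (p k) (\<zeta> k) - D p0 (\<zeta> k)) < e / 2" using N(3) p(2) by blast
    moreover have "\<zeta> k \<in> hist_nbhd n \<zeta>0" using \<zeta>[of k] hist_nbhd_mono[of n k] by (auto simp: k_def)
    then have "dist (D p0 (\<zeta> k)) (D p0 \<zeta>0) < e / 2" using n by (auto simp: dist_commute)
    ultimately have "dist (D (p k) (\<zeta> k)) (D p0 \<zeta>0) < e"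
      using dist_triangle[of "D (p k) (\<zeta> k)" "D p0 \<zeta>0" "D p0 (\<zeta> k)"] by (simp add: dist_norm)
    with far show False by blast
  qed
  show "((\<lambda>(p, \<zeta>). dir_deriv g p (0, \<zeta>)) \<longlongrightarrow> (case P of (p, \<zeta>) \<Rightarrow> dir_deriv g p (0, \<zeta>))) (at P within V \<times> UNIV)"
  proof (rule tendstoI)
    fix e :: real assume "e > 0"
    then obtain k where k: "\<And>p \<zeta>. p \<in> A k \<Longrightarrow> p \<in> V \<Longrightarrow> \<zeta> \<in> hist_nbhd k \<zeta>0 \<Longrightarrow> dist (D p \<zeta>) (D p0 \<zeta>0) < e"
      using near by blast
    have "P \<in> A k \<times> hist_nbhd k \<zeta>0" by (simp add: P A_def)
    moreover have "open (A k \<times> hist_nbhd k \<zeta>0)" by (intro open_Times openA open_hist_nbhd)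
    ultimately show "\<forall>\<^sub>F x in at P within V \<times> UNIV. dist (case x of (p, \<zeta>) \<Rightarrow> dir_deriv g p (0, \<zeta>))
        (case P of (p, \<zeta>) \<Rightarrow> dir_deriv g p (0, \<zeta>)) < e"
      unfolding eventually_at_topological
      using k by (intro exI[of _ "A k \<times> hist_nbhd k \<zeta>0"]) (auto simp: D_def P(1) p0_def)
  qed
qed

section \<open>Linearity, bounded families of variational solutions, and the case
  \<open>C1_F\<close>\<close>

locale vector_fde_F = vector_fde V g D
  for V :: "(real \<times> (real ^ 'n::finite) hist) set" and g D +
  assumes linear_D: "\<And>p. p \<in> V \<Longrightarrow> linear (D p)"
    and D_equicont_bounded: "\<And>B. hist_bounded B \<Longrightarrow> D_equicont V D B"
begin

lemma hist_at_linear_combination: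
  assumes "continuous_on UNIV (w :: real \<Rightarrow> real ^ 'n)" "continuous_on UNIV z"
  shows "hist_at (\<lambda>r. w r + c *\<^sub>R z r) s = hist_at w s + c *\<^sub>R hist_at z s"
proof (rule hist_eqI)
  have "continuous_on UNIV (\<lambda>r. w r + c *\<^sub>R z r)" by (intro continuous_intros assms)
  then show "hist_apply (hist_at (\<lambda>r. w r + c *\<^sub>R z r) s) u = hist_apply (hist_at w s + c *\<^sub>R hist_at z s) u"
    if "u \<le> 0" for u
    using that assms by (simp add: hist_apply_simps hist_apply_hist_at_UNIV)
qed

lemma lin_sol_linear_combination:
  assumes x: "sol a b x" and w: "lin_sol a b x w" and z: "lin_sol a b x z"
  shows "lin_sol a b x (\<lambda>r. w r + c *\<^sub>R z r)"
proof -
  have cw: "continuous_on UNIV w" and cz: "continuous_on UNIV z" using w z by (auto simp: lin_sol_def)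
  show ?thesis
    unfolding lin_sol_def
  proof (intro conjI ballI)
    show "continuous_on UNIV (\<lambda>r. w r + c *\<^sub>R z r)" by (intro continuous_intros cw cz)
    fix t assume t: "t \<in> {a..b}"
    then have "linear (D (t, hist_at x t))" using x by (intro linear_D) (auto simp: sol_def)
    then have "D (t, hist_at x t) (hist_at (\<lambda>r. w r + c *\<^sub>R z r) t) =
        D (t, hist_at x t) (hist_at w t) + c *\<^sub>R D (t, hist_at x t) (hist_at z t)"
      by (simp add: hist_at_linear_combination[OF cw cz] linear_add linear_scale)
    then show "((\<lambda>r. w r + c *\<^sub>R z r) has_vector_derivative
        D (t, hist_at x t) (hist_at (\<lambda>r. w r + c *\<^sub>R z r) t)) (at t within {a..b})"
      using w z t
      by (auto simp: lin_sol_def intro!: has_vector_derivative_add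
          bounded_linear.has_vector_derivative[OF bounded_linear_scaleR_right])
  qed
qed

text \<open>Linear combinations of variational solutions along the same \<open>x\<close> are
  variational solutions whose initial histories combine in the same way.\<close>

lemma linear_process_dir_deriv:
  assumes "\<phi> \<in> process_dom_at V g t t0"
  shows "linear (dir_deriv (process V g t t0) \<phi>)"
proof -
  obtain b b' x where x: "t0 \<le> t" "t < b'" "b' < b" "sol t0 b x" "hist_at x t0 = \<phi>"
    using process_dom_at_cases[OF assms] .
  have x': "sol t0 b' x" using sol_subinterval[OF x(4)] x by simp
  let ?P = "dir_deriv (process V g t t0) \<phi>"
  have comb: "?P (v + c *\<^sub>R v') = ?P v + c *\<^sub>R ?P v'" for v v' c
  proof -
    obtain w where w: "lin_sol t0 b' x w" "hist_at w t0 = v" using lin_sol_exists[OF x'] x by auto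
    obtain z where z: "lin_sol t0 b' x z" "hist_at z t0 = v'" using lin_sol_exists[OF x'] x by auto
    have cw: "continuous_on UNIV w" and cz: "continuous_on UNIV z" using w z by (auto simp: lin_sol_def)
    note eq = process_dir_deriv_eq[OF x(4,1,2,3), unfolded x(5)]
    show ?thesis
      using eq[OF w(1)] eq[OF z(1)] eq[OF lin_sol_linear_combination[OF x' w(1) z(1), of c]] w(2) z(2)
      by (simp add: hist_at_linear_combination[OF cw cz])
  qed
  show ?thesis
  proof (rule linearI)
    show "?P (v + v') = ?P v + ?P v'" for v v' using comb[of v 1 v'] by simp
    have "?P 0 = 0" using comb[of 0 1 0] by simp
    then show "?P (c *\<^sub>R v) = c *\<^sub>R ?P v" for c v using comb[of 0 c v] by simp
  qed
qed

text \<open>Comparison with the zero solution by \<open>lin_sol_gronwall\<close>. The bound depends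
  on the initial history only through its supremum over a window of length \<open>n \<ge> k\<close>,
  which is bounded on \<open>B\<close>.\<close>

lemma lin_sol_bounded:
  assumes x: "sol a b x" and ab: "a \<le> b" and B: "hist_bounded B"
  shows "hist_bounded {hist_at z s |z s. lin_sol a b x z \<and> hist_at z a \<in> B \<and> s \<in> {a..b}}"
  unfolding hist_bounded_def
proof
  fix k :: nat
  have cx: "continuous_on UNIV x" and Vx: "\<And>s. s \<in> {a..b} \<Longrightarrow> (s, hist_at x s) \<in> V"
    using x by (auto simp: sol_def)
  obtain n where n: "k \<le> n" "1 \<le> n" "tube x a b n" using tube_exists[OF cx Vx, of a b k] by blast
  obtain M0 where M0: "\<And>v u. v \<in> B \<Longrightarrow> u \<in> {- real n..0} \<Longrightarrow> norm (hist_apply v u) \<le> M0"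
    using B unfolding hist_bounded_def by blast
  define M where "M = \<bar>M0\<bar>"
  have "norm (hist_apply (hist_at z s) u) \<le> 2 * (M + 0) * exp (2 * real n * (b - a))"
    if z: "lin_sol a b x z" "hist_at z a \<in> B" and s: "s \<in> {a..b}" and u: "u \<in> {- real k..0}" for z s u
  proof -
    have cz: "continuous_on UNIV z" using z by (simp add: lin_sol_def)
    have D0: "D (s, hist_at x s) (hist_at (\<lambda>_. 0) s) = 0" if "s \<in> {a..b}" for s
    proof -
      have "hist_at (\<lambda>_. 0 :: real ^ 'n) s = 0"
        by (rule hist_eqI) (simp add: hist_apply_hist_at hist_apply_simps)
      then show ?thesis using linear_0[OF linear_D[OF Vx[OF that]]] by simp
    qed
    have "norm (z (s + u) - 0) \<le> 2 * (M + 0) * exp (2 * real n * (b - a))"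
    proof (rule lin_sol_gronwall[OF ab n(3,2) hist_nbhd_self z(1), where z = "\<lambda>_. 0" and h = "\<lambda>_. 0"])
      show "norm (z r - 0) \<le> M" if "r \<in> {a - real n..a}" for r
        using M0[OF z(2), of "r - a"] that hist_apply_hist_at_UNIV[OF cz, of "r - a" a]
        by (auto simp: M_def)
    qed (use s u n D0 in \<open>auto simp: M_def intro!: derivative_eq_intros\<close>)
    then show ?thesis using u by (simp add: hist_apply_hist_at_UNIV[OF cz])
  qed
  then show "\<exists>M. \<forall>v\<in>{hist_at z s |z s. lin_sol a b x z \<and> hist_at z a \<in> B \<and> s \<in> {a..b}}.
      \<forall>u\<in>{- real k..0}. norm (hist_apply v u) \<le> M" by blast
qed

text \<open>Continuity of each derivative as a linear map is inherited from \<open>C1_MB\<close>.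
  For continuity into the space of linear maps, a neighbourhood given by a bounded set
  \<open>B\<close> is met by taking for \<open>W\<close> all segments of variational solutions that
  start in \<open>B\<close>.\<close>

lemma C1_F_process:
  assumes t: "t0 \<le> t"
  shows "C1_F (process_dom_at V g t t0) (\<lambda>\<phi>. process V g t t0 \<phi>)"
proof -
  let ?O = "process_dom_at V g t t0" and ?P = "process V g t t0"
  have MB: "C1_MB ?O ?P" by (rule C1_MB_process[OF t])
  have clm: "dir_deriv ?P \<phi> \<in> continuous_linear_maps" if \<phi>: "\<phi> \<in> ?O" for \<phi>
  proof -
    have "continuous_on (?O \<times> UNIV) (\<lambda>(\<phi>, v). dir_deriv ?P \<phi> v)" using MB by (simp add: C1_MB_def)
    then have "continuous_on UNIV (\<lambda>v. (\<lambda>(\<phi>, v). dir_deriv ?P \<phi> v) (\<phi>, v))"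
      by (rule continuous_on_compose2) (use \<phi> in \<open>auto intro!: continuous_intros\<close>)
    then show ?thesis
      using linear_process_dir_deriv[OF \<phi>] by (simp add: continuous_linear_maps_def)
  qed
  have "\<exists>T. openin (top_of_set ?O) T \<and> \<phi> \<in> T \<and> T \<subseteq> {\<phi> \<in> ?O. dir_deriv ?P \<phi> \<in> U}"
    if U: "openin Lc_topology U" and \<phi>: "\<phi> \<in> ?O" "dir_deriv ?P \<phi> \<in> U" for U \<phi>
  proof -
    have "\<exists>B N. tvs_bounded B \<and> open N \<and> 0 \<in> N \<and>
        {A' \<in> continuous_linear_maps. \<forall>v\<in>B. A' v - dir_deriv ?P \<phi> v \<in> N} \<subseteq> U"
      using bspec[OF conjunct2[OF U[unfolded openin_Lc_topology Lc_open_def]] \<phi>(2)] .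
    then obtain B N where BN: "tvs_bounded B" "open N" "0 \<in> N"
      "{A' \<in> continuous_linear_maps. \<forall>v\<in>B. A' v - dir_deriv ?P \<phi> v \<in> N} \<subseteq> U"
      by (elim exE conjE)
    obtain n where n: "hist_nbhd n 0 \<subseteq> N" using hist_nbhd_base[OF BN(2,3)] .
    obtain b b' x where x: "t0 \<le> t" "t < b'" "b' < b" "sol t0 b x" "hist_at x t0 = \<phi>"
      using process_dom_at_cases[OF \<phi>(1)] .
    have t0b': "t0 \<le> b'" using x by simp
    have x': "sol t0 b' x" using sol_subinterval[OF x(4)] x by simp
    define W where "W = {hist_at z s |z s. lin_sol t0 b' x z \<and> hist_at z t0 \<in> B \<and> s \<in> {t0..b'}}"
    have "hist_bounded B" unfolding hist_bounded_def using tvs_bounded_hist_imp[OF BN(1)] by blast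
    then have "D_equicont V D W"
      unfolding W_def by (intro D_equicont_bounded lin_sol_bounded x' t0b')
    then obtain m where m: "\<And>\<phi> z v. \<phi> \<in> hist_nbhd m (hist_at x t0) \<Longrightarrow> lin_sol t0 b' x z \<Longrightarrow>
        (\<And>s. s \<in> {t0..b'} \<Longrightarrow> hist_at z s \<in> W) \<Longrightarrow> v \<in> hist_nbhd m (hist_at z t0) \<Longrightarrow>
        dir_deriv ?P \<phi> v \<in> hist_nbhd n (hist_at z t)"
      using process_dir_deriv_near[OF x(4,1,2,3), of W n] by blast
    have "dir_deriv ?P \<phi>' \<in> U" if \<phi>': "\<phi>' \<in> ?O" "\<phi>' \<in> hist_nbhd m \<phi>" for \<phi>'
    proof -
      have "dir_deriv ?P \<phi>' v - dir_deriv ?P \<phi> v \<in> N" if v: "v \<in> B" for v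
      proof -
        obtain z where z: "lin_sol t0 b' x z" "hist_at z t0 = v" using lin_sol_exists[OF x' t0b'] .
        have "dir_deriv ?P \<phi> v = hist_at z t"
          using process_dir_deriv_eq[OF x(4,1,2,3) z(1)] x z by simp
        moreover have "dir_deriv ?P \<phi>' v \<in> hist_nbhd n (hist_at z t)"
          using \<phi>' x z v by (intro m[OF _ z(1)]) (auto simp: W_def)
        ultimately have "dir_deriv ?P \<phi>' v - dir_deriv ?P \<phi> v \<in> hist_nbhd n 0"
          by (simp add: hist_nbhd_def hist_apply_simps)
        then show ?thesis using n by blast
      qed
      then show ?thesis using BN(4) clm[OF \<phi>'(1)] by blast
    qed
    then show ?thesis
      using \<phi>(1) open_hist_nbhd[of m \<phi>]
      by (intro exI[of _ "?O \<inter> hist_nbhd m \<phi>"]) (auto intro: openin_open_Int)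
  qed
  then have "openin (top_of_set ?O) {\<phi> \<in> ?O. dir_deriv ?P \<phi> \<in> U}" if "openin Lc_topology U" for U
    using that by (subst openin_subopen) blast
  then have "continuous_map (top_of_set ?O) Lc_topology (dir_deriv ?P)"
    using clm by (simp add: continuous_map_def topspace_Lc_topology)
  then show ?thesis using MB clm unfolding C1_F_def C1_MB_def by blast
qed

end

lemma dir_quotient_tendsto_dir_deriv:
  assumes "has_dir_deriv h u v"
  shows "(dir_quotient h u v \<longlongrightarrow> dir_deriv h u v) (at 0)"
proof -
  obtain w where w: "(dir_quotient h u v \<longlongrightarrow> w) (at 0)"
    using assms unfolding has_dir_deriv_def by blast
  then have "dir_deriv h u v = w"
    unfolding dir_deriv_def by (intro tendsto_Lim) simp
  with w show ?thesis by simp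
qed

text \<open>Non-emptiness of \<open>process_dom_at\<close> is tied to an element of
  \<open>Omega_g_at\<close> with first component \<open>time_hist t0\<close>. Other elements say
  nothing about the starting time \<open>t0\<close>: for \<open>V = {(r, \<phi>). r > 5}\<close> and
  \<open>t = t0 = 0\<close> the set \<open>Omega_g_at V g 0\<close> contains every
  \<open>(time_hist 6, \<phi>)\<close>, while \<open>process_dom_at V g 0 0\<close> is
  empty.\<close>

theorem mainTheorem4:
  fixes V :: "(real \<times> (real ^ 'n::finite) hist) set"
    and g :: "real \<times> (real ^ 'n) hist \<Rightarrow> real ^ 'n"
    and star :: smoothness
  assumes "open V" and "C1_smooth star V g"
  shows "openin (top_of_set {(t, t0, \<phi>). t0 \<le> t}) (process_dom V g) \<and>
    continuous_on (process_dom V g) (\<lambda>(t, t0, \<phi>). process V g t t0 \<phi>) \<and>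
    (\<forall>t t0. t0 \<le> t \<and> Omega_g_at V g (t - t0) \<noteq> {} \<longrightarrow>
       process_dom_at V g t t0 = {\<phi>. (time_hist t0, \<phi>) \<in> Omega_g_at V g (t - t0)} \<and>
       (Omega_g_at V g (t - t0) \<inter> {time_hist t0} \<times> UNIV \<noteq> {} \<longrightarrow>
          process_dom_at V g t t0 \<noteq> {}) \<and>
       open (process_dom_at V g t t0) \<and>
       C1_smooth star (process_dom_at V g t t0) (\<lambda>\<phi>. process V g t t0 \<phi>))"
proof -
  define D where "D = (\<lambda>p \<zeta>. dir_deriv g p (0, \<zeta>))"
  have g: "continuous_on V g" "\<And>u v. u \<in> V \<Longrightarrow> has_dir_deriv g u v"
    using assms(2) unfolding C1_MB_def C1_F_def by (cases star; auto simp: C1_MB_def C1_F_def)+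
  have cont_D: "continuous_on (V \<times> UNIV) (\<lambda>(p, \<zeta>). D p \<zeta>)"
  proof (cases star)
    case MB
    then have "continuous_on (V \<times> UNIV) (\<lambda>(u, v). dir_deriv g u v)"
      using assms(2) by (simp add: C1_MB_def)
    then have "continuous_on (V \<times> UNIV) (\<lambda>q. (\<lambda>(u, v). dir_deriv g u v) (fst q, (0, snd q)))"
      by (rule continuous_on_compose2) (auto intro!: continuous_intros)
    then show ?thesis by (simp add: D_def split_def)
  next
    case F
    then show ?thesis
      using C1_F_imp_continuous_on_dir_deriv[OF assms(1), of g] assms(2) by (simp add: D_def)
  qed
  interpret vector_fde V g D
  proof
    show "(dir_quotient g p (0, \<zeta>) \<longlongrightarrow> D p \<zeta>) (at 0)" if "p \<in> V" for p \<zeta>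
      unfolding D_def by (intro dir_quotient_tendsto_dir_deriv g that)
  qed (use assms(1) g(1) cont_D in simp_all)
  have dom_at: "process_dom_at V g t t0 = {\<phi>. (time_hist t0, \<phi>) \<in> Omega_g_at V g (t - t0)}" if "t0 \<le> t" for t t0
    using that by (auto simp: process_dom_at_def process_dom_def Omega_g_at_def Omega_g_def)
  have "C1_smooth star (process_dom_at V g t t0) (\<lambda>\<phi>. process V g t t0 \<phi>)" if t: "t0 \<le> t" for t t0
  proof (cases star)
    case MB
    then show ?thesis using C1_MB_process[OF t] by simp
  next
    case F
    then have gF: "C1_F V g" using assms(2) by simp
    have linear_D: "linear (D p)" if "p \<in> V" for p
    proof -
      have "linear (dir_deriv g p)" using gF that by (simp add: C1_F_def continuous_linear_maps_def)
      moreover have "linear (Pair 0 :: (real ^ 'n) hist \<Rightarrow> real \<times> (real ^ 'n) hist)"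
        by (intro linearI) auto
      ultimately have "linear (dir_deriv g p \<circ> Pair 0)" by (intro linear_compose)
      then show ?thesis by (simp add: D_def o_def)
    qed
    interpret vector_fde_F V g D
    proof (intro vector_fde_F.intro vector_fde_F_axioms.intro vector_fde_axioms)
      show "linear (D p)" if "p \<in> V" for p using linear_D[OF that] .
      show "D_equicont V D B" if "hist_bounded B" for B
        unfolding D_def by (rule C1_F_imp_D_equicont[OF assms(1) gF that])
    qed
    show ?thesis using C1_F_process[OF t] F by simp
  qed
  then show ?thesis
    using openin_process_dom continuous_on_process open_process_dom_at dom_at by auto
qed

end
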